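(* Put $W(\xi)=e^{\Theta(\xi)}$ with $\Theta(\xi)=\frac{|\xi|}{\log(e+|\xi|)}$. There is an absolute constant $A>0$ such that the following holds for all $\gamma\in(0,1)$, $\alpha\in(0,1]$ and $C_W>1$. If $f\in L^2(\mathbb{R})$ satisfies $$\int_{\mathbb{R}}|\widehat f(\xi)\,W(|\xi|)^{\alpha}|^2\,dm_1(\xi)\le C_W^2\|f\|_{L^2(\mathbb{R})}^2,$$ and $E\subset\mathbb{R}$ is $(\gamma,1)$-relatively dense, then $$\|f\|_{L^2(\mathbb{R})}\le\Bigl(\frac{A}{\gamma}\Bigr)^{(\log[A\cdot C_W])^{e^{A/\alpha}}}\|f\|_{L^2(E)}.$$
   Context: $m_1$ is Lebesgue measure on $\mathbb{R}$. The Fourier transform on $L^2(\mathbb{R})$ is the extension of $\widehat f(\xi)=\int_{\mathbb{R}}f(t)e^{-2\pi i\xi t}\,dm_1(t)$. A Borel set $E\subset\mathbb{R}$ is $(\gamma,1)$-relatively dense if $m_1(E\cap I)\ge\gamma$ for any interval $I\subset\mathbb{R}$ of length $1$. *)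

theory Defs
  imports "HOL-Analysis.Analysis"
begin

definition in_L1 :: "(real \<Rightarrow> complex) \<Rightarrow> bool" where
  "in_L1 f \<longleftrightarrow> integrable lebesgue f"

definition in_L2 :: "(real \<Rightarrow> complex) \<Rightarrow> bool" where
  "in_L2 f \<longleftrightarrow> f \<in> borel_measurable lebesgue \<and> integrable lebesgue (\<lambda>x. (cmod (f x))\<^sup>2)"

definition L2_norm_on :: "real set \<Rightarrow> (real \<Rightarrow> complex) \<Rightarrow> real" where
  "L2_norm_on E f = sqrt (LINT x:E|lebesgue. (cmod (f x))\<^sup>2)"

text \<open>Stated with the extended nonnegative integral, so that a difference that is not square
  integrable counts as being at infinite distance (the Bochner integral would return 0).\<close>

definition L2_tendsto :: "(nat \<Rightarrow> real \<Rightarrow> complex) \<Rightarrow> (real \<Rightarrow> complex) \<Rightarrow> bool" where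
  "L2_tendsto u f \<longleftrightarrow>
     (\<lambda>n. \<integral>\<^sup>+ x. ennreal ((cmod (u n x - f x))\<^sup>2) \<partial>lebesgue) \<longlonglongrightarrow> 0"

definition fourier_L1 :: "(real \<Rightarrow> complex) \<Rightarrow> real \<Rightarrow> complex" where
  "fourier_L1 f \<xi> =
     (LINT t|lebesgue. f t * exp (- 2 * complex_of_real pi * \<i> * complex_of_real \<xi> * complex_of_real t))"

text \<open>The Fourier transform on \<open>L\<^sup>2\<close> is the continuous extension of \<open>fourier_L1\<close> from
  \<open>L\<^sup>1 \<inter> L\<^sup>2\<close>. Elements of \<open>L\<^sup>2\<close> are represented by functions, so the
  transform is a relation: \<open>g\<close> may be any representative, and it is unique up to null sets.\<close>

definition has_fourier_L2 :: "(real \<Rightarrow> complex) \<Rightarrow> (real \<Rightarrow> complex) \<Rightarrow> bool" where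
  "has_fourier_L2 f g \<longleftrightarrow> in_L2 f \<and> in_L2 g \<and>
     (\<exists>u. (\<forall>n. in_L1 (u n) \<and> in_L2 (u n)) \<and> L2_tendsto u f \<and> L2_tendsto (\<lambda>n. fourier_L1 (u n)) g)"

definition relatively_dense :: "real \<Rightarrow> real set \<Rightarrow> bool" where
  "relatively_dense \<gamma> E \<longleftrightarrow> E \<in> sets borel \<and>
     (\<forall>I. is_interval I \<and> emeasure lebesgue I = 1 \<longrightarrow> emeasure lebesgue (E \<inter> I) \<ge> ennreal \<gamma>)"

definition Theta :: "real \<Rightarrow> real" where
  "Theta \<xi> = \<bar>\<xi>\<bar> / ln (exp 1 + \<bar>\<xi>\<bar>)"

definition W :: "real \<Rightarrow> real" where
  "W \<xi> = exp (Theta \<xi>)"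

end

theory Submission
  imports Defs "HOL-Probability.Probability"
begin

text \<open>The decay of the transform makes \<open>f\<close> smooth with \<open>\<parallel>f\<^sup>(\<^sup>n\<^sup>)\<parallel> \<le> C\<^sub>W P\<^sub>n \<parallel>f\<parallel>\<close>, where
  \<open>P\<^sub>n / P\<^sub>n\<^sub>-\<^sub>1\<close> is of order \<open>n ln n / \<alpha>\<close>; on most unit intervals (by mass) the same bounds, with a factor
  \<open>2\<^sup>n\<^sup>+\<^sup>1\<close>, hold locally. The class is quasianalytic because \<open>\<Sum> \<alpha> / (n ln n)\<close> diverges, and Bang's
  argument shows that at every point of such an interval some derivative of order below \<open>N\<close> is not small,
  where \<open>ln N\<close> is about \<open>ln (ln C\<^sub>W) * exp (c / \<alpha>)\<close>. A sublevel set estimate for functions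
  with one large derivative then bounds the set where \<open>f\<close> is small by half of \<open>\<gamma>\<close>.\<close>

section \<open>Sublevel sets and Bang's argument\<close>

text \<open>The partial sums of 1 / (n ln n) grow like ln ln n, so steps of total length 1 between
  levels K and N need ln ln N - ln ln K of size c / \<alpha>, that is, N about K to the power exp (c
  / \<alpha>). This is where the exponential of A / \<alpha> in the exponent comes from. The
  sublevel estimate raises \<delta> to the power N, and \<delta> is itself \<gamma> over a quantity
  exponential in N, so the loss is A / \<gamma> to a power of order N^2; the square is absorbed by
  enlarging A. The obstacle on the analytic side is that f is only square integrable and its
  transform is a relation up to null sets, so there are no derivatives to begin with. They are built
  as inverse Fourier integrals of powers of \<xi> times the transform, and the one of order 0 is
  identified with f almost everywhere by testing against Gaussians. For their norms the inequality
  half of Plancherel suffices. Bad intervals are never removed: their mass is charged to a weighted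
  sum over all derivatives, so that a single inequality holds on every unit interval and can be
  summed.\<close>

lemma is_interval_monotone_preimage:
  fixes v :: "real \<Rightarrow> real"
  assumes J: "is_interval J" and I: "is_interval I"
    and mono: "\<And>x y. x \<in> J \<Longrightarrow> y \<in> J \<Longrightarrow> x \<le> y \<Longrightarrow> v x \<le> v y"
  shows "is_interval {x\<in>J. v x \<in> I}"
  unfolding is_interval_1
proof (intro ballI allI impI, elim conjE)
  fix a b x assume *: "a \<in> {x\<in>J. v x \<in> I}" "b \<in> {x\<in>J. v x \<in> I}" "a \<le> x" "x \<le> b"
  hence x: "x \<in> J" using J unfolding is_interval_1 by blast
  moreover have "v a \<le> v x" "v x \<le> v b" using * x mono by auto
  hence "v x \<in> I" using * I unfolding is_interval_1 by blast
  ultimately show "x \<in> {x\<in>J. v x \<in> I}" by blast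
qed

lemma emeasure_interval_le:
  fixes J :: "real set"
  assumes J: "is_interval J" and d: "\<And>x y. x \<in> J \<Longrightarrow> y \<in> J \<Longrightarrow> x \<le> y \<Longrightarrow> y - x \<le> d" "0 \<le> d"
  shows "emeasure lborel J \<le> ennreal d"
proof (cases "J = {}")
  case False
  have bd: "bounded J"
  proof -
    obtain z where "z \<in> J" using False by blast
    hence "J \<subseteq> cball z d" using d by (smt (verit) dist_real_def mem_cball subsetI)
    thus ?thesis using bounded_cball bounded_subset by blast
  qed
  have bda: "bdd_above J" "bdd_below J" using bd by (auto simp: bounded_imp_bdd_above bounded_imp_bdd_below)
  have "J \<subseteq> {Inf J..Sup J}" using bda by (auto intro: cInf_lower cSup_upper)
  hence "emeasure lborel J \<le> emeasure lborel {Inf J..Sup J}" by (intro emeasure_mono) auto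
  also have "\<dots> = ennreal (Sup J - Inf J)" using False bda
    by (simp add: cInf_le_cSup)
  also have "\<dots> \<le> ennreal d"
  proof (rule ennreal_leI)
    have "Sup J \<le> y + d" if "y \<in> J" for y using False that d
      by (intro cSup_least) (smt (verit))+
    hence "Sup J - d \<le> Inf J" using False by (intro cInf_greatest) (auto simp: algebra_simps)
    thus "Sup J - Inf J \<le> d" by simp
  qed
  finally show ?thesis .
qed auto

text \<open>Since \<open>u (Suc j) \<ge> l\<close>, the function \<open>u j\<close> is increasing with slope at least \<open>l\<close>, so it exceeds
  \<open>l * \<delta>\<close> in modulus off an interval of length \<open>2 * \<delta>\<close>; the induction hypothesis applies on both sides.\<close>

lemma sublevel_derivative_bound:
  fixes u :: "nat \<Rightarrow> real \<Rightarrow> real"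
  assumes "\<And>k x. (u k has_real_derivative u (Suc k) x) (at x)"
    and "is_interval J" and "0 < l" and "0 < \<delta>"
    and "(\<forall>x\<in>J. l \<le> u j x) \<or> (\<forall>x\<in>J. u j x \<le> - l)"
  shows "emeasure lborel {x\<in>J. \<bar>u 0 x\<bar> < l * \<delta> ^ j} \<le> ennreal (2 * (2 ^ j - 1) * \<delta>)"
  using assms
proof (induction j arbitrary: J l u)
  case 0
  hence "{x\<in>J. \<bar>u 0 x\<bar> < l} = {}" by force
  thus ?case by (simp only: power_0 mult_1_right emeasure_empty) simp
next
  case (Suc j)
  \<comment> \<open>One sign suffices: if \<open>u (Suc j)\<close> is at most \<open>- l\<close>,
    the claim is used for the negated family, which has the same sublevel set.\<close>
  have pos_case: ?case if d: "\<And>k x. (w k has_real_derivative w (Suc k) x) (at x)"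
    and ge: "\<forall>x\<in>J. l \<le> w (Suc j) x" 
    and eq: "{x \<in> J. \<bar>u 0 x\<bar> < l * \<delta> ^ Suc j} = {x \<in> J. \<bar>w 0 x\<bar> < l * \<delta> ^ Suc j}"
    for w :: "nat \<Rightarrow> real \<Rightarrow> real"
  proof -
    have J: "is_interval J" by fact
    have lp: "l > 0" "\<delta> > 0" by fact+
    have slope: "l * (y - x) \<le> w j y - w j x" if xy: "x \<in> J" "y \<in> J" "x \<le> y" for x y
    proof (cases "x = y")
      case False
      hence "x < y" using xy by simp
      then obtain z where z: "z > x" "z < y" "w j y - w j x = (y - x) * w (Suc j) z"
        using MVT2[of x y "w j" "w (Suc j)"] d by blast
      have "z \<in> J" using z xy J unfolding is_interval_1 by (meson less_imp_le)
      hence "l \<le> w (Suc j) z" using ge by blast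
      thus ?thesis using z xy by (simp add: mult.commute mult_left_mono)
    qed auto
    have mono: "w j x \<le> w j y" if "x \<in> J" "y \<in> J" "x \<le> y" for x y
      using slope[OF that] that lp by (smt (verit) mult_nonneg_nonneg)
    define A where "A = {x\<in>J. w j x \<in> {..- (l * \<delta>)}}"
    define B where "B = {x\<in>J. w j x \<in> {l * \<delta>..}}"
    define C where "C = {x\<in>J. w j x \<in> {- (l * \<delta>)<..<l * \<delta>}}"
    have iv: "is_interval A" "is_interval B" "is_interval C"
      unfolding A_def B_def C_def
      by (rule is_interval_monotone_preimage[OF J _ mono]; (assumption | simp add: is_interval_1))+
    have C: "emeasure lborel C \<le> ennreal (2 * \<delta>)"
    proof (rule emeasure_interval_le[OF iv(3)])
      fix x y assume *: "x \<in> C" "y \<in> C" "x \<le> y"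
      hence "l * (y - x) \<le> w j y - w j x" by (intro slope) (auto simp: C_def)
      also have "\<dots> \<le> l * (2 * \<delta>)" using * by (auto simp: C_def)
      finally show "y - x \<le> 2 * \<delta>" using lp by simp
    qed (use lp in auto)
    have cont: "continuous_on UNIV (w 0)" using d
      by (intro DERIV_continuous_on[of _ _ "w 1"]) (auto intro: has_field_derivative_at_within)
    have [measurable]: "w 0 \<in> borel_measurable borel"
      using cont by (rule borel_measurable_continuous_onI)
    have [measurable]: "A \<in> sets borel" "B \<in> sets borel" "C \<in> sets borel" "J \<in> sets borel"
      using iv J real_interval_borel_measurable by auto
    let ?S = "\<lambda>J. {x \<in> J. \<bar>w 0 x\<bar> < (l * \<delta>) * \<delta> ^ j}"
    have AS: "emeasure lborel (?S A) \<le> ennreal (2 * (2 ^ j - 1) * \<delta>)"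
      using lp by (intro Suc.IH[where u = w, OF d iv(1)]) (auto simp: A_def)
    have BS: "emeasure lborel (?S B) \<le> ennreal (2 * (2 ^ j - 1) * \<delta>)"
      using lp by (intro Suc.IH[where u = w, OF d iv(2)]) (auto simp: B_def)
    have "?S J \<subseteq> (?S A \<union> ?S B) \<union> C" by (auto simp: A_def B_def C_def)
    hence "emeasure lborel (?S J) \<le> emeasure lborel ((?S A \<union> ?S B) \<union> C)"
      by (intro emeasure_mono) auto
    also have "\<dots> \<le> emeasure lborel (?S A \<union> ?S B) + emeasure lborel C"
      by (intro emeasure_subadditive) auto
    also have "\<dots> \<le> (emeasure lborel (?S A) + emeasure lborel (?S B)) + emeasure lborel C"
      by (intro add_right_mono emeasure_subadditive) auto
    also have "\<dots> \<le> (ennreal (2 * (2 ^ j - 1) * \<delta>) + ennreal (2 * (2 ^ j - 1) * \<delta>)) + ennreal (2 * \<delta>)"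
      by (intro add_mono AS BS C)
    also have "\<dots> = ennreal (2 * (2 ^ Suc j - 1) * \<delta>)"
    proof -
      have "0 \<le> 2 * (2 ^ j - 1) * \<delta>" using lp by simp
      thus ?thesis using lp by (simp add: ennreal_plus[symmetric] algebra_simps del: ennreal_plus)
    qed
    finally show ?thesis unfolding eq by (simp add: mult.assoc)
  qed
  show ?case
  proof (cases "\<forall>x\<in>J. l \<le> u (Suc j) x")
    case True thus ?thesis using pos_case[of u] Suc.prems by blast
  next
    case False
    hence "\<forall>x\<in>J. l \<le> - u (Suc j) x" using Suc.prems by force
    thus ?thesis using Suc.prems(1) by (intro pos_case[of "\<lambda>k x. - u k x"]) (auto intro: DERIV_minus)
  qed
qed


text \<open>Bang's argument: if \<open>\<bar>u j\<bar> \<le> exp (j - N) * M j\<close> for all \<open>j \<le> N\<close> at one point, the same holds with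
  \<open>N - 1\<close> in place of \<open>N\<close> at distance up to \<open>1 / (e * M N / M (N - 1))\<close>. Moving on in this way,
  one reaches any point of a unit interval once the step lengths add up to 1.\<close>

lemma bang_step:
  fixes u :: "nat \<Rightarrow> real \<Rightarrow> real" and M :: "nat \<Rightarrow> real"
  assumes d: "\<And>k x. (u k has_real_derivative u (Suc k) x) (at x)"
    and Mpos: "\<And>n. 0 < M n" and ratio: "\<And>n. n \<le> K \<Longrightarrow> M (Suc n) \<le> M n * r"
    and bound: "\<And>y. y \<in> {a..b} \<Longrightarrow> \<bar>u (Suc K) y\<bar> \<le> M (Suc K)"
    and x: "x \<in> {a..b}" "x + h \<in> {a..b}" and h: "\<bar>h\<bar> * (exp 1 * r) \<le> 1" and r: "0 < r"
    and small: "\<And>j. j \<le> Suc K \<Longrightarrow> \<bar>u j x\<bar> \<le> exp (real j - real (Suc K)) * M j"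
    and j: "j \<le> K"
  shows "\<bar>u j (x + h)\<bar> \<le> exp (real j - real K) * M j"
proof -
  \<comment> \<open>The Taylor expansion of \<open>u j\<close> stops at order \<open>Suc K\<close>,
    so the remainder is controlled by \<open>bound\<close>, valid on the whole interval, while all
    earlier terms are controlled by \<open>small\<close> at x.\<close>
  define n where "n = Suc K - j"
  have n: "j + n = Suc K" using j by (simp add: n_def)
  define c where "c = exp (real j - real (Suc K)) * M j"
  have c: "c > 0" using Mpos by (simp add: c_def)
  have Mr: "M (j + m) \<le> M j * r ^ m" if "j + m \<le> Suc K" for m
    using that
  proof (induction m)
    case (Suc m)
    have "M (j + Suc m) \<le> M (j + m) * r" using ratio[of "j + m"] Suc.prems by simp
    also have "\<dots> \<le> M j * r ^ m * r" using Suc r by (intro mult_right_mono) auto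
    finally show ?case by (simp add: mult_ac)
  qed auto
  \<comment> \<open>Raising the order by one costs a factor e in the smallness bound and a factor r
    in M; the step length cancels e * r. Hence every Taylor term is at most c / m!, and their sum
    loses a single factor e, exactly the gap between levels \<open>Suc K\<close> and K.\<close>
  have E: "exp (real (j + m) - real (Suc K)) * M (j + m) * \<bar>h\<bar> ^ m \<le> c" if "j + m \<le> Suc K" for m
  proof -
    have "exp (real (j + m) - real (Suc K)) * M (j + m) * \<bar>h\<bar> ^ m
      \<le> exp (real (j + m) - real (Suc K)) * (M j * r ^ m) * \<bar>h\<bar> ^ m"
      by (intro mult_right_mono mult_left_mono Mr that) auto
    also have "\<dots> = c * (\<bar>h\<bar> * (exp 1 * r)) ^ m"
    proof -
      have "exp (real (j + m) - real (Suc K)) = exp (real j - real (Suc K)) * exp 1 ^ m"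
        by (simp add: exp_of_nat_mult[symmetric] exp_add[symmetric])
      thus ?thesis by (simp add: c_def power_mult_distrib mult_ac)
    qed
    also have "\<dots> \<le> c * 1" using c h r by (intro mult_left_mono power_le_one) auto
    finally show ?thesis by simp
  qed
  have T: "\<bar>u (j + m) x / fact m * h ^ m\<bar> \<le> c * (1 / fact m)" if "j + m \<le> Suc K" for m
  proof -
    have "\<bar>u (j + m) x / fact m * h ^ m\<bar> = (\<bar>u (j + m) x\<bar> * \<bar>h\<bar> ^ m) / fact m"
      by (simp add: abs_mult power_abs)
    also have "\<dots> \<le> (exp (real (j + m) - real (Suc K)) * M (j + m) * \<bar>h\<bar> ^ m) / fact m"
      by (intro divide_right_mono mult_right_mono small that) auto
    also have "\<dots> \<le> c / fact m" by (intro divide_right_mono E that) auto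
    finally show ?thesis by simp
  qed
  have "\<exists>t\<in>{a..b}. u j (x + h) = (\<Sum>m<n. u (j + m) x / fact m * h ^ m) + u (j + n) t / fact n * h ^ n"
  proof (cases "h = 0")
    case True
    have "n > 0" using j by (simp add: n_def)
    hence "(\<Sum>m<n. u (j + m) x / fact m * 0 ^ m) = u j x"
      by (simp add: sum.remove[of _ 0] power_0_left)
    with True \<open>n > 0\<close> x show ?thesis by (auto simp: power_0_left)
  next
    case False
    have "\<exists>t. (if x + h < x then x + h < t \<and> t < x else x < t \<and> t < x + h) \<and>
      u j (x + h) = (\<Sum>m<n. u (j + m) x / fact m * (x + h - x) ^ m) + u (j + n) t / fact n * (x + h - x) ^ n"
      using j d x False
      by (intro Taylor[where a = a and b = b and diff = "\<lambda>m. u (j + m)"]) (auto simp: n_def)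
    thus ?thesis using x by (auto split: if_splits)
  qed
  then obtain t where t: "t \<in> {a..b}" and eq:
     "u j (x + h) = (\<Sum>m<n. u (j + m) x / fact m * h ^ m) + u (j + n) t / fact n * h ^ n"
    by blast
  have last: "\<bar>u (j + n) t / fact n * h ^ n\<bar> \<le> c * (1 / fact n)"
  proof -
    have "\<bar>u (j + n) t / fact n * h ^ n\<bar> = (\<bar>u (Suc K) t\<bar> * \<bar>h\<bar> ^ n) / fact n"
      by (simp add: abs_mult power_abs n)
    also have "\<dots> \<le> (M (Suc K) * \<bar>h\<bar> ^ n) / fact n"
      by (intro divide_right_mono mult_right_mono bound t) auto
    also have "\<dots> \<le> c / fact n" using E[of n] n by (intro divide_right_mono) auto
    finally show ?thesis by simp
  qed
  have "\<bar>u j (x + h)\<bar> \<le> (\<Sum>m<n. \<bar>u (j + m) x / fact m * h ^ m\<bar>) + \<bar>u (j + n) t / fact n * h ^ n\<bar>"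
    unfolding eq by (rule order_trans[OF abs_triangle_ineq add_right_mono[OF sum_abs]])
  also have "\<dots> \<le> (\<Sum>m<n. c * (1 / fact m)) + c * (1 / fact n)"
    using n by (intro add_mono sum_mono T last) auto
  also have "\<dots> = c * (\<Sum>m<Suc n. 1 / fact m)" by (simp add: sum_distrib_left algebra_simps)
  also have "\<dots> \<le> c * exp 1"
  proof (intro mult_left_mono)
    have "(\<lambda>m. 1 / fact m) sums exp (1::real)"
      using exp_converges[of "1::real"] by (simp add: divide_inverse mult.commute)
    thus "(\<Sum>m<Suc n. 1 / fact m) \<le> exp (1::real)"
      by (metis sum_le_suminf sums_iff finite_lessThan divide_nonneg_nonneg fact_ge_zero zero_le_one)
  qed (use c in auto)
  also have "\<dots> = exp (real j - real K) * M j" by (simp add: c_def exp_diff exp_add)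
  finally show ?thesis .
qed

lemma bang_propagation:
  fixes u :: "nat \<Rightarrow> real \<Rightarrow> real" and M R :: "nat \<Rightarrow> real"
  assumes d: "\<And>k x. (u k has_real_derivative u (Suc k) x) (at x)"
    and Mpos: "\<And>n. 0 < M n" and ratio: "\<And>n. M (Suc n) \<le> M n * R n"
    and R: "mono R" "\<And>n. 0 < R n"
    and bound: "\<And>n y. y \<in> {a..b} \<Longrightarrow> \<bar>u n y\<bar> \<le> M n"
    and KN: "K \<le> N"
    and y: "y \<in> {a..b}" and x: "x \<in> {a..b}" "\<bar>y - x\<bar> \<le> (\<Sum>n=K..<N. 1 / (exp 1 * R n))"
    and small: "\<And>j. j \<le> N \<Longrightarrow> \<bar>u j x\<bar> \<le> exp (real j - real N) * M j"
  shows "j \<le> K \<Longrightarrow> \<bar>u j y\<bar> \<le> exp (real j - real K) * M j"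
  using KN x small
proof (induction N arbitrary: x j rule: dec_induct)
  case base thus ?case by simp
next
  case (step N)
  \<comment> \<open>The move at the top level comes first, and the induction hypothesis continues
    from x + h. Cutting y - x off at length r means that a target within reach is hit exactly, after
    which all moves have length 0.\<close>
  define r where "r = 1 / (exp 1 * R N)"
  have r: "r > 0" using R by (simp add: r_def)
  define h where "h = (if y - x > r then r else if y - x < - r then - r else y - x)"
  have xh: "x + h \<in> {a..b}" using y step.prems r by (auto simp: h_def)
  have h: "\<bar>h\<bar> * (exp 1 * R N) \<le> 1"
  proof -
    have "\<bar>h\<bar> \<le> r" using r by (auto simp: h_def)
    thus ?thesis using R(2)[of N] by (simp add: r_def field_simps)
  qed
  have "\<bar>y - (x + h)\<bar> \<le> (\<Sum>n=K..<N. 1 / (exp 1 * R n))"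
  proof (cases "\<bar>y - x\<bar> \<le> r")
    case True
    hence "y - (x + h) = 0" by (auto simp: h_def)
    thus ?thesis using R by (auto intro!: sum_nonneg simp: less_imp_le)
  next
    case False
    thus ?thesis using step.prems step.hyps by (auto simp: h_def r_def abs_if split: if_splits)
  qed
  \<comment> \<open>\<open>bang_step\<close> wants one ratio bound for all orders up to N; R
    increases, so \<open>R N\<close> serves.\<close>
  moreover have "M (Suc n) \<le> M n * R N" if "n \<le> N" for n
    using ratio[of n] monoD[OF R(1) that] Mpos[of n]
    by (meson less_imp_le mult_left_mono order_trans)
  hence "\<bar>u j (x + h)\<bar> \<le> exp (real j - real N) * M j" if "j \<le> N" for j
    using that xh h R(2) step.prems d Mpos bound
    by (intro bang_step[of u M N "R N" a b x h j]) auto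
  ultimately show ?case using step.IH[of j "x + h"] step.prems xh by blast
qed


text \<open>If all derivatives of order below N were small at some x, Bang's argument would carry
  the smallness from x to \<open>x0\<close>, where it fails. So every x has a large derivative of
  some order j below N. The interval is cut into \<open>n0\<close> pieces, so short that this
  derivative keeps its sign and half of its guaranteed size on the whole piece; then
  \<open>sublevel_derivative_bound\<close> applies there. The order j may differ from piece to
  piece.\<close>

lemma quasianalytic_sublevel_bound:
  fixes u :: "nat \<Rightarrow> real \<Rightarrow> real" and M R :: "nat \<Rightarrow> real"
  assumes d: "\<And>k x. (u k has_real_derivative u (Suc k) x) (at x)"
    and Mpos: "\<And>n. 0 < M n" and ratio: "\<And>n. M (Suc n) \<le> M n * R n"
    and Mmono: "mono M"
    and R: "mono R" "\<And>n. 0 < R n"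
    and bound: "\<And>n y. y \<in> {a..a+1} \<Longrightarrow> \<bar>u n y\<bar> \<le> M n"
    and KN: "K \<le> N" and S: "1 \<le> (\<Sum>n=K..<N. 1 / (exp 1 * R n))"
    and x0: "x0 \<in> {a..a+1}" "exp (- real K) * M 0 < \<bar>u 0 x0\<bar>"
    and n0: "2 * R N * exp (real N) \<le> real n0" and \<delta>: "0 < \<delta>" "\<delta> \<le> 1"
  shows "emeasure lborel {x\<in>{a..a+1}. \<bar>u 0 x\<bar> < exp (- real N) * M 0 / 2 * \<delta> ^ N}
    \<le> ennreal (real n0 * 2 ^ (N + 1) * \<delta>)"
proof -
  \<comment> \<open>As M increases, 2 * l is below \<open>exp (- real N) * M j\<close> for every j,
    so one threshold serves all pieces.\<close>
  define l where "l = exp (- real N) * M 0 / 2"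
  have l: "l > 0" using Mpos by (simp add: l_def)
  have n0p: "n0 > 0" using n0 R(2)[of N] by (smt (verit) exp_gt_zero mult_pos_pos of_nat_le_0_iff gr0I of_nat_0)
  define Q where "Q i = {a + real i / n0 .. a + real (Suc i) / n0}" for i
  have large: "\<exists>j<N. exp (real j - real N) * M j < \<bar>u j x\<bar>" if x: "x \<in> {a..a+1}" for x
  proof (rule ccontr)
    assume neg: "\<not> ?thesis"
    have *: "\<bar>u j x\<bar> \<le> exp (real j - real N) * M j" if "j < N" for j
      using that neg by (meson not_less)
    \<comment> \<open>At order N the exponential is 1 and the claim is just the global bound; this
      is why the large derivative has order strictly below N.\<close>
    have **: "\<bar>u j x\<bar> \<le> exp (real j - real N) * M j" if "j \<le> N" for j
      using that *[of j] bound[OF x, of N] by (cases "j = N") auto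
    have dist: "\<bar>x0 - x\<bar> \<le> (\<Sum>n=K..<N. 1 / (exp 1 * R n))" 
      using S x x0 by auto
    have "\<bar>u 0 x0\<bar> \<le> exp (real 0 - real K) * M 0"
      by (rule bang_propagation[OF d Mpos ratio R bound KN x0(1) x dist **]) auto
    thus False using x0 by simp
  qed
  have Q: "emeasure lborel {x\<in>Q i. \<bar>u 0 x\<bar> < l * \<delta> ^ N} \<le> ennreal (2 ^ (N + 1) * \<delta>)"
    if i: "i < n0" for i
  proof -
    define y where "y = a + real i / n0"
    have sub: "Q i \<subseteq> {a..a+1}"
    proof -
      have "real (Suc i) / n0 \<le> 1" using i n0p by (simp add: field_simps)
      moreover have "real i / n0 \<ge> 0" by simp
      ultimately show ?thesis unfolding Q_def by (auto simp del: of_nat_Suc)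
    qed
    have yQ: "y \<in> Q i" unfolding y_def Q_def by (simp add: divide_right_mono)
    obtain j where j: "j < N" "exp (real j - real N) * M j < \<bar>u j y\<bar>"
      using large sub yQ by blast
    have lj: "2 * l \<le> exp (- real N) * M j"
      using monoD[OF Mmono, of 0 j] by (simp add: l_def)
    have near: "\<bar>u j x - u j y\<bar> \<le> exp (- real N) * M j / 2" if x: "x \<in> Q i" for x
    proof -
      have "\<bar>u j x - u j y\<bar> \<le> M (Suc j) * \<bar>x - y\<bar>"
      proof -
        have "norm (u j x - u j y) \<le> M (Suc j) * norm (x - y)"
        proof (rule field_differentiable_bound[where S = "Q i" and f' = "u (Suc j)"])
          show "norm (u (Suc j) z) \<le> M (Suc j)" if "z \<in> Q i" for z
            using bound[of z "Suc j"] sub that by auto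
        qed (use d x yQ in \<open>auto simp: Q_def intro: has_field_derivative_at_within\<close>)
        thus ?thesis by simp
      qed
      also have "\<dots> \<le> (M j * R N) * (1 / n0)"
      proof (intro mult_mono)
        show "M (Suc j) \<le> M j * R N"
          using ratio[of j] monoD[OF R(1), of j N] j Mpos[of j]
          by (meson less_imp_le mult_left_mono order_trans)
        show "\<bar>x - y\<bar> \<le> 1 / n0" using x by (auto simp: Q_def y_def add_divide_distrib)
        show "0 \<le> M j * R N" using Mpos[of j] R(2)[of N] by simp
      qed auto
      also have "\<dots> \<le> (M j * R N) * (exp (- real N) / (2 * R N))"
      proof (intro mult_left_mono)
        show "1 / n0 \<le> exp (- real N) / (2 * R N)"
          using n0 n0p R(2)[of N] by (simp add: exp_minus field_simps)
        show "0 \<le> M j * R N" using Mpos[of j] R(2)[of N] by simp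
      qed
      also have "\<dots> = exp (- real N) * M j / 2" using R(2)[of N] by simp
      finally show ?thesis .
    qed
    have uy: "exp (- real N) * M j < \<bar>u j y\<bar>"
    proof -
      have "exp (- real N) * M j \<le> exp (real j - real N) * M j"
        using Mpos[of j] by (intro mult_right_mono) auto
      thus ?thesis using j by linarith
    qed
    have "(\<forall>x\<in>Q i. l \<le> u j x) \<or> (\<forall>x\<in>Q i. u j x \<le> - l)"
    proof (cases "u j y > 0")
      case True
      hence "l \<le> u j x" if "x \<in> Q i" for x using near[OF that] uy lj by linarith
      thus ?thesis by blast
    next
      case False
      hence "u j x \<le> -l" if "x \<in> Q i" for x using near[OF that] uy lj by linarith
      thus ?thesis by blast
    qed
    hence "emeasure lborel {x\<in>Q i. \<bar>u 0 x\<bar> < l * \<delta> ^ j} \<le> ennreal (2 * (2 ^ j - 1) * \<delta>)"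
      using d l \<delta> by (intro sublevel_derivative_bound) (auto simp: Q_def)
    also have "\<dots> \<le> ennreal (2 ^ (N + 1) * \<delta>)"
    proof (intro ennreal_leI mult_right_mono)
      have "(2::real) ^ j \<le> 2 ^ N" using j by (intro power_increasing) auto
      moreover have "2 * (x - 1) \<le> 2 * y" if "x \<le> y" for x y :: real using that by simp
      ultimately have "2 * (2 ^ j - 1) \<le> (2 * 2 ^ N :: real)" by blast
      thus "2 * (2 ^ j - 1) \<le> (2 ^ (N + 1) :: real)" by simp
    qed (use \<delta> in auto)
    finally have *: "emeasure lborel {x\<in>Q i. \<bar>u 0 x\<bar> < l * \<delta> ^ j} \<le> ennreal (2 ^ (N + 1) * \<delta>)" .
    \<comment> \<open>Since \<delta> is at most 1, the power N makes the sublevel set independent of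
      the order found on the piece.\<close>
    have "l * \<delta> ^ N \<le> l * \<delta> ^ j" using l \<delta> j by (intro mult_left_mono power_decreasing) auto
    hence "{x\<in>Q i. \<bar>u 0 x\<bar> < l * \<delta> ^ N} \<subseteq> {x\<in>Q i. \<bar>u 0 x\<bar> < l * \<delta> ^ j}" by auto
    moreover have [measurable]: "u 0 \<in> borel_measurable borel"
      using d by (intro borel_measurable_continuous_onI DERIV_continuous_on[of _ _ "u 1"])
        (auto intro: has_field_derivative_at_within)
    ultimately have "emeasure lborel {x\<in>Q i. \<bar>u 0 x\<bar> < l * \<delta> ^ N} \<le> emeasure lborel {x\<in>Q i. \<bar>u 0 x\<bar> < l * \<delta> ^ j}"
      by (intro emeasure_mono) (auto simp: Q_def)
    thus ?thesis using * by (rule order_trans)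
  qed
  have cover: "{a..a+1} \<subseteq> (\<Union>i<n0. Q i)"
  proof
    fix x assume x: "x \<in> {a..a+1}"
    show "x \<in> (\<Union>i<n0. Q i)"
    proof (cases "x = a + 1")
      case True
      have "a + 1 \<in> Q (n0 - 1)" using n0p by (auto simp: Q_def field_simps of_nat_diff)
      thus ?thesis using True n0p by (intro UN_I[of "n0 - 1"]) auto
    next
      case False
      define i where "i = nat \<lfloor>(x - a) * n0\<rfloor>"
      have nn: "(x - a) * n0 \<ge> 0" using x by simp
      hence ri: "real i = of_int \<lfloor>(x - a) * n0\<rfloor>" by (simp add: i_def)
      have "real i \<le> (x - a) * n0" "(x - a) * n0 < real i + 1" unfolding ri by linarith+
      moreover have "(x - a) * n0 < n0" using x False n0p by simp
      ultimately have "i < n0" "x \<in> Q i"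
        using n0p by (auto simp: Q_def field_simps)
      thus ?thesis by blast
    qed
  qed
  have [measurable]: "u 0 \<in> borel_measurable borel"
    using d by (intro borel_measurable_continuous_onI DERIV_continuous_on[of _ _ "u 1"])
      (auto intro: has_field_derivative_at_within)
  have [measurable]: "Q i \<in> sets borel" for i by (simp add: Q_def)
  have "emeasure lborel {x\<in>{a..a+1}. \<bar>u 0 x\<bar> < l * \<delta> ^ N}
      \<le> emeasure lborel (\<Union>i<n0. {x\<in>Q i. \<bar>u 0 x\<bar> < l * \<delta> ^ N})"
    using cover by (intro emeasure_mono) auto
  also have "\<dots> \<le> (\<Sum>i<n0. emeasure lborel {x\<in>Q i. \<bar>u 0 x\<bar> < l * \<delta> ^ N})"
    by (intro emeasure_subadditive_finite) auto
  also have "\<dots> \<le> (\<Sum>i<n0. ennreal (2 ^ (N + 1) * \<delta>))" by (intro sum_mono Q) auto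
  also have "\<dots> = ennreal (real n0 * 2 ^ (N + 1) * \<delta>)"
    using \<delta> by (simp add: ennreal_mult'' ennreal_of_nat_eq_real_of_nat ennreal_mult mult_ac)
  finally show ?thesis by (simp add: l_def)
qed

section \<open>From L2 averages on a unit interval to pointwise bounds\<close>

lemma continuous_of_vector_derivative:
  fixes F :: "real \<Rightarrow> 'a::real_normed_vector"
  assumes "\<And>x. (F has_vector_derivative G x) (at x)"
  shows "continuous_on S F"
proof (rule continuous_at_imp_continuous_on, rule ballI)
  fix x show "continuous (at x) F" by (rule has_vector_derivative_continuous[OF assms])
qed

lemma exists_le_of_L2_average:
  fixes F :: "real \<Rightarrow> complex"
  assumes F: "continuous_on {a..a+1} F" and t: "0 \<le> t"
    and le: "(\<integral>\<^sup>+x\<in>{a..a+1}. ennreal ((cmod (F x))\<^sup>2) \<partial>lborel) \<le> ennreal (t\<^sup>2)"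
  shows "\<exists>y\<in>{a..a+1}. cmod (F y) \<le> t"
proof -
  have "\<exists>y\<in>{a..a+1}. \<forall>z\<in>{a..a+1}. cmod (F y) \<le> cmod (F z)"
    using F by (intro continuous_attains_inf continuous_intros) auto
  then obtain y where y: "y \<in> {a..a+1}" "\<And>z. z \<in> {a..a+1} \<Longrightarrow> cmod (F y) \<le> cmod (F z)" by blast
  have "ennreal ((cmod (F y))\<^sup>2) = (\<integral>\<^sup>+x\<in>{a..a+1}. ennreal ((cmod (F y))\<^sup>2) \<partial>lborel)"
    by (simp add: nn_integral_cmult_indicator)
  also have "\<dots> \<le> (\<integral>\<^sup>+x\<in>{a..a+1}. ennreal ((cmod (F x))\<^sup>2) \<partial>lborel)"
    by (intro nn_integral_mono) (auto simp: indicator_def intro!: ennreal_leI power_mono y)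
  also have "\<dots> \<le> ennreal (t\<^sup>2)" by fact
  finally have "(cmod (F y))\<^sup>2 \<le> t\<^sup>2" by simp
  hence "cmod (F y) \<le> t" using t by (rule power2_le_imp_le)
  thus ?thesis using y by blast
qed

lemma exists_ge_of_L2_average:
  fixes F :: "real \<Rightarrow> complex"
  assumes F: "continuous_on {a..a+1} F" and t: "0 \<le> t"
    and ge: "ennreal (t\<^sup>2) \<le> (\<integral>\<^sup>+x\<in>{a..a+1}. ennreal ((cmod (F x))\<^sup>2) \<partial>lborel)"
  shows "\<exists>y\<in>{a..a+1}. t \<le> cmod (F y)"
proof -
  have "\<exists>y\<in>{a..a+1}. \<forall>z\<in>{a..a+1}. cmod (F z) \<le> cmod (F y)"
    using F by (intro continuous_attains_sup continuous_intros) auto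
  then obtain y where y: "y \<in> {a..a+1}" "\<And>z. z \<in> {a..a+1} \<Longrightarrow> cmod (F z) \<le> cmod (F y)" by blast
  have "ennreal (t\<^sup>2) \<le> (\<integral>\<^sup>+x\<in>{a..a+1}. ennreal ((cmod (F x))\<^sup>2) \<partial>lborel)" by fact
  also have "\<dots> \<le> (\<integral>\<^sup>+x\<in>{a..a+1}. ennreal ((cmod (F y))\<^sup>2) \<partial>lborel)"
    by (intro nn_integral_mono) (auto simp: indicator_def intro!: ennreal_leI power_mono y)
  also have "\<dots> = ennreal ((cmod (F y))\<^sup>2)"
    by (simp add: nn_integral_cmult_indicator)
  finally have "t\<^sup>2 \<le> (cmod (F y))\<^sup>2" by simp
  hence "t \<le> cmod (F y)" by (rule power2_le_imp_le) auto
  thus ?thesis using y by blast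
qed

text \<open>Averaging gives one point where the modulus of F is at most t, and from there F can
  change by at most the integral of the modulus of G, which is at most t'.\<close>

lemma pointwise_le_of_L2:
  fixes F G :: "real \<Rightarrow> complex"
  assumes d: "\<And>x. (F has_vector_derivative G x) (at x)" and G: "continuous_on UNIV G"
    and t: "0 \<le> t" "0 < t'"
    and F2: "(\<integral>\<^sup>+x\<in>{a..a+1}. ennreal ((cmod (F x))\<^sup>2) \<partial>lborel) \<le> ennreal (t\<^sup>2)"
    and G2: "(\<integral>\<^sup>+x\<in>{a..a+1}. ennreal ((cmod (G x))\<^sup>2) \<partial>lborel) \<le> ennreal (t'\<^sup>2)"
    and x: "x \<in> {a..a+1}"
  shows "cmod (F x) \<le> t + t'"
proof -
  have contF: "continuous_on S F" for S using d by (rule continuous_of_vector_derivative)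
  have contG: "continuous_on S G" for S using G continuous_on_subset by blast
  obtain y where y: "y \<in> {a..a+1}" "cmod (F y) \<le> t"
    using exists_le_of_L2_average[OF contF t(1) F2] by blast
  let ?g = "\<lambda>x. (cmod (G x))\<^sup>2"
  have gi: "?g integrable_on {a..a+1}"
    by (intro integrable_continuous_interval continuous_intros contG)
  have bm [measurable]: "?g \<in> borel_measurable borel"
    by (intro borel_measurable_continuous_onI continuous_intros contG)
  have "(\<integral>\<^sup>+x. indicator {a..a+1} x * ?g x \<partial>lborel) = ennreal (integral {a..a+1} ?g)"
    by (rule nn_integral_has_integral_lebesgue[OF _ integrable_integral[OF gi]]) auto
  moreover have "(\<integral>\<^sup>+x. indicator {a..a+1} x * ?g x \<partial>lborel) = (\<integral>\<^sup>+x\<in>{a..a+1}. ennreal (?g x) \<partial>lborel)"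
    by (intro nn_integral_cong) (auto simp: indicator_def)
  ultimately have "ennreal (integral {a..a+1} ?g) \<le> ennreal (t'\<^sup>2)" using G2 by simp
  hence I: "integral {a..a+1} ?g \<le> t'\<^sup>2" by simp
  have key: "cmod (F w - F v) \<le> t'" if vw: "v \<in> {a..a+1}" "w \<in> {a..a+1}" "v \<le> w" for v w
  proof -
    \<comment> \<open>An AM-GM majorant of the modulus of G, used in place of Cauchy-Schwarz: over
      an interval of length 1 it integrates to at most t' / 2 + t' / 2. The division is the reason
      for t' > 0.\<close>
    let ?m = "\<lambda>x. (1 / (2 * t')) * ?g x + t' / 2"
    have FTC: "(G has_integral (F w - F v)) {v..w}"
      using d vw by (intro fundamental_theorem_of_calculus) (auto intro: has_vector_derivative_at_within)
    have mi: "?m integrable_on {a..a+1}"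
      by (intro integrable_continuous_interval continuous_intros contG)
    hence mi': "?m integrable_on {v..w}"
      by (rule integrable_subinterval_real) (use vw in auto)
    have "cmod (F w - F v) = norm (integral {v..w} G)" using FTC by (simp add: integral_unique)
    also have "\<dots> \<le> integral {v..w} ?m"
    proof (rule integral_norm_bound_integral)
      fix x
      have "0 \<le> (cmod (G x) - t')\<^sup>2" by simp
      thus "norm (G x) \<le> ?m x" using t(2) by (simp add: field_simps power2_eq_square)
    qed (use FTC mi' in auto)
    also have "\<dots> \<le> integral {a..a+1} ?m"
      using vw t by (intro integral_subset_le mi mi') auto
    also have "\<dots> = (1 / (2 * t')) * integral {a..a+1} ?g + t' / 2"
    proof -
      have "((\<lambda>x. t' / 2) has_integral t' / 2) {a..a+1}"
        using has_integral_const_real[of "t' / 2" a "a + 1"] by simp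
      hence "(?m has_integral ((1 / (2 * t')) * integral {a..a+1} ?g + t' / 2)) {a..a+1}"
        by (intro has_integral_add has_integral_mult_right integrable_integral gi)
      thus ?thesis by (simp add: integral_unique)
    qed
    also have "\<dots> \<le> (1 / (2 * t')) * t'\<^sup>2 + t' / 2"
      using t I by (intro add_right_mono mult_left_mono) auto
    also have "\<dots> = t'" using t by (simp add: power2_eq_square)
    finally show ?thesis .
  qed
  have "cmod (F x - F y) \<le> t'"
    using key[of x y] key[of y x] x y by (cases "x \<le> y") (auto simp: norm_minus_commute)
  thus ?thesis using y norm_triangle_ineq4[of "F x - F y" "- F y"] by simp
qed

text \<open>The L2 bounds of two consecutive orders give the sup bounds \<open>m n * s\<close>, and
  F 0 has modulus at least s somewhere, so \<open>quasianalytic_sublevel_bound\<close> applies.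
  \<delta> is tuned to give the exceptional set measure at most \<gamma> / 2; E then keeps measure
  at least \<gamma> / 2 outside it, where F 0 is bounded below.\<close>

lemma local_lower_bound:
  fixes F :: "nat \<Rightarrow> real \<Rightarrow> complex" and m R T :: "nat \<Rightarrow> real"
  assumes d: "\<And>n x. (F n has_vector_derivative F (Suc n) x) (at x)"
    and s: "0 < s"
    and s2: "(\<integral>\<^sup>+x\<in>{a..a+1}. ennreal ((cmod (F 0 x))\<^sup>2) \<partial>lborel) = ennreal (s\<^sup>2)"
    and Ts: "\<And>n. (\<integral>\<^sup>+x\<in>{a..a+1}. ennreal ((cmod (F n x))\<^sup>2) \<partial>lborel) \<le> ennreal ((T n * s)\<^sup>2)"
    and T: "\<And>n. 0 < T n" and Tm: "\<And>n. T n + T (Suc n) \<le> m n"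
    and ratio: "\<And>n. m (Suc n) \<le> m n * R n" and m: "mono m" "1 \<le> m 0"
    and R: "mono R" "\<And>n. 0 < R n"
    and KN: "K \<le> N" and S: "1 \<le> (\<Sum>n=K..<N. 1 / (exp 1 * R n))"
    and K: "exp (- real K) * m 0 < 1"
    and n0: "2 * R N * exp (real N) \<le> real n0"
    and E: "E \<in> sets borel" "ennreal \<gamma> \<le> emeasure lborel (E \<inter> {a..a+1})"
    and \<gamma>: "0 < \<gamma>" "\<gamma> < 1"
    and \<delta>_def: "\<delta> = \<gamma> / (real n0 * 2 ^ (N + 2))"
  shows "ennreal (\<gamma> / 2 * (exp (- real N) / 2 * \<delta> ^ N)\<^sup>2 * s\<^sup>2)
     \<le> (\<integral>\<^sup>+x\<in>E \<inter> {a..a+1}. ennreal ((cmod (F 0 x))\<^sup>2) \<partial>lborel)"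
proof -
  have cont: "continuous_on S (F n)" for n S using d by (rule continuous_of_vector_derivative)
  obtain x0 where x0: "x0 \<in> {a..a+1}" "s \<le> cmod (F 0 x0)"
    using exists_ge_of_L2_average[OF cont[of _ 0], of s a] s s2 by auto
  have "F 0 x0 \<noteq> 0" using x0 s by auto
  \<comment> \<open>The estimates for sublevel sets need a real function. This unimodular factor
    turns \<open>F 0 x0\<close> into a positive number, so taking real parts loses nothing at x0 and
    enlarges no derivative elsewhere.\<close>
  define c where "c = cnj (F 0 x0) / complex_of_real (cmod (F 0 x0))"
  have c: "cmod c = 1" using \<open>F 0 x0 \<noteq> 0\<close> by (simp add: c_def norm_divide)
  define u where "u n x = Re (c * F n x)" for n x
  have du: "(u n has_real_derivative u (Suc n) x) (at x)" for n x
    unfolding u_def has_real_derivative_iff_has_vector_derivative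
    by (intro bounded_linear.has_vector_derivative[OF bounded_linear_Re]
              bounded_linear.has_vector_derivative[OF bounded_linear_mult_right] d)
  have u_le: "\<bar>u n x\<bar> \<le> cmod (F n x)" for n x
    using abs_Re_le_cmod[of "c * F n x"] c by (simp add: u_def norm_mult)
  have "c * F 0 x0 = complex_of_real (cmod (F 0 x0))"
    using \<open>F 0 x0 \<noteq> 0\<close> by (simp add: c_def complex_norm_square[symmetric] mult.commute power2_eq_square)
  hence u0: "s \<le> \<bar>u 0 x0\<bar>" using x0 by (simp add: u_def)
  have mp: "m n \<ge> 1" for n using monoD[OF m(1), of 0 n] m(2) by simp
  have bound: "\<bar>u n y\<bar> \<le> m n * s" if y: "y \<in> {a..a+1}" for n y
  proof -
    have "cmod (F n y) \<le> T n * s + T (Suc n) * s"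
      using T s less_imp_le[OF T] by (intro pointwise_le_of_L2[OF d cont _ _ Ts Ts y]) auto
    also have "\<dots> \<le> m n * s" using Tm[of n] s by (simp add: distrib_right[symmetric] mult_right_mono)
    finally show ?thesis using u_le order_trans by blast
  qed
  have n0p: "n0 > 0"
    using n0 R(2)[of N] by (smt (verit) exp_gt_zero mult_pos_pos of_nat_le_0_iff gr0I of_nat_0)
  have \<delta>: "0 < \<delta>" "\<delta> \<le> 1"
  proof -
    show "0 < \<delta>" using \<gamma> n0p by (simp add: \<delta>_def)
    have "1 * 1 \<le> real n0 * 2 ^ (N + 2)" using n0p by (intro mult_mono one_le_power) auto
    thus "\<delta> \<le> 1" using \<gamma> n0p by (simp add: \<delta>_def)
  qed
  let ?l = "exp (- real N) / 2 * \<delta> ^ N * s"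
  define B where "B = {x\<in>{a..a+1}. \<bar>u 0 x\<bar> < exp (- real N) * (m 0 * s) / 2 * \<delta> ^ N}"
  have "emeasure lborel B \<le> ennreal (real n0 * 2 ^ (N + 1) * \<delta>)"
    unfolding B_def
  proof (rule quasianalytic_sublevel_bound[where M = "\<lambda>n. m n * s" and R = R and u = u and K = K and ?x0.0 = x0])
    show "0 < m n * s" for n using mp[of n] s by simp
    show "m (Suc n) * s \<le> m n * s * R n" for n
      using mult_right_mono[OF ratio[of n], of s] s by (simp add: mult_ac)
    show "mono (\<lambda>n. m n * s)" using m s by (auto simp: mono_def intro: mult_right_mono)
    show "exp (- real K) * (m 0 * s) < \<bar>u 0 x0\<bar>"
    proof -
      have "exp (- real K) * m 0 * s < 1 * s" using K s by (intro mult_strict_right_mono) auto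
      thus ?thesis using u0 by (simp add: mult.assoc)
    qed
  qed (fact du bound R KN S x0 n0 \<delta>)+
  also have "real n0 * 2 ^ (N + 1) * \<delta> = \<gamma> / 2" using n0p by (simp add: \<delta>_def field_simps)
  finally have Bm: "emeasure lborel B \<le> ennreal (\<gamma> / 2)" .
  have [measurable]: "u 0 \<in> borel_measurable borel" "F 0 \<in> borel_measurable borel"
    unfolding u_def by (intro borel_measurable_continuous_onI continuous_intros cont)+
  have [measurable]: "B \<in> sets borel" unfolding B_def by measurable
  note E(1)[measurable]
  define D where "D = (E \<inter> {a..a+1}) - B"
  have [measurable]: "D \<in> sets borel" unfolding D_def by measurable
  have Dm: "ennreal (\<gamma> / 2) \<le> emeasure lborel D"
  proof -
    have "ennreal (\<gamma> / 2) = ennreal \<gamma> - ennreal (\<gamma> / 2)" using \<gamma> by (simp add: ennreal_minus)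
    also have "\<dots> \<le> emeasure lborel (D \<union> B) - emeasure lborel B"
      using E(2) by (intro ennreal_minus_mono Bm order_trans[OF E(2) emeasure_mono]) (auto simp: D_def)
    also have "\<dots> \<le> (emeasure lborel D + emeasure lborel B) - emeasure lborel B"
      by (intro ennreal_minus_mono emeasure_subadditive) auto
    also have "\<dots> = emeasure lborel D"
    proof (rule ennreal_add_diff_cancel_right)
      show "emeasure lborel B \<noteq> top" using Bm by (auto simp: top_unique)
    qed
    finally show ?thesis .
  qed
  have lD: "?l\<^sup>2 \<le> (cmod (F 0 x))\<^sup>2" if "x \<in> D" for x
  proof -
    have "?l \<le> exp (- real N) * (m 0 * s) / 2 * \<delta> ^ N"
      using m s \<delta> by (simp add: mult_ac)
    also have "\<dots> \<le> \<bar>u 0 x\<bar>" using that by (auto simp: D_def B_def)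
    also have "\<dots> \<le> cmod (F 0 x)" by (rule u_le)
    finally show ?thesis using s \<delta> by (intro power_mono) auto
  qed
  have "ennreal (\<gamma> / 2 * (exp (- real N) / 2 * \<delta> ^ N)\<^sup>2 * s\<^sup>2) = ennreal (?l\<^sup>2) * ennreal (\<gamma> / 2)"
    using \<gamma> by (simp add: ennreal_mult[symmetric] power_mult_distrib power_divide mult_ac)
  also have "\<dots> \<le> ennreal (?l\<^sup>2) * emeasure lborel D" by (intro mult_left_mono Dm) auto
  also have "\<dots> = (\<integral>\<^sup>+x\<in>D. ennreal (?l\<^sup>2) \<partial>lborel)" by (simp add: nn_integral_cmult_indicator)
  also have "\<dots> \<le> (\<integral>\<^sup>+x\<in>E \<inter> {a..a+1}. ennreal ((cmod (F 0 x))\<^sup>2) \<partial>lborel)"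
  proof (intro nn_integral_mono)
    fix x
    have "x \<in> D \<Longrightarrow> x \<in> E \<inter> {a..a+1}" by (simp add: D_def)
    thus "ennreal (?l\<^sup>2) * indicator D x \<le> ennreal ((cmod (F 0 x))\<^sup>2) * indicator (E \<inter> {a..a+1}) x"
      using lD[of x] by (cases "x \<in> D") (auto simp: ennreal_leI)
  qed
  finally show ?thesis .
qed

section \<open>The weight and the choice of parameters\<close>

definition log_factor :: "real \<Rightarrow> nat \<Rightarrow> real" where
  "log_factor \<alpha> k = ln (exp 1 + real k / \<alpha>)"

text \<open>Up to a constant this is the point where
  \<open>\<xi> ^ k * exp (- \<alpha> * Theta \<xi>)\<close> peaks, since there \<xi> / ln \<xi> is
  of order k / \<alpha>. It serves as the ratio of the moment bounds of orders k and k - 1, with B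
  collecting the numerical factors.\<close>

definition moment_ratio :: "real \<Rightarrow> real \<Rightarrow> nat \<Rightarrow> real" where
  "moment_ratio B \<alpha> k = B * real k * log_factor \<alpha> k / \<alpha>"

lemma log_factor_ge_1: "0 < \<alpha> \<Longrightarrow> 1 \<le> log_factor \<alpha> k"
  unfolding log_factor_def by (subst ln_ge_iff) (auto intro: add_pos_nonneg)

lemma log_factor_mono: "0 < \<alpha> \<Longrightarrow> j \<le> k \<Longrightarrow> log_factor \<alpha> j \<le> log_factor \<alpha> k"
  unfolding log_factor_def by (subst ln_le_cancel_iff) (auto intro: add_pos_nonneg divide_right_mono)

lemma moment_ratio_mono:
  "0 < \<alpha> \<Longrightarrow> 0 \<le> B \<Longrightarrow> j \<le> k \<Longrightarrow> moment_ratio B \<alpha> j \<le> moment_ratio B \<alpha> k"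
  unfolding moment_ratio_def using log_factor_ge_1[of \<alpha> j]
  by (intro divide_right_mono mult_mono log_factor_mono) auto

lemma moment_ratio_ge_1:
  assumes "0 < \<alpha>" "\<alpha> \<le> 1" "1 \<le> B" "1 \<le> k"
  shows "1 \<le> moment_ratio B \<alpha> k"
proof -
  have "1 * 1 * 1 / 1 \<le> B * real k * log_factor \<alpha> k / \<alpha>"
    using assms log_factor_ge_1[of \<alpha> k] by (intro frac_le mult_mono) auto
  thus ?thesis by (simp add: moment_ratio_def)
qed

text \<open>With y = ln (1 + w) it is enough that (y - 4) (y + 2) \<le> exp y - 1, which follows
  from exp y \<ge> (1 + y / 3)^3. The additive 4 becomes the factor \<open>exp 4\<close> in
  \<open>moment_le_power\<close>.\<close>

lemma ln_le_plus_div_ln: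
  fixes w :: real
  assumes "0 < w"
  shows "ln w \<le> 4 + w / (2 + ln (1 + w))"
proof -
  define y where "y = ln (1 + w)"
  have y: "y \<ge> 0" "ln w \<le> y" "w = exp y - 1" using assms by (auto simp: y_def)
  have "(1 + y / 3) ^ 3 \<le> exp (y / 3) ^ 3" using y by (intro power_mono exp_ge_add_one_self) auto
  also have "\<dots> = exp y" by (simp add: exp_of_nat_mult[symmetric])
  finally have "(1 + y / 3) ^ 3 \<le> exp y" .
  \<comment> \<open>The cube is a convenient minorant because the difference becomes y times a
    square, plus a constant.\<close>
  moreover have "(1 + y / 3) ^ 3 - 1 - (y - 4) * (y + 2) = y * (y - 9)\<^sup>2 / 27 + 8"
    by (simp add: power2_eq_square power3_eq_cube field_simps)
  moreover have "0 \<le> y * (y - 9)\<^sup>2 / 27" using y by simp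
  ultimately have "(y - 4) * (y + 2) \<le> w" using y by linarith
  hence "y - 4 \<le> w / (2 + y)" using y by (simp add: pos_le_divide_eq add.commute)
  thus ?thesis using y unfolding y_def by linarith
qed

text \<open>Measure \<xi> in units of the expected peak: \<xi> = q l w with q = n / \<alpha> and l
  the log factor. Then ln (e + \<xi>) \<le> l (2 + ln (1 + w)), so \<alpha> * Theta \<xi> is at
  least n w / (2 + ln (1 + w)) and hence at least n (ln w - 4) by \<open>ln_le_plus_div_ln\<close>.
  The factor w^n cancels and exp 4 per order remains.\<close>

lemma moment_le_power:
  assumes \<alpha>: "0 < \<alpha>" "\<alpha> \<le> 1" and n: "1 \<le> n" and \<xi>: "0 < \<xi>"
  shows "\<xi> ^ n * exp (- \<alpha> * Theta \<xi>) \<le> (exp 4 * (real n * log_factor \<alpha> n / \<alpha>)) ^ n"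
proof -
  define q where "q = real n / \<alpha>"
  define l where "l = log_factor \<alpha> n"
  have l: "l \<ge> 1" "l = ln (exp 1 + q)" using log_factor_ge_1 \<alpha> by (auto simp: l_def log_factor_def q_def)
  have q: "q > 0" using \<alpha> n by (simp add: q_def)
  define w where "w = \<xi> / (q * l)"
  have w: "w > 0" "\<xi> = q * l * w" using q l \<xi> by (auto simp: w_def)
  have "exp 1 + \<xi> \<le> (exp 1 + q) * (1 + l * w)" using q l w by (simp add: algebra_simps)
  also have "\<dots> \<le> (exp 1 + q) * ((1 + l) * (1 + w))"
    using q l w by (intro mult_left_mono) (auto simp: algebra_simps intro: add_pos_nonneg)
  finally have "ln (exp 1 + \<xi>) \<le> ln ((exp 1 + q) * ((1 + l) * (1 + w)))"
    using \<xi> by (intro ln_mono) (auto intro!: add_pos_pos)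
  also have "\<dots> = l + (ln (1 + l) + ln (1 + w))"
    using q l(1) w by (simp add: ln_mult_pos add_pos_pos l(2)[symmetric] del: ln_mult)
  also have "\<dots> \<le> l + (l + l * ln (1 + w))"
  proof (intro add_left_mono add_mono)
    show "ln (1 + l) \<le> l" using l by (intro ln_add_one_self_le_self) auto
    have "1 * ln (1 + w) \<le> l * ln (1 + w)" using l w by (intro mult_right_mono) auto
    thus "ln (1 + w) \<le> l * ln (1 + w)" by simp
  qed
  also have "\<dots> = l * (2 + ln (1 + w))" by (simp add: algebra_simps)
  finally have le: "ln (exp 1 + \<xi>) \<le> l * (2 + ln (1 + w))" .
  have pos: "0 < ln (exp 1 + \<xi>)"
  proof -
    have "1 < exp 1 + \<xi>" using \<xi> exp_gt_one[of 1] by linarith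
    thus ?thesis by simp
  qed
  have lw: "0 < 2 + ln (1 + w)" using w by (simp add: add_pos_nonneg)
  have "real n * (ln w - 4) \<le> real n * (w / (2 + ln (1 + w)))"
    using ln_le_plus_div_ln[OF w(1)] by (intro mult_left_mono) auto
  also have "\<dots> = \<alpha> * (\<xi> / (l * (2 + ln (1 + w))))"
  proof -
    have "l \<noteq> 0" using l(1) by simp
    hence "\<alpha> * (\<xi> / (l * (2 + ln (1 + w)))) = (\<alpha> * q) * (w / (2 + ln (1 + w)))"
      by (simp add: w(2))
    thus ?thesis using \<alpha> by (simp add: q_def)
  qed
  also have "\<dots> \<le> \<alpha> * (\<xi> / ln (exp 1 + \<xi>))"
    using \<alpha> \<xi> pos le by (intro mult_left_mono divide_left_mono) auto
  also have "\<dots> = \<alpha> * Theta \<xi>" using \<xi> by (simp add: Theta_def)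
  finally have "exp (- \<alpha> * Theta \<xi>) \<le> exp (real n * (4 - ln w))" by (simp add: algebra_simps)
  also have "\<dots> = (exp 4 / w) ^ n" using w by (simp add: exp_of_nat_mult exp_diff)
  finally have "\<xi> ^ n * exp (- \<alpha> * Theta \<xi>) \<le> \<xi> ^ n * (exp 4 / w) ^ n"
    using \<xi> by (intro mult_left_mono) auto
  also have "\<dots> = (exp 4 * (q * l)) ^ n" using w by (simp add: power_mult_distrib[symmetric] mult_ac)
  finally show ?thesis by (simp add: q_def l_def)
qed

text \<open>With c = n / k the logarithm grows by at most ln c \<le> c - 1, and a log factor of at
  least 1 absorbs this into the multiple c. It is used to trade the power in
  \<open>moment_le_power\<close> for a product of individual ratios.\<close>

lemma log_factor_le_scaled:
  assumes "0 < \<alpha>" "1 \<le> k" "k \<le> n"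
  shows "log_factor \<alpha> n \<le> real n / real k * log_factor \<alpha> k"
proof -
  have r: "1 \<le> real n / real k" using assms by simp
  have "exp 1 + real n / \<alpha> \<le> (real n / real k) * (exp 1 + real k / \<alpha>)"
    using assms r mult_right_mono[OF r, of "exp 1"] by (simp add: distrib_left)
  hence "log_factor \<alpha> n \<le> ln ((real n / real k) * (exp 1 + real k / \<alpha>))"
    unfolding log_factor_def using assms
    by (intro ln_mono) (auto intro!: add_pos_nonneg)
  also have "\<dots> = ln (real n / real k) + log_factor \<alpha> k"
    unfolding log_factor_def using assms by (subst ln_mult_pos) (auto intro!: add_pos_nonneg)
  also have "\<dots> \<le> (real n / real k - 1) * 1 + log_factor \<alpha> k"
    using assms by (auto intro!: ln_le_minus_one)
  also have "\<dots> \<le> (real n / real k - 1) * log_factor \<alpha> k + log_factor \<alpha> k"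
    using r log_factor_ge_1[of \<alpha> k] assms by (intro add_right_mono mult_left_mono) auto
  finally show ?thesis by (simp add: algebra_simps)
qed

lemma power_div_fact_le_exp:
  fixes x :: real
  assumes "0 \<le> x"
  shows "x ^ n / fact n \<le> exp x"
proof -
  have s: "(\<lambda>k. x ^ k / fact k) sums exp x"
    using exp_converges[of x] by (simp add: divide_inverse mult.commute)
  have "x ^ n / fact n \<le> (\<Sum>k<Suc n. x ^ k / fact k)"
    using assms by (intro member_le_sum) auto
  also have "\<dots> \<le> exp x"
    using s assms unfolding sums_unique[OF s] by (intro sum_le_suminf) (auto simp: sums_iff)
  finally show ?thesis .
qed

lemma Theta_nonneg: "0 \<le> Theta \<xi>"
proof -
  have "1 \<le> exp 1 + \<bar>\<xi>\<bar>" using exp_ge_add_one_self[of 1] abs_ge_zero[of \<xi>] by linarith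
  thus ?thesis by (simp add: Theta_def)
qed

text \<open>\<open>moment_le_power\<close> yields the n-th power of one number, while Bang's
  argument works with ratios. Writing l for the log factor, n l(n) \<le> (n / k)^2 k l(k), and the
  product of all n / k is n^n / n!, at most exp n. The square costs exp 2 per factor, whence exp 6 =
  exp 4 * exp 2; each derivative of the Fourier kernel brings a factor 2 pi.\<close>

lemma moment_bound:
  assumes \<alpha>: "0 < \<alpha>" "\<alpha> \<le> 1" and \<xi>: "0 \<le> \<xi>"
  shows "(2 * pi * \<xi>) ^ n * exp (- \<alpha> * Theta \<xi>) \<le> (\<Prod>k=1..n. moment_ratio (2 * pi * exp 6) \<alpha> k)"
proof -
  consider "n = 0" | "n \<ge> 1" "\<xi> = 0" | "n \<ge> 1" "\<xi> > 0" using \<xi> by linarith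
  thus ?thesis
  proof cases
    case 1
    thus ?thesis using \<alpha> Theta_nonneg[of \<xi>] by simp
  next
    case 2
    have "0 \<le> moment_ratio (2 * pi * exp 6) \<alpha> k" for k
      using moment_ratio_mono[of \<alpha> "2 * pi * exp 6" 0 k] \<alpha> by (simp add: moment_ratio_def)
    thus ?thesis using 2 by (simp add: power_0_left prod_nonneg)
  next
    case 3
    define l where "l = log_factor \<alpha>"
    have l: "l k \<ge> 1" for k using log_factor_ge_1 \<alpha> by (simp add: l_def)
    have "(real n * l n) ^ n = (\<Prod>k=1..n. real n * l n)" by simp
    also have "\<dots> \<le> (\<Prod>k=1..n. (real n / real k) ^ 2 * (real k * l k))"
    proof (intro prod_mono conjI)
      fix k assume k: "k \<in> {1..n}"
      show "0 \<le> real n * l n" using l[of n] by simp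
      have "real n * l n \<le> real n * (real n / real k * l k)"
        unfolding l_def using k \<alpha> by (intro mult_left_mono log_factor_le_scaled) auto
      also have "\<dots> = (real n / real k) ^ 2 * (real k * l k)"
        using k by (simp add: power2_eq_square field_simps)
      finally show "real n * l n \<le> (real n / real k) ^ 2 * (real k * l k)" .
    qed
    also have "\<dots> = (\<Prod>k=1..n. real n / real k) ^ 2 * (\<Prod>k=1..n. real k * l k)"
      by (simp add: prod.distrib prod_power_distrib)
    also have "(\<Prod>k=1..n. real n / real k) = real n ^ n / fact n"
      by (simp add: prod_dividef fact_prod)
    also have "(real n ^ n / fact n) ^ 2 * (\<Prod>k=1..n. real k * l k)
        \<le> exp (real n) ^ 2 * (\<Prod>k=1..n. real k * l k)"
      using power_div_fact_le_exp[of "real n" n] l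
      by (intro mult_right_mono power_mono prod_nonneg)
         (auto intro!: mult_nonneg_nonneg intro: order_trans[OF zero_le_one])
    finally have main: "(real n * l n) ^ n \<le> exp 2 ^ n * (\<Prod>k=1..n. real k * l k)"
      by (simp add: exp_of_nat_mult[symmetric] mult.commute)
    have "(2 * pi * \<xi>) ^ n * exp (- \<alpha> * Theta \<xi>) = (2 * pi) ^ n * (\<xi> ^ n * exp (- \<alpha> * Theta \<xi>))"
      by (simp add: power_mult_distrib)
    also have "\<dots> \<le> (2 * pi) ^ n * (exp 4 * (real n * l n / \<alpha>)) ^ n"
      unfolding l_def using 3 \<alpha> by (intro mult_left_mono moment_le_power) auto
    also have "\<dots> = (2 * pi * exp 4 / \<alpha>) ^ n * (real n * l n) ^ n"
      by (simp add: power_mult_distrib power_divide)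
    also have "\<dots> \<le> (2 * pi * exp 4 / \<alpha>) ^ n * (exp 2 ^ n * (\<Prod>k=1..n. real k * l k))"
      using \<alpha> by (intro mult_left_mono main) auto
    also have "\<dots> = (2 * pi * exp 6 / \<alpha>) ^ n * (\<Prod>k=1..n. real k * l k)"
    proof -
      have "exp 4 * exp 2 = exp (6::real)" by (simp add: exp_add[symmetric])
      thus ?thesis by (simp add: power_mult_distrib[symmetric] power_divide mult_ac)
    qed
    also have "\<dots> = (\<Prod>k=1..n. moment_ratio (2 * pi * exp 6) \<alpha> k)"
      by (simp add: moment_ratio_def l_def prod.distrib prod_dividef power_divide power_mult_distrib)
    finally show ?thesis .
  qed
qed


section \<open>Divergence of the series of step lengths, and the numerical parameters\<close>

lemma ln_ln_diff_le:
  fixes x :: real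
  assumes "1 < x"
  shows "ln (ln (x + 1)) - ln (ln x) \<le> 1 / (x * ln x)"
proof -
  have "ln x > 0" "ln (x + 1) > 0" using assms by auto
  hence "ln (ln (x + 1)) - ln (ln x) = ln (ln (x + 1) / ln x)" by (simp add: ln_div)
  also have "\<dots> \<le> ln (x + 1) / ln x - 1"
    using \<open>ln x > 0\<close> \<open>ln (x + 1) > 0\<close> by (intro ln_le_minus_one) auto
  also have "\<dots> = (ln (x + 1) - ln x) / ln x" using \<open>ln x > 0\<close> by (simp add: diff_divide_distrib)
  also have "ln (x + 1) - ln x = ln (1 + 1 / x)"
    using assms ln_div[of "x + 1" x] by (simp add: add_divide_distrib)
  also have "\<dots> / ln x \<le> (1 / x) / ln x"
    using assms \<open>ln x > 0\<close> by (intro divide_right_mono ln_add_one_self_le_self) auto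
  finally show ?thesis by simp
qed

text \<open>Once k is at least 1 / \<alpha>, the \<alpha> inside the logarithm is harmless: e + k /
  \<alpha> \<le> 4 + k^2 \<le> k^4. This leaves the comparison series 1 / (k ln k).\<close>

lemma moment_ratio_le:
  assumes \<alpha>: "0 < \<alpha>" and B: "0 \<le> B" and k: "2 \<le> k" "1 / \<alpha> \<le> real k"
  shows "moment_ratio B \<alpha> k \<le> 4 * B / \<alpha> * (real k * ln (real k))"
proof -
  have "exp 1 + real k / \<alpha> \<le> 4 + real k * real k"
    using exp_le mult_left_mono[OF k(2), of "real k"] by simp
  also have "\<dots> \<le> real k ^ 4"
  proof -
    have k2: "4 \<le> (real k)\<^sup>2" using k(1) power_mono[of 2 "real k" 2] by simp
    have "0 \<le> ((real k)\<^sup>2 - 4) * ((real k)\<^sup>2 + 1) + 2 * (real k)\<^sup>2" using k2 by simp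
    also have "\<dots> = real k ^ 4 - (4 + real k * real k)"
      by (simp add: power2_eq_square power4_eq_xxxx algebra_simps)
    finally show ?thesis by simp
  qed
  finally have "log_factor \<alpha> k \<le> ln (real k ^ 4)"
    unfolding log_factor_def using \<alpha> by (intro ln_mono) (auto intro: add_pos_nonneg)
  also have "\<dots> = 4 * ln (real k)" using k by (simp add: ln_realpow)
  finally have "B * real k * log_factor \<alpha> k / \<alpha> \<le> B * real k * (4 * ln (real k)) / \<alpha>"
    using \<alpha> B by (intro divide_right_mono mult_left_mono) auto
  thus ?thesis by (simp add: moment_ratio_def mult_ac)
qed

text \<open>The summands are Bang's step lengths 1 / (e * R n) with R n =
  \<open>2 * moment_ratio B \<alpha> (n + 2)\<close>, and 1 / (k ln k) dominates the increment of ln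
  ln at k, so the sum telescopes. The factor 8 is the 2 in R times the 4 of
  \<open>moment_ratio_le\<close>; the shift by 2 also keeps ln k positive.\<close>

lemma sum_inverse_moment_ratio_ge:
  assumes \<alpha>: "0 < \<alpha>" and B: "0 < B" and K: "1 / \<alpha> \<le> real K + 2" and KN: "K \<le> N"
  shows "\<alpha> / (8 * exp 1 * B) * (ln (ln (real N + 2)) - ln (ln (real K + 2)))
    \<le> (\<Sum>n=K..<N. 1 / (exp 1 * (2 * moment_ratio B \<alpha> (n + 2))))"
  using KN
proof (induction N rule: dec_induct)
  case base thus ?case by simp
next
  case (step N)
  let ?k = "N + 2"
  have k: "1 / \<alpha> \<le> real ?k" using K step.hyps by linarith
  have lk: "0 < ln (real ?k)" by simp
  have pos: "0 < moment_ratio B \<alpha> ?k"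
    using \<alpha> B log_factor_ge_1[OF \<alpha>, of ?k] unfolding moment_ratio_def
    by (intro divide_pos_pos mult_pos_pos) auto
  have "ln (ln (real (Suc N) + 2)) - ln (ln (real N + 2)) \<le> 1 / (real ?k * ln (real ?k))"
    using ln_ln_diff_le[of "real ?k"] by (simp add: add_ac)
  hence "\<alpha> / (8 * exp 1 * B) * (ln (ln (real (Suc N) + 2)) - ln (ln (real N + 2)))
     \<le> \<alpha> / (8 * exp 1 * B) * (1 / (real ?k * ln (real ?k)))"
    using \<alpha> B by (intro mult_left_mono) auto
  also have "\<dots> = 1 / (exp 1 * (2 * (4 * B / \<alpha> * (real ?k * ln (real ?k)))))"
    using \<alpha> B by simp
  also have "\<dots> \<le> 1 / (exp 1 * (2 * moment_ratio B \<alpha> ?k))"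
    using \<alpha> B pos k lk
    by (intro divide_left_mono mult_left_mono moment_ratio_le mult_pos_pos) auto
  finally show ?case using step.IH step.hyps by (simp add: algebra_simps)
qed

text \<open>K lets exp K beat the sup bound of order 0, N makes the steps between levels K and N add
  up to 1, and \<open>n0\<close> is the number of pieces of a unit interval. The 3 / 2 in the last
  condition compensates for the factor 2 / 3 that \<open>global_estimate\<close> leaves after
  charging the bad intervals.\<close>

lemma parameter_choice:
  fixes B :: real
  assumes B: "1 \<le> B"
  obtains A :: real where "1 \<le> A" and
    "\<And>\<gamma> \<alpha> C. 0 < \<gamma> \<Longrightarrow> \<gamma> < 1 \<Longrightarrow> 0 < \<alpha> \<Longrightarrow> \<alpha> \<le> 1 \<Longrightarrow> 1 < C \<Longrightarrow>
      \<exists>K N n0::nat. K \<le> N \<and> exp (- real K) * (8 * C * moment_ratio B \<alpha> 1) < 1 \<and>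
        1 \<le> (\<Sum>n=K..<N. 1 / (exp 1 * (2 * moment_ratio B \<alpha> (n + 2)))) \<and>
        2 * (2 * moment_ratio B \<alpha> (N + 2)) * exp (real N) \<le> real n0 \<and>
        3 / 2 \<le> \<gamma> / 2 * (exp (- real N) / 2 * (\<gamma> / (real n0 * 2 ^ (N + 2))) ^ N)\<^sup>2
                 * ((A / \<gamma>) powr (ln (A * C) powr exp (A / \<alpha>)))\<^sup>2"
proof -
  define c where "c = 8 * exp 1 * B"
  define C1 where "C1 = 816 * B * exp 4"
  \<comment> \<open>One summand for each later demand on A: the first for the base A / \<gamma>, the
    second for the lower bound \<open>L\<close> on ln (A * C), the third for the exponent A /
    \<alpha>.\<close>
  define A where "A = 4 * exp 1 * C1 + 32 * B * exp 3 + (8 + c)"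
  have C1: "1 \<le> C1"
  proof -
    have "1 * 1 * 1 \<le> 816 * B * exp 4" using B by (intro mult_mono) auto
    thus ?thesis by (simp add: C1_def)
  qed
  have c: "c > 0" using B by (simp add: c_def)
  have A: "4 * exp 1 * C1 \<le> A" "32 * B * exp 3 \<le> A" "8 + c \<le> A"
    using B C1 c by (auto simp: A_def intro!: add_nonneg_nonneg)
  have A1: "1 \<le> A" using A(3) c by simp
  show thesis
  proof (rule that[OF A1])
    fix \<gamma> \<alpha> C :: real
    assume \<gamma>: "0 < \<gamma>" "\<gamma> < 1" and \<alpha>: "0 < \<alpha>" "\<alpha> \<le> 1" and C: "1 < C"
    \<comment> \<open>exp \<kappa> is 32 B C exp (1 / \<alpha>)^2, which dominates the constant 24 B
      C / \<alpha>^2 to be beaten in \<open>first\<close>. The summand 2 / \<alpha> also makes K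
      exceed 1 / \<alpha>, as the comparison of the series requires.\<close>
    define \<kappa> where "\<kappa> = ln (32 * B * C) + 2 / \<alpha>"
    have BC: "1 \<le> B * C" using mult_mono[of 1 B 1 C] B C by simp
    have \<kappa>: "2 / \<alpha> \<le> \<kappa>" using BC by (simp add: \<kappa>_def mult.assoc)
    have ia: "1 \<le> 1 / \<alpha>" using \<alpha> by simp
    define K where "K = nat \<lceil>\<kappa>\<rceil>"
    have K: "\<kappa> \<le> real K" "real K \<le> \<kappa> + 1"
    proof -
      have "0 \<le> \<kappa>" using \<kappa> ia by simp
      thus "\<kappa> \<le> real K" "real K \<le> \<kappa> + 1" unfolding K_def by linarith+
    qed
    \<comment> \<open>Raising V to the power X multiplies ln V by X and so adds c / \<alpha> to ln
      (ln V), exactly what makes the step lengths sum to 1.\<close>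
    define X where "X = exp (c / \<alpha>)"
    have X: "1 \<le> X" using c \<alpha> by (simp add: X_def)
    define V where "V = real K + 2"
    have V: "2 \<le> V" by (simp add: V_def)
    define N where "N = nat \<lceil>V powr X\<rceil>"
    have VX: "V \<le> V powr X" using powr_mono[OF X, of V] V by simp
    have N: "V powr X \<le> real N" "real N \<le> V powr X + 1" unfolding N_def using powr_ge_zero[of V X] by linarith+
    have KN: "K \<le> N" using N VX by (simp add: V_def)
    have N1: "1 \<le> N" using N VX V by linarith
    have iaK: "1 / \<alpha> \<le> real K + 2" using K \<kappa> ia by simp
    have first: "exp (- real K) * (8 * C * moment_ratio B \<alpha> 1) < 1"
    proof -
      have "log_factor \<alpha> 1 \<le> exp 1 + 1 / \<alpha> - 1"
        unfolding log_factor_def using \<alpha> by (auto intro!: ln_le_minus_one add_pos_pos)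
      also have "\<dots> \<le> 3 / \<alpha>" using exp_le ia by simp
      finally have l1: "log_factor \<alpha> 1 \<le> 3 / \<alpha>" .
      have "B * real 1 * log_factor \<alpha> 1 / \<alpha> \<le> B * real 1 * (3 / \<alpha>) / \<alpha>"
        using B \<alpha> by (intro divide_right_mono mult_left_mono l1) auto
      hence "moment_ratio B \<alpha> 1 \<le> B * (3 / \<alpha>) / \<alpha>"
        unfolding moment_ratio_def by simp
      hence "8 * C * moment_ratio B \<alpha> 1 \<le> 8 * C * (B * (3 / \<alpha>) / \<alpha>)"
        using C by (intro mult_left_mono) auto
      also have "\<dots> = 24 * (B * C) * (1 / \<alpha>)\<^sup>2" by (simp add: power2_eq_square)
      also have "\<dots> < 32 * (B * C) * (1 / \<alpha>)\<^sup>2"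
        using BC \<alpha> by (intro mult_strict_right_mono) auto
      also have "\<dots> \<le> 32 * (B * C) * exp (1 / \<alpha>) ^ 2"
        using BC \<alpha> by (intro mult_left_mono power_mono order_trans[OF _ exp_ge_add_one_self]) auto
      also have "\<dots> = exp \<kappa>"
        using BC by (simp add: \<kappa>_def exp_add exp_of_nat_mult[symmetric] mult.assoc)
      also have "\<dots> \<le> exp (real K)" using K by simp
      finally show ?thesis by (simp add: exp_minus field_simps)
    qed
    have second: "1 \<le> (\<Sum>n=K..<N. 1 / (exp 1 * (2 * moment_ratio B \<alpha> (n + 2))))"
    proof -
      have lV: "0 < ln V" using V by simp
      have "ln (X * ln V) \<le> ln (ln (real N + 2))"
      proof (rule ln_mono)
        have "X * ln V = ln (V powr X)" using V by (simp add: ln_powr)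
        also have "\<dots> \<le> ln (real N + 2)" using N V by (intro ln_mono) auto
        finally show "X * ln V \<le> ln (real N + 2)" .
        show "0 < X * ln V" using X lV by simp
      qed
      moreover have "ln (X * ln V) = c / \<alpha> + ln (ln V)"
        using X lV by (subst ln_mult_pos) (auto simp: X_def)
      ultimately have "c / \<alpha> \<le> ln (ln (real N + 2)) - ln (ln (real K + 2))"
        by (simp add: V_def)
      hence "\<alpha> / c * (c / \<alpha>) \<le> \<alpha> / c * (ln (ln (real N + 2)) - ln (ln (real K + 2)))"
        using c \<alpha> by (intro mult_left_mono) auto
      also have "\<dots> \<le> (\<Sum>n=K..<N. 1 / (exp 1 * (2 * moment_ratio B \<alpha> (n + 2))))"
        unfolding c_def using B \<alpha> iaK KN by (intro sum_inverse_moment_ratio_ge) auto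
      finally show ?thesis using c \<alpha> by simp
    qed
    define r where "r = 2 * (2 * moment_ratio B \<alpha> (N + 2)) * exp (real N)"
    define n0 where "n0 = nat \<lceil>r\<rceil>"
    have r: "0 < r" using moment_ratio_ge_1[of \<alpha> B "N + 2"] \<alpha> B by (simp add: r_def)
    have n0: "r \<le> real n0" "real n0 \<le> r + 1" using r unfolding n0_def by linarith+
    define G where "G = real n0 * 2 ^ (N + 2)"
    have G0: "0 < G" using n0 r by (simp add: G_def)
    \<comment> \<open>G is \<gamma> / \<delta>. As 1 / \<alpha> is at most N + 2, the moment ratio
      is cubic in N and exponentials absorb it. N \<ge> 1 allows the prefactor 408 B exp 2 to be
      raised to the power N too; times 2 exp 2 it is \<open>C1\<close>.\<close>
    have G: "G \<le> C1 ^ N"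
    proof -
      let ?k = "real N + 2"
      have ka: "1 / \<alpha> \<le> real (N + 2)" using iaK KN by simp
      have "moment_ratio B \<alpha> (N + 2) \<le> 4 * B / \<alpha> * (real (N + 2) * ln (real (N + 2)))"
        using \<alpha> B ka by (intro moment_ratio_le) auto
      also have "\<dots> = 4 * B * (1 / \<alpha>) * (?k * ln ?k)" by (simp add: add.commute)
      also have "\<dots> \<le> 4 * B * ?k * (?k * ?k)"
        using B \<alpha> ka ln_le_minus_one[of ?k] by (intro mult_mono) (auto simp: add.commute)
      also have "\<dots> = 4 * B * ?k ^ 3" by (simp add: power3_eq_cube)
      also have "\<dots> \<le> 4 * B * (6 * exp ?k)"
      proof (intro mult_left_mono)
        show "?k ^ 3 \<le> 6 * exp ?k" using power_div_fact_le_exp[of ?k 3] by (simp add: fact_numeral)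
      qed (use B in auto)
      finally have "moment_ratio B \<alpha> (N + 2) \<le> 24 * B * exp ?k" by simp
      hence "r \<le> 2 * (2 * (24 * B * exp ?k)) * exp (real N)"
        unfolding r_def by (intro mult_right_mono mult_left_mono) auto
      hence "real n0 \<le> 96 * B * exp ?k * exp (real N) + 1" using n0 by simp
      also have "\<dots> \<le> 102 * B * exp ?k * exp (real N)"
      proof -
        have "1 * 1 * 1 \<le> B * exp ?k * exp (real N)" using B by (intro mult_mono) auto
        hence "96 * (B * exp ?k * exp (real N)) + 1 \<le> 102 * (B * exp ?k * exp (real N))"
          by linarith
        thus ?thesis by (simp only: mult.assoc)
      qed
      finally have "G \<le> 102 * B * exp ?k * exp (real N) * 2 ^ (N + 2)"
        unfolding G_def by (intro mult_right_mono) auto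
      also have "\<dots> = (408 * B * exp 2) ^ 1 * (2 * exp 2) ^ N"
      proof -
        have "exp ?k * exp (real N) = exp 2 * exp 2 ^ N"
          by (simp add: exp_add[symmetric] exp_of_nat_mult[symmetric])
        thus ?thesis by (simp add: power_mult_distrib)
      qed
      also have "\<dots> \<le> (408 * B * exp 2) ^ N * (2 * exp 2) ^ N"
      proof (intro mult_right_mono power_increasing)
        have "1 * 1 * 1 \<le> 408 * B * exp 2" using B by (intro mult_mono) auto
        thus "1 \<le> 408 * B * exp 2" by simp
      qed (use N1 in auto)
      also have "\<dots> = C1 ^ N"
      proof -
        have "exp 2 * exp 2 = exp (4::real)" by (simp add: exp_add[symmetric])
        hence "(408 * B * exp 2) * (2 * exp 2) = C1" by (simp add: C1_def mult.assoc)
        thus ?thesis by (simp only: power_mult_distrib[symmetric])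
      qed
      finally show ?thesis .
    qed
    define \<Lambda> where "\<Lambda> = ln (A * C)"
    \<comment> \<open>The 3 pays for V = K + 2 together with the rounding in K, and makes \<Lambda>
      larger than e.\<close>
    have L: "ln (32 * B * C) + 3 \<le> \<Lambda>"
    proof -
      have "ln (32 * B * C) + 3 = ln (32 * B * C * exp 3)"
        using B C by (subst ln_mult_pos) auto
      also have "\<dots> \<le> \<Lambda>" unfolding \<Lambda>_def
        using B C A(2) mult_right_mono[OF A(2), of C] by (intro ln_mono) (auto simp: mult_ac)
      finally show ?thesis .
    qed
    have L3: "3 \<le> \<Lambda>"
    proof -
      have "0 \<le> ln (32 * B * C)" using BC by (simp add: mult.assoc)
      thus ?thesis using L by simp
    qed
    \<comment> \<open>Turns the additive 2 / \<alpha> into a power of \<Lambda>: 1 + 2 / \<alpha>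
      \<le> exp (2 / \<alpha>) \<le> \<Lambda> powr (2 / \<alpha>), the last because e \<le> 3 \<le>
      \<Lambda>.\<close>
    have VL: "V \<le> \<Lambda> powr (1 + 2 / \<alpha>)"
    proof -
      have "V \<le> \<Lambda> + 1 * (2 / \<alpha>)" using K L by (simp add: V_def \<kappa>_def)
      also have "\<dots> \<le> \<Lambda> + \<Lambda> * (2 / \<alpha>)" using L3 \<alpha> by (intro add_left_mono mult_right_mono) auto
      also have "\<dots> = \<Lambda> * (1 + 2 / \<alpha>)" by (simp add: algebra_simps)
      also have "\<dots> \<le> \<Lambda> * exp (2 / \<alpha>)" using L3 by (intro mult_left_mono exp_ge_add_one_self) auto
      also have "exp (2 / \<alpha>) = exp 1 powr (2 / \<alpha>)" by (simp add: powr_def)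
      also have "\<Lambda> * exp 1 powr (2 / \<alpha>) \<le> \<Lambda> * \<Lambda> powr (2 / \<alpha>)"
        using L3 exp_le \<alpha> by (intro mult_left_mono powr_mono2) auto
      also have "\<dots> = \<Lambda> powr (1 + 2 / \<alpha>)" using L3 by (simp add: powr_add)
      finally show ?thesis .
    qed
    \<comment> \<open>The target is 3 N^2 because the exponent of A / \<gamma> collected in
      \<open>Qge\<close> is 1 + N + N^2.\<close>
    have N2: "3 * real N ^ 2 \<le> \<Lambda> powr exp (A / \<alpha>)"
    proof -
      have "1 \<le> V powr X" using VX V by linarith
      hence "real N \<le> 2 * V powr X" using N by linarith
      hence "3 * real N ^ 2 \<le> 3 * (2 * V powr X) ^ 2" by (intro mult_left_mono power_mono) auto
      also have "\<dots> = 12 * V powr (2 * X)" using V by (simp add: powr_powr power_mult_distrib powr_numeral[symmetric] mult.commute)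
      also have "\<dots> \<le> V powr 4 * V powr (2 * X)"
      proof (intro mult_right_mono)
        have "2 ^ 4 \<le> V ^ 4" using V by (intro power_mono) auto
        thus "12 \<le> V powr 4" using V by (simp add: powr_numeral)
      qed auto
      also have "\<dots> = V powr (4 + 2 * X)" by (simp add: powr_add)
      also have "\<dots> \<le> (\<Lambda> powr (1 + 2 / \<alpha>)) powr (4 + 2 * X)"
        using VL V X by (intro powr_mono2) auto
      also have "\<dots> = \<Lambda> powr ((1 + 2 / \<alpha>) * (4 + 2 * X))" by (simp add: powr_powr)
      also have "\<dots> \<le> \<Lambda> powr exp (A / \<alpha>)"
      proof (intro powr_mono)
        \<comment> \<open>The three factors contribute 2, 6 and c to the numerator over \<alpha>;
          this is the summand 8 + c of A.\<close>
        have "(1 + 2 / \<alpha>) * (4 + 2 * X) \<le> exp (2 / \<alpha>) * (6 * X)"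
          using X \<alpha> by (intro mult_mono exp_ge_add_one_self) auto
        also have "\<dots> \<le> exp (2 / \<alpha>) * (exp (6 / \<alpha>) * X)"
        proof (intro mult_left_mono mult_right_mono)
          have "6 \<le> 6 * (1 / \<alpha>)" using ia by simp
          also have "\<dots> \<le> exp (6 / \<alpha>)" using exp_ge_add_one_self[of "6 / \<alpha>"] by linarith
          finally show "6 \<le> exp (6 / \<alpha>)" .
        qed (use X in auto)
        also have "\<dots> = exp ((8 + c) / \<alpha>)" by (simp add: X_def exp_add[symmetric] add_divide_distrib)
        also have "\<dots> \<le> exp (A / \<alpha>)" using A \<alpha> by (simp add: divide_right_mono)
        finally show "(1 + 2 / \<alpha>) * (4 + 2 * X) \<le> exp (A / \<alpha>)" .
      qed (use L3 in auto)
      finally show ?thesis .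
    qed
    define Q where "Q = (A / \<gamma>) powr (\<Lambda> powr exp (A / \<alpha>))"
    have Ag: "1 \<le> A / \<gamma>" using A1 \<gamma> by simp
    have AC: "C1 \<le> A" "4 \<le> A" "exp 1 \<le> A"
    proof -
      have "1 * 1 * C1 \<le> 4 * exp 1 * C1" using C1 by (intro mult_mono) auto
      thus "C1 \<le> A" using A(1) by linarith
      have "4 * 1 * 1 \<le> 4 * exp 1 * C1" using C1 by (intro mult_mono) auto
      thus "4 \<le> A" using A(1) by linarith
      have "1 * exp 1 * 1 \<le> 4 * exp 1 * C1" using C1 by (intro mult_mono) auto
      thus "exp 1 \<le> A" using A(1) by linarith
    qed
    \<comment> \<open>The left side is 2 / \<gamma> times the reciprocal of the base that is squared
      in \<open>third\<close>. Its factors are at most A / \<gamma> to the powers 1, N and N * N,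
      the last because of the bound on G.\<close>
    have Qge: "4 / \<gamma> * exp (real N) * (G / \<gamma>) ^ N \<le> Q"
    proof -
      have "4 / \<gamma> \<le> (A / \<gamma>) ^ 1" using AC \<gamma> by (simp add: divide_right_mono)
      moreover have "exp (real N) \<le> (A / \<gamma>) ^ N"
      proof -
        have "exp 1 / 1 \<le> A / \<gamma>" using AC \<gamma> by (intro frac_le) auto
        hence "exp 1 ^ N \<le> (A / \<gamma>) ^ N" by (intro power_mono) auto
        thus ?thesis by (simp add: exp_of_nat_mult[symmetric])
      qed
      moreover have "(G / \<gamma>) ^ N \<le> (A / \<gamma>) ^ (N * N)"
      proof -
        have "\<gamma> ^ N \<le> \<gamma> ^ 1" using \<gamma> N1 by (intro power_decreasing) auto
        hence "G / \<gamma> \<le> A ^ N / \<gamma> ^ N"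
          using G AC C1 G0 \<gamma> by (intro frac_le order_trans[OF G] power_mono) auto
        also have "\<dots> = (A / \<gamma>) ^ N" by (simp add: power_divide)
        finally have "(G / \<gamma>) ^ N \<le> ((A / \<gamma>) ^ N) ^ N" using G0 \<gamma> by (intro power_mono) auto
        thus ?thesis by (simp add: power_mult)
      qed
      ultimately have "4 / \<gamma> * exp (real N) * (G / \<gamma>) ^ N \<le> (A / \<gamma>) ^ 1 * (A / \<gamma>) ^ N * (A / \<gamma>) ^ (N * N)"
        using \<gamma> G0 Ag by (intro mult_mono) auto
      also have "\<dots> = (A / \<gamma>) ^ (1 + N + N * N)" by (simp only: power_add)
      also have "\<dots> = (A / \<gamma>) powr real (1 + N + N * N)" using Ag by (subst powr_realpow) auto
      also have "\<dots> \<le> Q" unfolding Q_def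
      proof (intro powr_mono Ag)
        have "1 * N \<le> N * N" by (rule mult_le_mono[OF N1 le_refl])
        hence "1 + N + N * N \<le> 3 * N ^ 2" unfolding power2_eq_square using N1 by linarith
        hence "real (1 + N + N * N) \<le> real (3 * N ^ 2)" by (simp only: of_nat_le_iff)
        also have "\<dots> = 3 * real N ^ 2" by simp
        also note N2
        finally show "real (1 + N + N * N) \<le> \<Lambda> powr exp (A / \<alpha>)" .
      qed
      finally show ?thesis .
    qed
    have third: "3 / 2 \<le> \<gamma> / 2 * (exp (- real N) / 2 * (\<gamma> / G) ^ N)\<^sup>2 * Q\<^sup>2"
    proof -
      have "3 / 2 \<le> 2 / \<gamma>" using \<gamma> by (simp add: field_simps)
      also have "\<dots> = \<gamma> / 2 * (exp (- real N) / 2 * (\<gamma> / G) ^ N)\<^sup>2 * (4 / \<gamma> * exp (real N) * (G / \<gamma>) ^ N)\<^sup>2"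
      proof -
        have *: "(exp (- real N) / 2 * (\<gamma> / G) ^ N) * (4 / \<gamma> * exp (real N) * (G / \<gamma>) ^ N) = 2 / \<gamma>"
          using \<gamma> G0 by (simp add: exp_minus power_divide)
        show ?thesis unfolding mult.assoc power_mult_distrib[symmetric]
          unfolding mult.assoc[symmetric] *[unfolded mult.assoc[symmetric]] using \<gamma> by (simp add: power2_eq_square)
      qed
      also have "\<dots> \<le> \<gamma> / 2 * (exp (- real N) / 2 * (\<gamma> / G) ^ N)\<^sup>2 * Q\<^sup>2"
        using Qge \<gamma> G0 by (intro mult_left_mono power_mono) auto
      finally show ?thesis .
    qed
    show "\<exists>K N n0::nat. K \<le> N \<and> exp (- real K) * (8 * C * moment_ratio B \<alpha> 1) < 1 \<and>
        1 \<le> (\<Sum>n=K..<N. 1 / (exp 1 * (2 * moment_ratio B \<alpha> (n + 2)))) \<and>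
        2 * (2 * moment_ratio B \<alpha> (N + 2)) * exp (real N) \<le> real n0 \<and>
        3 / 2 \<le> \<gamma> / 2 * (exp (- real N) / 2 * (\<gamma> / (real n0 * 2 ^ (N + 2))) ^ N)\<^sup>2
                 * ((A / \<gamma>) powr (ln (A * C) powr exp (A / \<alpha>)))\<^sup>2"
      using KN first second n0(1) third unfolding r_def G_def Q_def \<Lambda>_def by blast
  qed
qed

section \<open>Fourier inversion and the Plancherel inequality\<close>

text \<open>The definitions use the completed measure, while Fubini and measurability of parameter
  integrals are handled over \<open>lborel\<close>; this is the passage between the two.\<close>

lemma lebesgue_measurable_borel_representative:
  fixes h :: "real \<Rightarrow> complex"
  assumes "h \<in> borel_measurable lebesgue"
  obtains h' where "h' \<in> borel_measurable borel" "AE x in lborel. h x = h' x"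
proof -
  have "(\<lambda>x. Re (h x)) \<in> borel_measurable (completion lborel)"
    "(\<lambda>x. Im (h x)) \<in> borel_measurable (completion lborel)"
    using assms by measurable
  note this[THEN completion_ex_borel_measurable_real]
  then obtain r i where [measurable]: "r \<in> borel_measurable lborel" "i \<in> borel_measurable lborel"
    and ae: "AE x in lborel. Re (h x) = r x" "AE x in lborel. Im (h x) = i x"
    by blast
  show thesis
  proof (rule that)
    show "(\<lambda>x. Complex (r x) (i x)) \<in> borel_measurable borel"
      unfolding Complex_eq by measurable
    show "AE x in lborel. h x = Complex (r x) (i x)"
      using ae by eventually_elim (simp add: complex_eq_iff)
  qed
qed

text \<open>For s = - 2 * pi this is the transform of \<open>fourier_L1\<close> on Borel functions,
  for s = 2 * pi the inverse one. The free factor lets one multiplication formula serve both and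
  makes rescaling a Gaussian a change of s.\<close>

definition osc_integral :: "real \<Rightarrow> (real \<Rightarrow> complex) \<Rightarrow> real \<Rightarrow> complex" where
  "osc_integral s g x = (LINT \<xi>|lborel. g \<xi> * cis (s * x * \<xi>))"

lemma fourier_L1_eq_osc_integral:
  assumes u: "u \<in> borel_measurable lebesgue" and u': "u' \<in> borel_measurable borel" and ae: "AE x in lborel. u x = u' x"
  shows "fourier_L1 u = osc_integral (- 2 * pi) u'"
proof
  fix \<xi>
  have c: "exp (- 2 * complex_of_real pi * \<i> * complex_of_real \<xi> * complex_of_real t) = cis (- 2 * pi * \<xi> * t)" for t
    by (simp add: cis_conv_exp mult_ac)
  have cm: "(\<lambda>t. cis (s * t)) \<in> borel_measurable borel" for s
    by (intro borel_measurable_continuous_onI continuous_intros)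
  have cm': "(\<lambda>t. cis (- 2 * pi * \<xi> * t)) \<in> borel_measurable lebesgue"
    by (intro measurable_completion) (use cm[of "- 2 * pi * \<xi>"] in simp)
  note u[measurable] u'[measurable]
  have [measurable]: "u' \<in> borel_measurable lebesgue"
    by (intro measurable_completion) simp
  have "fourier_L1 u \<xi> = (LINT t|lebesgue. u t * cis (- 2 * pi * \<xi> * t))"
    by (simp only: fourier_L1_def c)
  also have "\<dots> = (LINT t|lebesgue. u' t * cis (- 2 * pi * \<xi> * t))"
    using AE_completion[OF ae] by (intro integral_cong_AE borel_measurable_times cm') auto
  also have "\<dots> = osc_integral (- 2 * pi) u' \<xi>"
    unfolding osc_integral_def using cm[of "- 2 * pi * \<xi>"]
    by (intro integral_completion borel_measurable_times) auto
  finally show "fourier_L1 u \<xi> = osc_integral (- 2 * pi) u' \<xi>" .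
qed

section \<open>Oscillatory integrals, Gaussians and the Plancherel inequality\<close>

lemma cis_measurable [measurable]: "cis \<in> borel_measurable borel"
  by (intro borel_measurable_continuous_onI continuous_intros)

lemma cnj_measurable [measurable]: "cnj \<in> borel_measurable borel"
  by (intro borel_measurable_continuous_onI continuous_intros)

lemma integrable_mult_cis [simp]:
  assumes "integrable lborel g"
  shows "integrable lborel (\<lambda>\<xi>. g \<xi> * cis (s * x * \<xi>))"
proof (rule Bochner_Integration.integrable_bound[OF assms])
  show "(\<lambda>\<xi>. g \<xi> * cis (s * x * \<xi>)) \<in> borel_measurable lborel"
    using borel_measurable_integrable[OF assms] by measurable
qed (simp add: norm_mult)

lemma osc_integral_measurable [measurable]:
  assumes [measurable]: "g \<in> borel_measurable borel"
  shows "osc_integral s g \<in> borel_measurable borel"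
  unfolding osc_integral_def by measurable

lemma norm_osc_integral_le:
  shows "cmod (osc_integral s g x) \<le> (LINT \<xi>|lborel. cmod (g \<xi>))"
proof -
  have "cmod (osc_integral s g x) \<le> (LINT \<xi>|lborel. cmod (g \<xi> * cis (s * x * \<xi>)))"
    unfolding osc_integral_def by (rule integral_norm_bound)
  thus ?thesis by (simp add: norm_mult)
qed

lemma cnj_osc_integral: "cnj (osc_integral s g x) = osc_integral (- s) (\<lambda>\<xi>. cnj (g \<xi>)) x"
proof -
  have "(LINT \<xi>|lborel. cnj (g \<xi> * cis (s * x * \<xi>))) = cnj (LINT \<xi>|lborel. g \<xi> * cis (s * x * \<xi>))"
    by (rule Bochner_Integration.integral_cnj)
  thus ?thesis unfolding osc_integral_def by (simp add: cis_cnj del: Bochner_Integration.integral_cnj)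
qed

lemma integrable_prod_phase:
  assumes a: "integrable lborel a" and b: "integrable lborel b"
  shows "integrable (lborel \<Otimes>\<^sub>M lborel) (\<lambda>(x, \<xi>). b x * (a \<xi> * cis (s * x * \<xi>)))"
proof (rule lborel_pair.Fubini_integrable)
  note [measurable] = borel_measurable_integrable[OF a] borel_measurable_integrable[OF b]
  show "(\<lambda>(x, \<xi>). b x * (a \<xi> * cis (s * x * \<xi>))) \<in> borel_measurable (lborel \<Otimes>\<^sub>M lborel)"
    by measurable
  show "integrable lborel (\<lambda>x. LINT y|lborel. norm (case (x, y) of (x, \<xi>) \<Rightarrow> b x * (a \<xi> * cis (s * x * \<xi>))))"
    using b by (simp add: norm_mult)
  show "AE x in lborel. integrable lborel (\<lambda>y. case (x, y) of (x, \<xi>) \<Rightarrow> b x * (a \<xi> * cis (s * x * \<xi>)))"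
    using a by (intro AE_I2) simp
qed

text \<open>Fubini. With a Gaussian as one of the two functions, it turns transforms into
  convolutions with a normal density.\<close>

lemma osc_integral_multiplication:
  assumes a: "integrable lborel a" and b: "integrable lborel b"
  shows "(LINT x|lborel. b x * osc_integral s a x) = (LINT \<xi>|lborel. a \<xi> * osc_integral s b \<xi>)"
proof -
  have "(LINT x|lborel. b x * osc_integral s a x)
      = (LINT x|lborel. LINT \<xi>|lborel. b x * (a \<xi> * cis (s * x * \<xi>)))"
    using a unfolding osc_integral_def by simp
  also have "\<dots> = (LINT \<xi>|lborel. LINT x|lborel. b x * (a \<xi> * cis (s * x * \<xi>)))"
    by (rule lborel_pair.Fubini_integral[OF integrable_prod_phase[OF a b], symmetric])
  also have "\<dots> = (LINT \<xi>|lborel. a \<xi> * osc_integral s b \<xi>)"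
    using b unfolding osc_integral_def
    by (intro Bochner_Integration.integral_cong refl) (simp add: mult_ac flip: integral_mult_right_zero)
  finally show ?thesis .
qed

lemma osc_integral_std_normal: "osc_integral s (\<lambda>x. complex_of_real (std_normal_density x)) x = exp (- (s * x)\<^sup>2 / 2)"
proof -
  have "char std_normal_distribution (s * x) = (LINT y|lborel. std_normal_density y *\<^sub>R iexp (s * x * y))"
    unfolding char_def by (subst integral_density) auto
  also have "\<dots> = osc_integral s (\<lambda>x. complex_of_real (std_normal_density x)) x"
    by (simp add: osc_integral_def cis_conv_exp scaleR_conv_of_real)
  finally show ?thesis by (simp add: char_std_normal_distribution)
qed

lemma normal_density_scale:
  assumes "0 < \<sigma>"
  shows "normal_density 0 \<sigma> (\<sigma> * y) = std_normal_density y / \<sigma>"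
  using assms by (simp add: normal_density_def power_mult_distrib real_sqrt_mult)

lemma osc_integral_normal:
  assumes \<sigma>: "0 < \<sigma>"
  shows "osc_integral s (\<lambda>x. complex_of_real (normal_density 0 \<sigma> x)) x = exp (- (s * \<sigma> * x)\<^sup>2 / 2)"
proof -
  have "osc_integral s (\<lambda>x. complex_of_real (normal_density 0 \<sigma> x)) x
    = \<bar>\<sigma>\<bar> *\<^sub>R (LINT y|lborel. complex_of_real (normal_density 0 \<sigma> (0 + \<sigma> * y)) * cis (s * x * (0 + \<sigma> * y)))"
    unfolding osc_integral_def using \<sigma> by (subst lborel_integral_real_affine[of \<sigma> _ 0]) auto
  also have "\<dots> = (LINT y|lborel. complex_of_real \<sigma> * (complex_of_real (normal_density 0 \<sigma> (\<sigma> * y)) * cis (s * x * (\<sigma> * y))))"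
    using \<sigma> by (simp add: scaleR_conv_of_real)
  also have "\<dots> = osc_integral (s * \<sigma>) (\<lambda>x. complex_of_real (std_normal_density x)) x"
    unfolding osc_integral_def
  proof (intro Bochner_Integration.integral_cong refl)
    fix y
    have "complex_of_real \<sigma> * complex_of_real (normal_density 0 \<sigma> (\<sigma> * y)) = std_normal_density y"
      using \<sigma> by (simp add: normal_density_scale)
    moreover have "s * x * (\<sigma> * y) = s * \<sigma> * x * y" by simp
    ultimately show "complex_of_real \<sigma> * (complex_of_real (normal_density 0 \<sigma> (\<sigma> * y)) * cis (s * x * (\<sigma> * y)))
      = complex_of_real (std_normal_density y) * cis (s * \<sigma> * x * y)"
      by (metis mult.assoc)
  qed
  finally show ?thesis by (simp add: osc_integral_std_normal)
qed

text \<open>The Gaussian is written so that its transform is the density \<open>normal_density 0 \<sigma>\<close>.\<close>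

definition gauss :: "real \<Rightarrow> real \<Rightarrow> real" where
  "gauss \<sigma> x = exp (- (2 * pi * \<sigma> * x)\<^sup>2 / 2)"

lemma gauss_eq_normal_density:
  assumes \<sigma>: "0 < \<sigma>"
  shows "gauss \<sigma> x = sqrt (2 * pi) / (2 * pi * \<sigma>) * normal_density 0 (1 / (2 * pi * \<sigma>)) x"
  using \<sigma> by (simp add: gauss_def normal_density_def power_divide power_mult_distrib real_sqrt_divide real_sqrt_mult field_simps)

lemma gauss_measurable [measurable]: "gauss \<sigma> \<in> borel_measurable borel"
  unfolding gauss_def by measurable

lemma integrable_gauss:
  assumes "0 < \<sigma>"
  shows "integrable lborel (gauss \<sigma>)"
  using assms unfolding gauss_eq_normal_density[OF assms, abs_def]
  by (intro integrable_mult_right integrable_normal_density) auto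

lemma gauss_bounds: "0 \<le> gauss \<sigma> x" "gauss \<sigma> x \<le> 1"
  by (auto simp: gauss_def)

lemma osc_integral_gauss:
  assumes \<sigma>: "0 < \<sigma>" and s: "s = 2 * pi \<or> s = - 2 * pi"
  shows "osc_integral s (\<lambda>x. complex_of_real (gauss \<sigma> x)) \<xi> = normal_density 0 \<sigma> \<xi>"
proof -
  define \<tau> where "\<tau> = 1 / (2 * pi * \<sigma>)"
  have \<tau>: "\<tau> > 0" using \<sigma> by (simp add: \<tau>_def)
  have "osc_integral s (\<lambda>x. complex_of_real (gauss \<sigma> x)) \<xi>
     = complex_of_real (sqrt (2 * pi) / (2 * pi * \<sigma>)) * osc_integral s (\<lambda>x. complex_of_real (normal_density 0 \<tau> x)) \<xi>"
    unfolding osc_integral_def gauss_eq_normal_density[OF \<sigma>] \<tau>_def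
    by (simp add: mult.assoc flip: integral_mult_right_zero)
  also have "\<dots> = complex_of_real (sqrt (2 * pi) / (2 * pi * \<sigma>) * exp (- (s * \<tau> * \<xi>)\<^sup>2 / 2))"
    by (simp add: osc_integral_normal[OF \<tau>])
  also have "(s * \<tau> * \<xi>)\<^sup>2 = (\<xi> / \<sigma>)\<^sup>2"
    using s \<sigma> by (auto simp: \<tau>_def power_mult_distrib power_divide)
  also have "sqrt (2 * pi) / (2 * pi * \<sigma>) * exp (- (\<xi> / \<sigma>)\<^sup>2 / 2) = normal_density 0 \<sigma> \<xi>"
  proof -
    have "sqrt (2 * pi) / (2 * pi * \<sigma>) = 1 / (sqrt (2 * pi) * \<sigma>)"
      using \<sigma> real_sqrt_mult_self[of "2 * pi"] by (simp add: field_simps)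
    thus ?thesis using \<sigma> by (simp add: normal_density_def power_divide real_sqrt_mult field_simps)
  qed
  finally show ?thesis .
qed


lemma nn_integral_normal_density_shift:
  assumes \<sigma>: "0 < \<sigma>"
  shows "(\<integral>\<^sup>+ \<eta>. ennreal (normal_density 0 \<sigma> (\<xi> - \<eta>)) \<partial>lborel) = 1"
    and "(\<integral>\<^sup>+ \<eta>. ennreal (normal_density 0 \<sigma> (\<eta> - \<xi>)) \<partial>lborel) = 1"
proof -
  have "(\<integral>\<^sup>+ \<eta>. ennreal (normal_density 0 \<sigma> \<eta>) \<partial>lborel) = 1"
    using \<sigma> by (subst nn_integral_eq_integral) auto
  thus "(\<integral>\<^sup>+ \<eta>. ennreal (normal_density 0 \<sigma> (\<xi> - \<eta>)) \<partial>lborel) = 1"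
    "(\<integral>\<^sup>+ \<eta>. ennreal (normal_density 0 \<sigma> (\<eta> - \<xi>)) \<partial>lborel) = 1"
    using nn_integral_real_affine[of "\<lambda>\<eta>. ennreal (normal_density 0 \<sigma> \<eta>)" "-1" \<xi>]
      nn_integral_real_affine[of "\<lambda>\<eta>. ennreal (normal_density 0 \<sigma> \<eta>)" 1 "- \<xi>"] by simp_all
qed

lemma osc_integral_gauss_phase:
  assumes \<sigma>: "0 < \<sigma>" and s: "s = 2 * pi \<or> s = - 2 * pi"
  shows "osc_integral s (\<lambda>x. complex_of_real (gauss \<sigma> x) * cis (- s * \<xi> * x)) \<eta>
    = complex_of_real (normal_density 0 \<sigma> (\<xi> - \<eta>))"
proof -
  have "osc_integral s (\<lambda>x. complex_of_real (gauss \<sigma> x) * cis (- s * \<xi> * x)) \<eta>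
     = osc_integral s (\<lambda>x. complex_of_real (gauss \<sigma> x)) (\<eta> - \<xi>)"
    unfolding osc_integral_def
    by (intro Bochner_Integration.integral_cong refl) (simp add: mult.assoc cis_mult algebra_simps)
  also have "\<dots> = normal_density 0 \<sigma> (\<eta> - \<xi>)" by (rule osc_integral_gauss[OF \<sigma> s])
  also have "\<dots> = normal_density 0 \<sigma> (\<xi> - \<eta>)"
    by (simp add: normal_density_def power2_commute)
  finally show ?thesis .
qed

lemma integrable_gauss_phase:
  assumes \<sigma>: "0 < \<sigma>"
  shows "integrable lborel (\<lambda>x. complex_of_real (gauss \<sigma> x) * cis (s * \<xi> * x))"
  using integrable_gauss[OF \<sigma>] by (intro integrable_mult_cis integrable_of_real)

text \<open>Weighting by a Gaussian makes the double integral for \<open>|osc_integral (2 * pi) g|\<^sup>2\<close> absolutely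
  convergent, with a kernel of total mass 1; Fatou's lemma removes the weight.\<close>

lemma plancherel_gauss:
  assumes g: "integrable lborel g" and \<sigma>: "0 < \<sigma>"
  shows "(\<integral>\<^sup>+x. ennreal ((cmod (osc_integral (2 * pi) g x))\<^sup>2 * gauss \<sigma> x) \<partial>lborel)
     \<le> (\<integral>\<^sup>+\<xi>. ennreal ((cmod (g \<xi>))\<^sup>2) \<partial>lborel)"
proof -
  define F where "F = osc_integral (2 * pi) g"
  note gm [measurable] = borel_measurable_integrable[OF g, simplified]
  have [measurable]: "F \<in> borel_measurable borel" unfolding F_def by measurable
  \<comment> \<open>Chosen so that b * F is the weighted square of the modulus of F; pairing b with
    F then moves the transform from g to b.\<close>
  define b where "b = (\<lambda>x. cnj (F x) * complex_of_real (gauss \<sigma> x))"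
  define M where "M = (LINT \<xi>|lborel. cmod (g \<xi>))"
  have FM: "cmod (F x) \<le> M" for x unfolding F_def M_def by (rule norm_osc_integral_le)
  have M0: "0 \<le> M" unfolding M_def by simp
  have bi: "integrable lborel b"
  proof (rule Bochner_Integration.integrable_bound)
    show "integrable lborel (\<lambda>x. M * gauss \<sigma> x)" using integrable_gauss[OF \<sigma>] by simp
    show "b \<in> borel_measurable lborel" unfolding b_def by measurable
    show "AE x in lborel. norm (b x) \<le> norm (M * gauss \<sigma> x)"
      using FM M0 gauss_bounds(1)[of \<sigma>]
      by (intro AE_I2) (auto simp: b_def norm_mult abs_mult intro!: mult_right_mono)
  qed
  have sq: "b x * F x = complex_of_real ((cmod (F x))\<^sup>2 * gauss \<sigma> x)" for x
  proof -
    have "b x * F x = (F x * cnj (F x)) * complex_of_real (gauss \<sigma> x)" by (simp add: b_def mult_ac)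
    also have "F x * cnj (F x) = complex_of_real ((cmod (F x))\<^sup>2)" by (rule complex_norm_square[symmetric])
    finally show ?thesis by simp
  qed
  \<comment> \<open>Conjugation flips the sign of s, so F conjugated is again a transform. The
    multiplication formula moves it onto the Gaussian with phase, which becomes the normal density
    centred at \<xi>.\<close>
  have ob: "osc_integral (2 * pi) b \<xi> = (LINT \<eta>|lborel. cnj (g \<eta>) * complex_of_real (normal_density 0 \<sigma> (\<xi> - \<eta>)))" for \<xi>
  proof -
    define c where "c = (\<lambda>x. complex_of_real (gauss \<sigma> x) * cis (- (- 2 * pi) * \<xi> * x))"
    have ci: "integrable lborel c" unfolding c_def by (rule integrable_gauss_phase[OF \<sigma>])
    have "osc_integral (2 * pi) b \<xi> = (LINT x|lborel. c x * osc_integral (- 2 * pi) (\<lambda>\<xi>. cnj (g \<xi>)) x)"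
      unfolding osc_integral_def[of _ b]
      by (intro Bochner_Integration.integral_cong refl)
         (simp add: b_def c_def F_def cnj_osc_integral mult_ac)
    also have "\<dots> = (LINT \<eta>|lborel. cnj (g \<eta>) * osc_integral (- 2 * pi) c \<eta>)"
      using g ci by (intro osc_integral_multiplication) auto
    also have "\<dots> = (LINT \<eta>|lborel. cnj (g \<eta>) * complex_of_real (normal_density 0 \<sigma> (\<xi> - \<eta>)))"
      unfolding c_def by (subst osc_integral_gauss_phase[OF \<sigma>]) auto
    finally show ?thesis .
  qed
  have nd: "0 \<le> normal_density 0 \<sigma> y" for y by simp
  have ob_le: "ennreal (cmod (osc_integral (2 * pi) b \<xi>))
     \<le> (\<integral>\<^sup>+\<eta>. ennreal (cmod (g \<eta>) * normal_density 0 \<sigma> (\<xi> - \<eta>)) \<partial>lborel)" for \<xi>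
  proof (cases "integrable lborel (\<lambda>\<eta>. cnj (g \<eta>) * complex_of_real (normal_density 0 \<sigma> (\<xi> - \<eta>)))")
    case True
    from integral_norm_bound_ennreal[OF this] show ?thesis by (simp add: ob norm_mult)
  next
    \<comment> \<open>The Bochner integral then has its default value 0, which makes the bound
      trivial.\<close>
    case False
    thus ?thesis by (simp add: ob not_integrable_integral_eq)
  qed
  have gb: "integrable lborel (\<lambda>\<xi>. g \<xi> * osc_integral (2 * pi) b \<xi>)"
  proof (rule Bochner_Integration.integrable_bound)
    show "integrable lborel (\<lambda>\<xi>. cmod (g \<xi>) * (LINT x|lborel. cmod (b x)))" using g by simp
    have [measurable]: "b \<in> borel_measurable borel" using bi by simp
    show "(\<lambda>\<xi>. g \<xi> * osc_integral (2 * pi) b \<xi>) \<in> borel_measurable lborel" by measurable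
    show "AE \<xi> in lborel. norm (g \<xi> * osc_integral (2 * pi) b \<xi>) \<le> norm (cmod (g \<xi>) * (LINT x|lborel. cmod (b x)))"
      using norm_osc_integral_le[of "2 * pi" b]
      by (intro AE_I2) (simp add: norm_mult abs_mult mult_left_mono)
  qed
  have bFi: "integrable lborel (\<lambda>x. (cmod (F x))\<^sup>2 * gauss \<sigma> x)"
  proof (rule Bochner_Integration.integrable_bound)
    show "integrable lborel (\<lambda>x. M\<^sup>2 * gauss \<sigma> x)" using integrable_gauss[OF \<sigma>] by simp
    show "(\<lambda>x. (cmod (F x))\<^sup>2 * gauss \<sigma> x) \<in> borel_measurable lborel" by measurable
    show "AE x in lborel. norm ((cmod (F x))\<^sup>2 * gauss \<sigma> x) \<le> norm (M\<^sup>2 * gauss \<sigma> x)"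
      using FM gauss_bounds(1)[of \<sigma>]
      by (intro AE_I2) (auto simp: abs_mult intro!: mult_right_mono power_mono)
  qed
  have "(\<integral>\<^sup>+x. ennreal ((cmod (F x))\<^sup>2 * gauss \<sigma> x) \<partial>lborel) = ennreal (LINT x|lborel. (cmod (F x))\<^sup>2 * gauss \<sigma> x)"
    using gauss_bounds(1)[of \<sigma>] by (intro nn_integral_eq_integral bFi) (auto intro!: mult_nonneg_nonneg)
  also have "\<dots> \<le> ennreal (cmod (LINT x|lborel. b x * F x))"
    unfolding sq integral_complex_of_real by (intro ennreal_leI) simp
  also have "(LINT x|lborel. b x * F x) = (LINT \<xi>|lborel. g \<xi> * osc_integral (2 * pi) b \<xi>)"
    unfolding F_def by (rule osc_integral_multiplication[OF g bi])
  also have "ennreal (cmod \<dots>) \<le> (\<integral>\<^sup>+\<xi>. ennreal (cmod (g \<xi> * osc_integral (2 * pi) b \<xi>)) \<partial>lborel)"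
    by (rule integral_norm_bound_ennreal[OF gb])
  also have "\<dots> = (\<integral>\<^sup>+\<xi>. ennreal (cmod (g \<xi>)) * ennreal (cmod (osc_integral (2 * pi) b \<xi>)) \<partial>lborel)"
    by (simp add: norm_mult ennreal_mult)
  also have "\<dots> \<le> (\<integral>\<^sup>+\<xi>. ennreal (cmod (g \<xi>)) * (\<integral>\<^sup>+\<eta>. ennreal (cmod (g \<eta>) * normal_density 0 \<sigma> (\<xi> - \<eta>)) \<partial>lborel) \<partial>lborel)"
    by (intro nn_integral_mono mult_left_mono ob_le) auto
  also have "\<dots> = (\<integral>\<^sup>+\<xi>. \<integral>\<^sup>+\<eta>. ennreal (cmod (g \<xi>) * cmod (g \<eta>) * normal_density 0 \<sigma> (\<xi> - \<eta>)) \<partial>lborel \<partial>lborel)"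
    by (intro nn_integral_cong) (simp add: ennreal_mult mult.assoc flip: nn_integral_cmult)
  \<comment> \<open>AM-GM splits the product into two halves; in each, the kernel is integrated over
    the variable on which the square does not depend and contributes mass 1.\<close>
  also have "\<dots> \<le> (\<integral>\<^sup>+\<xi>. \<integral>\<^sup>+\<eta>. ennreal ((cmod (g \<xi>))\<^sup>2 / 2) * ennreal (normal_density 0 \<sigma> (\<xi> - \<eta>))
      + ennreal ((cmod (g \<eta>))\<^sup>2 / 2) * ennreal (normal_density 0 \<sigma> (\<xi> - \<eta>)) \<partial>lborel \<partial>lborel)"
  proof (intro nn_integral_mono)
    fix \<xi> \<eta> :: real
    have "cmod (g \<xi>) * cmod (g \<eta>) \<le> (cmod (g \<xi>))\<^sup>2 / 2 + (cmod (g \<eta>))\<^sup>2 / 2"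
      using sum_squares_bound[of "cmod (g \<xi>)" "cmod (g \<eta>)"] by simp
    from mult_right_mono[OF this nd[of "\<xi> - \<eta>"]]
    have "ennreal (cmod (g \<xi>) * cmod (g \<eta>) * normal_density 0 \<sigma> (\<xi> - \<eta>))
       \<le> ennreal (((cmod (g \<xi>))\<^sup>2 / 2 + (cmod (g \<eta>))\<^sup>2 / 2) * normal_density 0 \<sigma> (\<xi> - \<eta>))"
      by (rule ennreal_leI)
    also have "\<dots> = ennreal ((cmod (g \<xi>))\<^sup>2 / 2) * ennreal (normal_density 0 \<sigma> (\<xi> - \<eta>))
      + ennreal ((cmod (g \<eta>))\<^sup>2 / 2) * ennreal (normal_density 0 \<sigma> (\<xi> - \<eta>))"
      by (subst ennreal_mult[symmetric]; simp?)+ (simp add: distrib_right)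
    finally show "ennreal (cmod (g \<xi>) * cmod (g \<eta>) * normal_density 0 \<sigma> (\<xi> - \<eta>)) \<le> \<dots>" .
  qed
  also have "\<dots> = (\<integral>\<^sup>+\<xi>. \<integral>\<^sup>+\<eta>. ennreal ((cmod (g \<xi>))\<^sup>2 / 2) * ennreal (normal_density 0 \<sigma> (\<xi> - \<eta>)) \<partial>lborel \<partial>lborel)
      + (\<integral>\<^sup>+\<xi>. \<integral>\<^sup>+\<eta>. ennreal ((cmod (g \<eta>))\<^sup>2 / 2) * ennreal (normal_density 0 \<sigma> (\<xi> - \<eta>)) \<partial>lborel \<partial>lborel)"
    by (subst nn_integral_add[symmetric]; measurable?) (simp add: nn_integral_add)
  also have "(\<integral>\<^sup>+\<xi>. \<integral>\<^sup>+\<eta>. ennreal ((cmod (g \<eta>))\<^sup>2 / 2) * ennreal (normal_density 0 \<sigma> (\<xi> - \<eta>)) \<partial>lborel \<partial>lborel)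
     = (\<integral>\<^sup>+\<eta>. \<integral>\<^sup>+\<xi>. ennreal ((cmod (g \<eta>))\<^sup>2 / 2) * ennreal (normal_density 0 \<sigma> (\<xi> - \<eta>)) \<partial>lborel \<partial>lborel)"
    by (rule lborel_pair.Fubini') measurable
  also have "(\<integral>\<^sup>+\<xi>. \<integral>\<^sup>+\<eta>. ennreal ((cmod (g \<xi>))\<^sup>2 / 2) * ennreal (normal_density 0 \<sigma> (\<xi> - \<eta>)) \<partial>lborel \<partial>lborel)
      + \<dots> = (\<integral>\<^sup>+\<xi>. ennreal ((cmod (g \<xi>))\<^sup>2 / 2) \<partial>lborel) + (\<integral>\<^sup>+\<eta>. ennreal ((cmod (g \<eta>))\<^sup>2 / 2) \<partial>lborel)"
    by (simp add: nn_integral_cmult nn_integral_normal_density_shift[OF \<sigma>])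
  also have "\<dots> = (\<integral>\<^sup>+\<xi>. ennreal ((cmod (g \<xi>))\<^sup>2 / 2) + ennreal ((cmod (g \<xi>))\<^sup>2 / 2) \<partial>lborel)"
    by (subst nn_integral_add) auto
  also have "\<dots> = (\<integral>\<^sup>+\<xi>. ennreal ((cmod (g \<xi>))\<^sup>2) \<partial>lborel)"
    by (intro nn_integral_cong) (simp flip: ennreal_plus)
  finally show ?thesis by (simp add: F_def)
qed

lemma plancherel_le:
  assumes g: "integrable lborel g"
  shows "(\<integral>\<^sup>+x. ennreal ((cmod (osc_integral (2 * pi) g x))\<^sup>2) \<partial>lborel)
     \<le> (\<integral>\<^sup>+\<xi>. ennreal ((cmod (g \<xi>))\<^sup>2) \<partial>lborel)"
proof -
  define F where "F = osc_integral (2 * pi) g"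
  note gm [measurable] = borel_measurable_integrable[OF g, simplified]
  have [measurable]: "F \<in> borel_measurable borel" unfolding F_def by measurable
  define v where "v n x = ennreal ((cmod (F x))\<^sup>2 * gauss (1 / real (Suc n)) x)" for n x
  have [measurable]: "v n \<in> borel_measurable borel" for n unfolding v_def by measurable
  have lim: "(\<lambda>n. v n x) \<longlonglongrightarrow> ennreal ((cmod (F x))\<^sup>2)" for x
  proof -
    have "(\<lambda>n. (cmod (F x))\<^sup>2 * exp (- (2 * pi * (1 / real (Suc n)) * x)\<^sup>2 / 2))
      \<longlonglongrightarrow> (cmod (F x))\<^sup>2 * exp (- (2 * pi * 0 * x)\<^sup>2 / 2)"
      by (intro tendsto_intros LIMSEQ_Suc[OF lim_1_over_n]) auto
    thus ?thesis unfolding v_def gauss_def by (intro tendsto_ennrealI) simp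
  qed
  have "(\<integral>\<^sup>+x. ennreal ((cmod (F x))\<^sup>2) \<partial>lborel) = (\<integral>\<^sup>+x. liminf (\<lambda>n. v n x) \<partial>lborel)"
    using lim_imp_Liminf[OF sequentially_bot lim] by simp
  also have "\<dots> \<le> liminf (\<lambda>n. \<integral>\<^sup>+x. v n x \<partial>lborel)"
    by (intro nn_integral_liminf) auto
  also have "\<dots> \<le> liminf (\<lambda>n::nat. \<integral>\<^sup>+\<xi>. ennreal ((cmod (g \<xi>))\<^sup>2) \<partial>lborel)"
    unfolding v_def F_def by (intro Liminf_mono always_eventually allI plancherel_gauss[OF g]) simp
  also have "\<dots> = (\<integral>\<^sup>+\<xi>. ennreal ((cmod (g \<xi>))\<^sup>2) \<partial>lborel)" by (simp add: Liminf_const)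
  finally show ?thesis by (simp add: F_def)
qed


section \<open>Fourier inversion for the relation \<open>has_fourier_L2\<close>\<close>

lemma integrable_mult_of_L2:
  fixes a b :: "'a \<Rightarrow> complex"
  assumes [measurable]: "a \<in> borel_measurable M" "b \<in> borel_measurable M"
    and a: "integrable M (\<lambda>x. (cmod (a x))\<^sup>2)" and b: "integrable M (\<lambda>x. (cmod (b x))\<^sup>2)"
  shows "integrable M (\<lambda>x. a x * b x)"
proof (rule Bochner_Integration.integrable_bound)
  show "integrable M (\<lambda>x. (cmod (a x))\<^sup>2 + (cmod (b x))\<^sup>2)" using a b by simp
  show "AE x in M. norm (a x * b x) \<le> norm ((cmod (a x))\<^sup>2 + (cmod (b x))\<^sup>2)"
  proof (intro AE_I2)
    fix x
    have "2 * (cmod (a x) * cmod (b x)) \<le> (cmod (a x))\<^sup>2 + (cmod (b x))\<^sup>2"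
      using sum_squares_bound[of "cmod (a x)" "cmod (b x)"] by (simp add: mult.assoc)
    moreover have "0 \<le> cmod (a x) * cmod (b x)" by simp
    ultimately show "norm (a x * b x) \<le> norm ((cmod (a x))\<^sup>2 + (cmod (b x))\<^sup>2)"
      unfolding norm_mult real_norm_def by linarith
  qed
qed measurable

lemma normal_density_le: "normal_density \<mu> \<sigma> x \<le> 1 / sqrt (2 * pi * \<sigma>\<^sup>2)"
  by (simp add: normal_density_def divide_right_mono)

lemma integrable_normal_density_shift:
  "0 < \<sigma> \<Longrightarrow> integrable lborel (\<lambda>t. normal_density 0 \<sigma> (x - t))"
  using lborel_integrable_real_affine[OF integrable_normal_density[of \<sigma> 0], of "-1" x] by simp

lemma integrable_normal_density_square:
  assumes \<sigma>: "0 < \<sigma>"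
  shows "integrable lborel (\<lambda>t. (normal_density 0 \<sigma> (x - t))\<^sup>2)"
proof (rule Bochner_Integration.integrable_bound)
  show "integrable lborel (\<lambda>t. (1 / sqrt (2 * pi * \<sigma>\<^sup>2)) * normal_density 0 \<sigma> (x - t))"
    by (intro integrable_mult_right integrable_normal_density_shift \<sigma>)
  show "AE t in lborel. norm ((normal_density 0 \<sigma> (x - t))\<^sup>2)
      \<le> norm ((1 / sqrt (2 * pi * \<sigma>\<^sup>2)) * normal_density 0 \<sigma> (x - t))"
  proof (intro AE_I2)
    fix t
    have "normal_density 0 \<sigma> (x - t) * normal_density 0 \<sigma> (x - t)
        \<le> (1 / sqrt (2 * pi * \<sigma>\<^sup>2)) * normal_density 0 \<sigma> (x - t)"
      by (intro mult_right_mono normal_density_le) simp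
    thus "norm ((normal_density 0 \<sigma> (x - t))\<^sup>2)
      \<le> norm ((1 / sqrt (2 * pi * \<sigma>\<^sup>2)) * normal_density 0 \<sigma> (x - t))"
      by (simp add: power2_eq_square[of "normal_density _ _ _"] abs_mult)
  qed
qed measurable

text \<open>Cauchy-Schwarz, carried out with extended integrals to match \<open>L2_tendsto\<close>,
  whose differences may have infinite norm for some n.\<close>

lemma L2_tendsto_integral_mult:
  assumes um: "\<And>n. u n \<in> borel_measurable lebesgue" and fm: "f \<in> borel_measurable lebesgue"
    and \<phi>m: "\<phi> \<in> borel_measurable lebesgue"
    and ui: "\<And>n. integrable lebesgue (\<lambda>x. u n x * \<phi> x)" and fi: "integrable lebesgue (\<lambda>x. f x * \<phi> x)"
    and \<phi>2: "(\<integral>\<^sup>+x. ennreal ((cmod (\<phi> x))\<^sup>2) \<partial>lebesgue) < \<infinity>"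
    and lim: "L2_tendsto u f"
  shows "(\<lambda>n. LINT x|lebesgue. u n x * \<phi> x) \<longlonglongrightarrow> (LINT x|lebesgue. f x * \<phi> x)"
proof -
  note [measurable] = um fm \<phi>m
  define C where "C = (\<integral>\<^sup>+x. ennreal ((cmod (\<phi> x))\<^sup>2) \<partial>lebesgue)"
  define d where "d n = (\<integral>\<^sup>+ x. ennreal ((cmod (u n x - f x))\<^sup>2) \<partial>lebesgue)" for n
  define r where "r n = cmod ((LINT x|lebesgue. u n x * \<phi> x) - (LINT x|lebesgue. f x * \<phi> x))" for n
  have le: "ennreal ((r n)\<^sup>2) \<le> d n * C" for n
  proof -
    have "ennreal (r n) = ennreal (cmod (LINT x|lebesgue. (u n x - f x) * \<phi> x))"
      unfolding r_def using ui[of n] fi by (simp add: left_diff_distrib)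
    also have "\<dots> \<le> (\<integral>\<^sup>+x. ennreal (cmod ((u n x - f x) * \<phi> x)) \<partial>lebesgue)"
      using ui[of n] fi by (intro integral_norm_bound_ennreal) (simp add: left_diff_distrib)
    also have "\<dots> = (\<integral>\<^sup>+x. ennreal (cmod (u n x - f x)) * ennreal (cmod (\<phi> x)) \<partial>lebesgue)"
      by (simp add: norm_mult ennreal_mult)
    finally have "ennreal (r n) ^ 2 \<le> (\<integral>\<^sup>+x. ennreal (cmod (u n x - f x)) * ennreal (cmod (\<phi> x)) \<partial>lebesgue) ^ 2"
      by (intro power_mono) auto
    also have "\<dots> \<le> (\<integral>\<^sup>+x. ennreal (cmod (u n x - f x)) ^ 2 \<partial>lebesgue) * (\<integral>\<^sup>+x. ennreal (cmod (\<phi> x)) ^ 2 \<partial>lebesgue)"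
      by (intro Cauchy_Schwarz_nn_integral) measurable
    also have "\<dots> = d n * C" by (simp add: d_def C_def ennreal_power)
    finally show ?thesis by (simp add: ennreal_power r_def)
  qed
  \<comment> \<open>Multiplication by C preserves the limit 0 because C is finite.\<close>
  have "(\<lambda>n. C * d n) \<longlonglongrightarrow> C * 0"
    using lim \<phi>2 by (intro ennreal_tendsto_cmult) (auto simp: L2_tendsto_def d_def C_def)
  hence "(\<lambda>n. d n * C) \<longlonglongrightarrow> 0" by (simp add: mult.commute)
  hence "(\<lambda>n. ennreal ((r n)\<^sup>2)) \<longlonglongrightarrow> 0"
    by (rule tendsto_sandwich[rotated 3]) (use le in auto)
  hence "(\<lambda>n. ennreal ((r n)\<^sup>2)) \<longlonglongrightarrow> ennreal 0" by simp
  hence "(\<lambda>n. (r n)\<^sup>2) \<longlonglongrightarrow> 0" by (subst (asm) tendsto_ennreal_iff) auto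
  hence "(\<lambda>n. sqrt ((r n)\<^sup>2)) \<longlonglongrightarrow> sqrt 0" by (intro tendsto_intros)
  moreover have "sqrt ((r n)\<^sup>2) = r n" for n by (simp add: r_def)
  ultimately have "r \<longlonglongrightarrow> 0" by simp
  thus ?thesis unfolding r_def by (simp add: LIM_zero_iff tendsto_norm_zero_iff)
qed

text \<open>For the approximating integrable functions this is the multiplication formula with a
  Gaussian. Both sides are pairings with square integrable functions, so they pass to the L2 limit.
  The approximating sequence in \<open>has_fourier_L2\<close> enters only here.\<close>

lemma smoothing_of_fourier_L2:
  assumes four: "has_fourier_L2 f g" and \<sigma>: "0 < \<sigma>"
    and f': "f' \<in> borel_measurable borel" "AE x in lborel. f x = f' x"
    and g': "integrable lborel g'" "AE x in lborel. g x = g' x"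
  shows "(LINT t|lborel. f' t * complex_of_real (normal_density 0 \<sigma> (x - t)))
    = (LINT \<xi>|lborel. g' \<xi> * (complex_of_real (gauss \<sigma> \<xi>) * cis (2 * pi * x * \<xi>)))"
proof -
  have f: "in_L2 f" and g: "in_L2 g" using four by (auto simp: has_fourier_L2_def)
  obtain u where u: "\<And>n. in_L1 (u n)" "\<And>n. in_L2 (u n)"
    and lim: "L2_tendsto u f" "L2_tendsto (\<lambda>n. fourier_L1 (u n)) g"
    using four by (auto simp: has_fourier_L2_def)
  have um: "u n \<in> borel_measurable lebesgue" for n using u(2) by (simp add: in_L2_def)
  have "\<exists>v. v \<in> borel_measurable borel \<and> (AE x in lborel. u n x = v x)" for n
    using lebesgue_measurable_borel_representative[OF um] by metis
  then obtain v where v [measurable]: "\<And>n. v n \<in> borel_measurable borel"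
    and uv: "\<And>n. AE x in lborel. u n x = v n x" by metis
  have vi: "integrable lborel (v n)" for n
  proof -
    have "integrable lebesgue (v n)"
      using u(1)[of n] um AE_completion[OF uv[of n]] unfolding in_L1_def
      by (subst integrable_cong_AE[symmetric]) (auto intro: measurable_completion)
    thus ?thesis by (subst (asm) integrable_completion) auto
  qed
  have fu: "fourier_L1 (u n) = osc_integral (- 2 * pi) (v n)" for n
    by (rule fourier_L1_eq_osc_integral[OF um v uv])
  \<comment> \<open>The phase places the transform of \<phi> at x: it is the density \<psi>, and
    pairing with \<psi> is the Gaussian mean around x.\<close>
  define \<phi> where "\<phi> = (\<lambda>\<xi>. complex_of_real (gauss \<sigma> \<xi>) * cis (- (- 2 * pi) * x * \<xi>))"
  define \<psi> where "\<psi> = (\<lambda>t. complex_of_real (normal_density 0 \<sigma> (x - t)))"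
  have \<phi>i: "integrable lborel \<phi>" unfolding \<phi>_def by (rule integrable_gauss_phase[OF \<sigma>])
  have [measurable]: "\<phi> \<in> borel_measurable borel" "\<psi> \<in> borel_measurable borel"
    unfolding \<phi>_def \<psi>_def by measurable
  have \<phi>1: "cmod (\<phi> \<xi>) \<le> 1" for \<xi>
    using gauss_bounds[of \<sigma> \<xi>] by (simp add: \<phi>_def norm_mult)
  have \<psi>B: "cmod (\<psi> t) \<le> 1 / sqrt (2 * pi * \<sigma>\<^sup>2)" for t
    using normal_density_le[of 0 \<sigma> "x - t"] by (simp add: \<psi>_def)
  have osc: "osc_integral (- 2 * pi) \<phi> = \<psi>"
    unfolding \<phi>_def \<psi>_def by (intro ext osc_integral_gauss_phase[OF \<sigma>]) simp
  have eq: "(LINT \<xi>|lborel. osc_integral (- 2 * pi) (v n) \<xi> * \<phi> \<xi>) = (LINT t|lborel. v n t * \<psi> t)" for n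
    using osc_integral_multiplication[OF vi[of n] \<phi>i, of "- 2 * pi"] unfolding osc by (simp only: mult.commute[of "\<phi> _"])
  have comp: "h \<in> borel_measurable borel \<Longrightarrow> h \<in> borel_measurable lebesgue" for h :: "real \<Rightarrow> complex"
    by (intro measurable_completion) simp
  have fm: "f \<in> borel_measurable lebesgue" and gm: "g \<in> borel_measurable lebesgue"
    using f g by (auto simp: in_L2_def)
  note [measurable] = f'(1) borel_measurable_integrable[OF g'(1), simplified]
  have L: "\<phi> \<in> borel_measurable lebesgue" "\<psi> \<in> borel_measurable lebesgue" "f' \<in> borel_measurable lebesgue"
    "g' \<in> borel_measurable lebesgue" "\<And>n. v n \<in> borel_measurable lebesgue"
    by (intro comp; measurable)+
  have \<phi>2: "(\<integral>\<^sup>+x. ennreal ((cmod (\<phi> x))\<^sup>2) \<partial>lborel) < \<infinity>"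
  proof -
    have "(\<integral>\<^sup>+x. ennreal ((cmod (\<phi> x))\<^sup>2) \<partial>lborel) \<le> (\<integral>\<^sup>+x. ennreal (cmod (\<phi> x)) \<partial>lborel)"
      using \<phi>1 by (intro nn_integral_mono ennreal_leI) (simp add: power2_eq_square mult_left_le)
    also have "\<dots> < \<infinity>" using \<phi>i by (simp add: integrable_iff_bounded)
    finally show ?thesis .
  qed
  have \<psi>sq: "integrable lborel (\<lambda>x. (cmod (\<psi> x))\<^sup>2)"
    unfolding \<psi>_def using integrable_normal_density_square[OF \<sigma>] by simp
  have \<psi>2: "(\<integral>\<^sup>+x. ennreal ((cmod (\<psi> x))\<^sup>2) \<partial>lborel) < \<infinity>"
    using \<psi>sq by (subst nn_integral_eq_integral) auto
  have lim1: "(\<lambda>n. LINT \<xi>|lebesgue. fourier_L1 (u n) \<xi> * \<phi> \<xi>) \<longlonglongrightarrow> (LINT \<xi>|lebesgue. g \<xi> * \<phi> \<xi>)"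
  proof (rule L2_tendsto_integral_mult[OF _ gm _ _ _ _ lim(2)])
    show "fourier_L1 (u n) \<in> borel_measurable lebesgue" for n
      unfolding fu by (intro comp) measurable
    show "\<phi> \<in> borel_measurable lebesgue" by (intro comp) measurable
    show "integrable lebesgue (\<lambda>\<xi>. fourier_L1 (u n) \<xi> * \<phi> \<xi>)" for n
    proof (subst integrable_completion)
      show "integrable lborel (\<lambda>\<xi>. fourier_L1 (u n) \<xi> * \<phi> \<xi>)"
      proof (rule Bochner_Integration.integrable_bound)
        show "integrable lborel (\<lambda>\<xi>. (LINT t|lborel. cmod (v n t)) * cmod (\<phi> \<xi>))" using \<phi>i by simp
        show "AE \<xi> in lborel. norm (fourier_L1 (u n) \<xi> * \<phi> \<xi>) \<le> norm ((LINT t|lborel. cmod (v n t)) * cmod (\<phi> \<xi>))"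
          unfolding fu using norm_osc_integral_le[of "- 2 * pi" "v n"]
          by (intro AE_I2) (simp add: norm_mult abs_mult mult_right_mono)
      qed (simp add: fu)
    qed (simp add: fu)
    have "integrable lebesgue (\<lambda>\<xi>. g' \<xi> * \<phi> \<xi>)"
    proof (subst integrable_completion)
      show "integrable lborel (\<lambda>\<xi>. g' \<xi> * \<phi> \<xi>)"
        using \<phi>1 by (intro Bochner_Integration.integrable_bound[OF g'(1)]) (auto simp: norm_mult mult_left_le)
    qed simp
    thus "integrable lebesgue (\<lambda>\<xi>. g \<xi> * \<phi> \<xi>)"
      using AE_completion[OF g'(2)] gm by (subst integrable_cong_AE[where g = "\<lambda>\<xi>. g' \<xi> * \<phi> \<xi>"])
        (auto intro!: borel_measurable_times L)
    show "(\<integral>\<^sup>+x. ennreal ((cmod (\<phi> x))\<^sup>2) \<partial>lebesgue) < \<infinity>"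
      using \<phi>2 by (subst nn_integral_completion) auto
  qed
  have fsq: "integrable lborel (\<lambda>x. (cmod (f' x))\<^sup>2)"
  proof -
    have "integrable lebesgue (\<lambda>x. (cmod (f' x))\<^sup>2)"
      using f AE_completion[OF f'(2)] fm comp[OF f'(1)] unfolding in_L2_def
      by (subst integrable_cong_AE[where g = "\<lambda>x. (cmod (f x))\<^sup>2"]) auto
    thus ?thesis by (subst (asm) integrable_completion) auto
  qed
  have lim2: "(\<lambda>n. LINT t|lebesgue. u n t * \<psi> t) \<longlonglongrightarrow> (LINT t|lebesgue. f t * \<psi> t)"
  proof (rule L2_tendsto_integral_mult[OF um fm _ _ _ _ lim(1)])
    show "\<psi> \<in> borel_measurable lebesgue" by (intro comp) measurable
    have "integrable lebesgue (\<lambda>t. v n t * \<psi> t)" for n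
    proof (subst integrable_completion)
      show "integrable lborel (\<lambda>t. v n t * \<psi> t)"
      proof (rule Bochner_Integration.integrable_bound)
        show "integrable lborel (\<lambda>t. cmod (v n t) * (1 / sqrt (2 * pi * \<sigma>\<^sup>2)))" using vi[of n] by simp
        show "AE t in lborel. norm (v n t * \<psi> t) \<le> norm (cmod (v n t) * (1 / sqrt (2 * pi * \<sigma>\<^sup>2)))"
          using mult_left_mono[OF \<psi>B] by (intro AE_I2) (simp add: norm_mult abs_mult)
      qed simp
    qed simp
    thus "integrable lebesgue (\<lambda>t. u n t * \<psi> t)" for n
      using AE_completion[OF uv[of n]] um[of n] by (subst integrable_cong_AE[where g = "\<lambda>\<xi>. v n \<xi> * \<psi> \<xi>"])
        (auto intro!: borel_measurable_times L)
    have "integrable lebesgue (\<lambda>t. f' t * \<psi> t)"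
    proof (subst integrable_completion)
      show "integrable lborel (\<lambda>t. f' t * \<psi> t)"
        using fsq \<psi>sq by (intro integrable_mult_of_L2) auto
    qed simp
    thus "integrable lebesgue (\<lambda>t. f t * \<psi> t)"
      using AE_completion[OF f'(2)] fm by (subst integrable_cong_AE[where g = "\<lambda>\<xi>. f' \<xi> * \<psi> \<xi>"])
        (auto intro!: borel_measurable_times L)
    show "(\<integral>\<^sup>+x. ennreal ((cmod (\<psi> x))\<^sup>2) \<partial>lebesgue) < \<infinity>"
      using \<psi>2 by (subst nn_integral_completion) auto
  qed
  have rep: "(LINT t|lebesgue. w t * \<theta> t) = (LINT t|lborel. w' t * \<theta> t)"
    if "w \<in> borel_measurable lebesgue" "w' \<in> borel_measurable borel" "AE x in lborel. w x = w' x"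
      "\<theta> \<in> borel_measurable borel" for w w' \<theta> :: "real \<Rightarrow> complex"
  proof -
    have "(LINT t|lebesgue. w t * \<theta> t) = (LINT t|lebesgue. w' t * \<theta> t)"
      using AE_completion[OF that(3)] that(1) comp[OF that(2)] comp[OF that(4)]
      by (intro integral_cong_AE borel_measurable_times) auto
    also have "\<dots> = (LINT t|lborel. w' t * \<theta> t)"
      using that by (intro integral_completion) simp
    finally show ?thesis .
  qed
  have "(LINT \<xi>|lebesgue. fourier_L1 (u n) \<xi> * \<phi> \<xi>) = (LINT t|lebesgue. u n t * \<psi> t)" for n
    using eq[of n] rep[OF um v uv, of \<psi> n] rep[of "fourier_L1 (u n)" "fourier_L1 (u n)" \<phi>] 
    by (simp add: fu comp)
  hence "(LINT \<xi>|lebesgue. g \<xi> * \<phi> \<xi>) = (LINT t|lebesgue. f t * \<psi> t)"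
    using lim1 lim2 LIMSEQ_unique by simp
  hence "(LINT \<xi>|lborel. g' \<xi> * \<phi> \<xi>) = (LINT t|lborel. f' t * \<psi> t)"
    using rep[OF gm _ g'(2), of \<phi>] rep[OF fm f'(1,2), of \<psi>] by simp
  thus ?thesis by (simp add: \<phi>_def \<psi>_def)
qed

text \<open>The right-hand side agrees with that of \<open>smoothing_of_fourier_L2\<close>, so f and
  the inverse transform of g have equal Gaussian means at every point and scale.\<close>

lemma smoothing_of_osc_integral:
  assumes g: "integrable lborel g" and \<sigma>: "0 < \<sigma>"
  shows "(LINT t|lborel. osc_integral (2 * pi) g t * complex_of_real (normal_density 0 \<sigma> (x - t)))
    = (LINT \<xi>|lborel. g \<xi> * (complex_of_real (gauss \<sigma> \<xi>) * cis (2 * pi * x * \<xi>)))"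
proof -
  define b where "b = (\<lambda>t. complex_of_real (normal_density 0 \<sigma> (x - t)))"
  have bi: "integrable lborel b"
    unfolding b_def by (intro integrable_of_real integrable_normal_density_shift \<sigma>)
  have ob: "osc_integral (2 * pi) b \<xi> = complex_of_real (gauss \<sigma> \<xi>) * cis (2 * pi * x * \<xi>)" for \<xi>
  proof -
    have "osc_integral (2 * pi) b \<xi>
        = \<bar>-1\<bar> *\<^sub>R (LINT y|lborel. b (x + (-1) * y) * cis (2 * pi * \<xi> * (x + (-1) * y)))"
      unfolding osc_integral_def by (rule lborel_integral_real_affine) simp
    also have "\<dots> = (LINT y|lborel. (complex_of_real (normal_density 0 \<sigma> y) * cis (- 2 * pi * \<xi> * y)) * cis (2 * pi * x * \<xi>))"
      by (simp add: b_def mult.assoc cis_mult algebra_simps)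
    also have "\<dots> = osc_integral (- 2 * pi) (\<lambda>y. complex_of_real (normal_density 0 \<sigma> y)) \<xi> * cis (2 * pi * x * \<xi>)"
      unfolding osc_integral_def by (rule integral_mult_left_zero)
    also have "osc_integral (- 2 * pi) (\<lambda>y. complex_of_real (normal_density 0 \<sigma> y)) \<xi> = gauss \<sigma> \<xi>"
      by (subst osc_integral_normal[OF \<sigma>]) (simp add: gauss_def)
    finally show ?thesis .
  qed
  have "(LINT t|lborel. b t * osc_integral (2 * pi) g t) = (LINT \<xi>|lborel. g \<xi> * osc_integral (2 * pi) b \<xi>)"
    by (rule osc_integral_multiplication[OF g bi])
  thus ?thesis unfolding ob by (simp add: b_def mult.commute)
qed

text \<open>Integrating the vanishing Gaussian means over \<open>{a..b}\<close> and exchanging integrals leaves the mean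
  over \<open>y\<close> of the continuous function \<open>z \<mapsto> \<integral>\<^sub>a\<^sup>b h (x - z) dx\<close> at \<open>z = \<sigma> y\<close>; then \<open>\<sigma> \<rightarrow> 0\<close>.\<close>

lemma interval_integral_zero_of_gauss_smoothing:
  fixes h :: "real \<Rightarrow> complex"
  assumes hm [measurable]: "h \<in> borel_measurable borel"
    and loc: "\<And>a b. \<exists>C\<ge>0. \<forall>z. (\<integral>\<^sup>+x. ennreal (indicator {a..b} x * cmod (h (x - z))) \<partial>lborel) \<le> ennreal C"
    and sm: "\<And>\<sigma> x. 0 < \<sigma> \<Longrightarrow> (LINT t|lborel. h t * complex_of_real (normal_density 0 \<sigma> (x - t))) = 0"
  shows "(LINT x:{a..b}|lborel. h x) = 0"
proof -
  obtain C where C: "0 \<le> C"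
    "\<And>z. (\<integral>\<^sup>+x. ennreal (indicator {a..b} x * cmod (h (x - z))) \<partial>lborel) \<le> ennreal C"
    using loc[of a b] by blast
  define I where "I x = complex_of_real (indicator {a..b} x)" for x :: real
  have [measurable]: "I \<in> borel_measurable borel" unfolding I_def by measurable
  have nI: "cmod (I x * h y) = indicator {a..b} x * cmod (h y)" for x y
    by (simp add: I_def norm_mult)
  have int1: "integrable lborel (\<lambda>x. I x * h (x - z))" for z
    using C(2)[of z] by (intro integrableI_bounded) (auto simp: nI intro: le_less_trans)
  define \<kappa> where "\<kappa> z = (LINT x|lborel. I x * h (x - z))" for z
  have [measurable]: "\<kappa> \<in> borel_measurable borel" unfolding \<kappa>_def by measurable
  have nle: "(LINT x|lborel. cmod (I x * h (x - z))) \<le> C" for z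
  proof -
    have "ennreal (LINT x|lborel. cmod (I x * h (x - z))) = (\<integral>\<^sup>+x. ennreal (cmod (I x * h (x - z))) \<partial>lborel)"
      using int1[of z] by (intro nn_integral_eq_integral[symmetric]) auto
    also have "\<dots> \<le> ennreal C" using C(2)[of z] by (simp add: nI)
    finally show ?thesis using C(1) by simp
  qed
  have \<kappa>C: "cmod (\<kappa> z) \<le> C" for z
    unfolding \<kappa>_def by (rule order_trans[OF integral_norm_bound nle])
  let ?n = "\<lambda>y. complex_of_real (std_normal_density y)"
  have zero: "(LINT y|lborel. ?n y * \<kappa> (\<sigma> * y)) = 0" if \<sigma>: "0 < \<sigma>" for \<sigma>
  proof -
    have int2: "integrable (lborel \<Otimes>\<^sub>M lborel) (\<lambda>(y, x). ?n y * (I x * h (x - \<sigma> * y)))"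
    proof (rule lborel_pair.Fubini_integrable)
      show "(\<lambda>(y, x). ?n y * (I x * h (x - \<sigma> * y))) \<in> borel_measurable (lborel \<Otimes>\<^sub>M lborel)"
        by measurable
      show "integrable lborel (\<lambda>y. LINT x|lborel. norm (case (y, x) of (y, x) \<Rightarrow> ?n y * (I x * h (x - \<sigma> * y))))"
      proof (rule Bochner_Integration.integrable_bound)
        show "integrable lborel (\<lambda>y. C * std_normal_density y)" by (intro integrable_mult_right) auto
        show "(\<lambda>y. LINT x|lborel. norm (case (y, x) of (y, x) \<Rightarrow> ?n y * (I x * h (x - \<sigma> * y)))) \<in> borel_measurable lborel"
          by measurable
        show "AE y in lborel. norm (LINT x|lborel. norm (case (y, x) of (y, x) \<Rightarrow> ?n y * (I x * h (x - \<sigma> * y))))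
            \<le> norm (C * std_normal_density y)"
        proof (intro AE_I2)
          fix y
          have "(LINT x|lborel. norm (?n y * (I x * h (x - \<sigma> * y))))
              = std_normal_density y * (LINT x|lborel. cmod (I x * h (x - \<sigma> * y)))"
            by (simp add: norm_mult[of "?n y"])
          also have "\<dots> \<le> std_normal_density y * C" by (intro mult_left_mono nle) auto
          finally show "norm (LINT x|lborel. norm (case (y, x) of (y, x) \<Rightarrow> ?n y * (I x * h (x - \<sigma> * y))))
            \<le> norm (C * std_normal_density y)"
            using C(1) by (simp add: abs_mult mult.commute)
        qed
      qed
      show "AE y in lborel. integrable lborel (\<lambda>x. case (y, x) of (y, x) \<Rightarrow> ?n y * (I x * h (x - \<sigma> * y)))"
        using int1 by (intro AE_I2) simp
    qed
    have inner: "(LINT y|lborel. ?n y * h (x - \<sigma> * y)) = 0" for x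
    proof -
      have "0 = (LINT t|lborel. h t * complex_of_real (normal_density 0 \<sigma> (x - t)))" using sm[OF \<sigma>] by simp
      also have "\<dots> = \<bar>-\<sigma>\<bar> *\<^sub>R (LINT y|lborel. h (x + (-\<sigma>) * y) * complex_of_real (normal_density 0 \<sigma> (x - (x + (-\<sigma>) * y))))"
        using \<sigma> by (intro lborel_integral_real_affine) simp
      also have "\<dots> = \<sigma> *\<^sub>R (LINT y|lborel. (?n y * h (x - \<sigma> * y)) / complex_of_real \<sigma>)"
      proof -
        have e: "x - (x + (-\<sigma>) * y) = \<sigma> * y" "x + (-\<sigma>) * y = x - \<sigma> * y" for y by simp_all
        show ?thesis unfolding e using \<sigma>
          by (simp add: mult.commute[of "h _"] normal_density_scale)
      qed
      finally show ?thesis using \<sigma> by (simp add: scaleR_conv_of_real)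
    qed
    have "(LINT y|lborel. ?n y * \<kappa> (\<sigma> * y)) = (LINT y|lborel. LINT x|lborel. ?n y * (I x * h (x - \<sigma> * y)))"
      unfolding \<kappa>_def by simp
    also have "\<dots> = (LINT x|lborel. LINT y|lborel. ?n y * (I x * h (x - \<sigma> * y)))"
      by (rule lborel_pair.Fubini_integral[OF int2, symmetric])
    also have "\<dots> = (LINT x|lborel. I x * (LINT y|lborel. ?n y * h (x - \<sigma> * y)))"
      by (intro Bochner_Integration.integral_cong refl) (simp add: mult_ac flip: integral_mult_right_zero)
    also have "\<dots> = 0" unfolding inner by simp
    finally show ?thesis .
  qed
  \<comment> \<open>Moving the shift from h to the indicator gives pointwise convergence off the two
    endpoints, whatever h is. The shifts are bounded by M, so the integrand is dominated on the
    interval enlarged by M.\<close>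
  have \<kappa>lim: "(\<lambda>k. \<kappa> (z k)) \<longlonglongrightarrow> \<kappa> 0" if z: "z \<longlonglongrightarrow> 0" for z :: "nat \<Rightarrow> real"
  proof -
    have shift: "\<kappa> w = (LINT t|lborel. I (t + w) * h t)" for w
      unfolding \<kappa>_def by (subst lborel_integral_real_affine[of 1 _ w]) (auto simp: add.commute)
    have "Bseq z" using z convergentI convergent_imp_Bseq by blast
    then obtain M where M: "\<And>k. \<bar>z k\<bar> \<le> M" by (auto simp: Bseq_def)
    obtain C' where "0 \<le> C'"
      "\<And>z. (\<integral>\<^sup>+x. ennreal (indicator {a-M..b+M} x * cmod (h (x - z))) \<partial>lborel) \<le> ennreal C'"
      using loc[of "a-M" "b+M"] by blast
    from this(2)[of 0] have dom: "integrable lborel (\<lambda>t. indicator {a-M..b+M} t * cmod (h t))"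
      by (intro integrableI_bounded) (auto intro: le_less_trans)
    show ?thesis unfolding shift
    proof (rule integral_dominated_convergence[OF _ _ dom])
      have "AE t in lborel. t \<noteq> a \<and> t \<noteq> b"
        using AE_lborel_singleton[of a] AE_lborel_singleton[of b] by eventually_elim auto
      thus "AE t in lborel. (\<lambda>k. I (t + z k) * h t) \<longlonglongrightarrow> I (t + 0) * h t"
      proof eventually_elim
        case (elim t)
        have tz: "(\<lambda>k. t + z k) \<longlonglongrightarrow> t" using tendsto_add[OF tendsto_const z, of t] by simp
        have "\<forall>\<^sub>F k in sequentially. I (t + z k) = I t"
        proof -
          consider "t < a" | "t > b" | "a < t" "t < b" using elim by linarith
          thus ?thesis
          proof cases
            case 1 from order_tendstoD(2)[OF tz 1] show ?thesis by eventually_elim (use 1 in \<open>simp add: I_def\<close>)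
          next
            case 2 from order_tendstoD(1)[OF tz 2] show ?thesis by eventually_elim (use 2 in \<open>simp add: I_def\<close>)
          next
            case 3
            from order_tendstoD(1)[OF tz 3(1)] order_tendstoD(2)[OF tz 3(2)] show ?thesis
              by eventually_elim (use 3 in \<open>simp add: I_def\<close>)
          qed
        qed
        hence "\<forall>\<^sub>F k in sequentially. I (t + z k) * h t = I (t + 0) * h t"
          by eventually_elim simp
        thus ?case by (rule tendsto_eventually)
      qed
      show "AE t in lborel. norm (I (t + z k) * h t) \<le> indicator {a-M..b+M} t * cmod (h t)" for k
      proof (intro AE_I2)
        fix t
        have "(indicator {a..b} (t + z k) :: real) \<le> indicator {a-M..b+M} t"
          using M[of k] by (auto simp: indicator_def)
        thus "norm (I (t + z k) * h t) \<le> indicator {a-M..b+M} t * cmod (h t)"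
          unfolding nI by (rule mult_right_mono) simp
      qed
    qed measurable
  qed
  have "(\<lambda>k. LINT y|lborel. ?n y * \<kappa> ((1 / real (Suc k)) * y)) \<longlonglongrightarrow> (LINT y|lborel. ?n y * \<kappa> 0)"
  proof (rule integral_dominated_convergence)
    show "integrable lborel (\<lambda>y. C * std_normal_density y)" by (intro integrable_mult_right) auto
    show "AE y in lborel. (\<lambda>k. ?n y * \<kappa> ((1 / real (Suc k)) * y)) \<longlonglongrightarrow> ?n y * \<kappa> 0"
    proof (intro AE_I2 tendsto_intros \<kappa>lim)
      fix y :: real
      have "(\<lambda>k. (1 / real (Suc k)) * y) \<longlonglongrightarrow> 0 * y"
        by (intro tendsto_intros LIMSEQ_Suc[OF lim_1_over_n])
      thus "(\<lambda>k. (1 / real (Suc k)) * y) \<longlonglongrightarrow> 0" by simp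
    qed
    show "AE y in lborel. norm (?n y * \<kappa> ((1 / real (Suc k)) * y)) \<le> C * std_normal_density y" for k
    proof (intro AE_I2)
      fix y
      have "norm (?n y * \<kappa> ((1 / real (Suc k)) * y)) = std_normal_density y * cmod (\<kappa> ((1 / real (Suc k)) * y))"
        by (simp add: norm_mult)
      also have "\<dots> \<le> std_normal_density y * C" by (intro mult_left_mono \<kappa>C) auto
      finally show "norm (?n y * \<kappa> ((1 / real (Suc k)) * y)) \<le> C * std_normal_density y" by (simp only: mult.commute)
    qed
  qed measurable
  moreover have "(LINT y|lborel. ?n y * \<kappa> ((1 / real (Suc k)) * y)) = 0" for k by (rule zero) simp
  ultimately have "(LINT y|lborel. ?n y * \<kappa> 0) = 0" by (simp add: LIMSEQ_const_iff)
  hence "\<kappa> 0 = 0" by (simp add: integral_complex_of_real)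
  thus ?thesis by (simp add: \<kappa>_def I_def set_lebesgue_integral_def scaleR_conv_of_real)
qed

text \<open>Truncation to \<open>{- real n..real n}\<close> makes h integrable; vanishing over
  intervals then spreads to all Borel sets through complements and disjoint unions, which forces the
  truncated function to be null. Countably many n cover the line.\<close>

lemma AE_zero_of_interval_integrals:
  fixes h :: "real \<Rightarrow> complex"
  assumes hm [measurable]: "h \<in> borel_measurable borel"
    and loc: "\<And>a b. set_integrable lborel {a..b} h"
    and zero: "\<And>a b. (LINT x:{a..b}|lborel. h x) = 0"
  shows "AE x in lborel. h x = 0"
proof -
  have "AE x in lborel. indicator {- real n..real n} x *\<^sub>R h x = 0" for n :: nat
  proof (rule sigma_finite_measure.density_zero[OF sigma_finite_lborel])
    let ?h = "\<lambda>x. indicator {- real n..real n} x *\<^sub>R h x"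
    show hi: "integrable lborel ?h" using loc[of "- real n" "real n"] by (simp add: set_integrable_def)
    have hset: "set_integrable lborel A ?h" if "A \<in> sets borel" for A
      unfolding set_integrable_def by (intro integrable_mult_indicator hi) (use that in simp)
    fix A :: "real set" assume "A \<in> sets lborel"
    hence "A \<in> sets borel" by simp
    thus "(LINT x:A|lborel. ?h x) = 0"
    proof (induction A rule: borel_set_induct)
      case empty show ?case by (simp add: set_lebesgue_integral_def)
    next
      case (interval c d)
      have "(LINT x:{c..d}|lborel. ?h x) = (LINT x:{max c (- real n)..min d (real n)}|lborel. h x)"
        unfolding set_lebesgue_integral_def
        by (intro Bochner_Integration.integral_cong refl) (auto simp: indicator_def)
      thus ?case by (simp add: zero)
    next
      case (compl A)
      have "(LINT x:UNIV|lborel. ?h x) = (LINT x:A|lborel. ?h x) + (LINT x:-A|lborel. ?h x)"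
        using compl by (subst set_integral_Un[symmetric]) (auto intro!: hset)
      moreover have "(LINT x:UNIV|lborel. ?h x) = 0"
        using zero[of "- real n" "real n"] by (simp add: set_lebesgue_integral_def)
      ultimately show ?case using compl by simp
    next
      case (union f)
      have "(LINT x:(\<Union>i. f i)|lborel. ?h x) = (\<Sum>i. LINT x:f i|lborel. ?h x)"
        using union by (intro lebesgue_integral_countable_add hset) (auto simp: disjoint_family_on_def)
      thus ?case using union by simp
    qed
  qed
  hence "AE x in lborel. \<forall>n::nat. indicator {- real n..real n} x *\<^sub>R h x = 0"
    by (subst AE_all_countable) auto
  thus ?thesis
  proof eventually_elim
    case (elim x)
    obtain n :: nat where "\<bar>x\<bar> \<le> real n" using real_arch_simple by blast
    thus ?case using elim[rule_format, of n] by (auto simp: indicator_def abs_le_iff split: if_splits)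
  qed
qed

text \<open>By the two smoothing identities the difference h of both sides has vanishing Gaussian
  means. Since f' is square integrable and the inverse transform is bounded, the modulus of h is at
  most that of f' squared plus a constant; this bounds its integrals over all translates of an
  interval uniformly, as \<open>interval_integral_zero_of_gauss_smoothing\<close> demands.\<close>

theorem fourier_inversion_AE:
  assumes four: "has_fourier_L2 f g"
    and f': "f' \<in> borel_measurable borel" "AE x in lborel. f x = f' x"
    and f2: "integrable lborel (\<lambda>x. (cmod (f' x))\<^sup>2)"
    and g': "integrable lborel g'" "AE x in lborel. g x = g' x"
  shows "AE x in lborel. f' x = osc_integral (2 * pi) g' x"
proof -
  define F where "F = osc_integral (2 * pi) g'"
  note [measurable] = f'(1) borel_measurable_integrable[OF g'(1), simplified]
  have [measurable]: "F \<in> borel_measurable borel" unfolding F_def by measurable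
  define M where "M = (LINT \<xi>|lborel. cmod (g' \<xi>))"
  have FM: "cmod (F x) \<le> M" for x unfolding F_def M_def by (rule norm_osc_integral_le)
  have M0: "0 \<le> M" unfolding M_def by simp
  define h where "h x = f' x - F x" for x
  have [measurable]: "h \<in> borel_measurable borel" unfolding h_def by measurable
  have hle: "cmod (h x) \<le> (cmod (f' x))\<^sup>2 + (1 + M)" for x
  proof -
    have "2 * cmod (f' x) \<le> (cmod (f' x))\<^sup>2 + 1"
      using sum_squares_bound[of "cmod (f' x)" 1] by simp
    hence "cmod (f' x) \<le> (cmod (f' x))\<^sup>2 + 1" using norm_ge_zero[of "f' x"] by linarith
    thus ?thesis using norm_triangle_ineq4[of "f' x" "F x"] FM[of x] unfolding h_def by linarith
  qed
  have loc: "\<exists>C\<ge>0. \<forall>z. (\<integral>\<^sup>+x. ennreal (indicator {a..b} x * cmod (h (x - z))) \<partial>lborel) \<le> ennreal C" for a b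
  proof (intro exI conjI allI)
    let ?C = "(LINT x|lborel. (cmod (f' x))\<^sup>2) + (1 + M) * measure lborel {a..b}"
    show "0 \<le> ?C" using M0 by simp
    fix z
    have "(\<integral>\<^sup>+x. ennreal (indicator {a..b} x * cmod (h (x - z))) \<partial>lborel)
      \<le> (\<integral>\<^sup>+x. ennreal ((cmod (f' (- z + 1 * x)))\<^sup>2) + ennreal (1 + M) * indicator {a..b} x \<partial>lborel)"
    proof (intro nn_integral_mono)
      fix x
      have "ennreal (cmod (h (x - z))) \<le> ennreal ((cmod (f' (x - z)))\<^sup>2) + ennreal (1 + M)"
        using hle[of "x - z"] M0 by (simp flip: ennreal_plus add: ennreal_leI)
      thus "ennreal (indicator {a..b} x * cmod (h (x - z))) \<le> ennreal ((cmod (f' (- z + 1 * x)))\<^sup>2) + ennreal (1 + M) * indicator {a..b} x"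
        by (auto simp: indicator_def)
    qed
    also have "\<dots> = (\<integral>\<^sup>+x. ennreal ((cmod (f' (- z + 1 * x)))\<^sup>2) \<partial>lborel) + (\<integral>\<^sup>+x. ennreal (1 + M) * indicator {a..b} x \<partial>lborel)"
      by (intro nn_integral_add) auto
    also have "(\<integral>\<^sup>+x. ennreal ((cmod (f' (- z + 1 * x)))\<^sup>2) \<partial>lborel) = (\<integral>\<^sup>+x. ennreal ((cmod (f' x))\<^sup>2) \<partial>lborel)"
      using nn_integral_real_affine[of "\<lambda>x. ennreal ((cmod (f' x))\<^sup>2)" 1 "- z"] by simp
    also have "\<dots> = ennreal (LINT x|lborel. (cmod (f' x))\<^sup>2)"
      using f2 by (intro nn_integral_eq_integral) auto
    also have "(\<integral>\<^sup>+x. ennreal (1 + M) * indicator {a..b} x \<partial>lborel) = ennreal ((1 + M) * measure lborel {a..b})"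
    proof -
      have "emeasure lborel {a..b} = ennreal (measure lborel {a..b})"
        by (rule emeasure_eq_ennreal_measure) (simp add: emeasure_lborel_Icc_eq)
      thus ?thesis using M0 by (simp add: nn_integral_cmult_indicator ennreal_mult del: ennreal_plus)
    qed
    finally show "(\<integral>\<^sup>+x. ennreal (indicator {a..b} x * cmod (h (x - z))) \<partial>lborel) \<le> ennreal ?C"
      using M0 by (simp add: ennreal_plus)
  qed
  have sm: "(LINT t|lborel. h t * complex_of_real (normal_density 0 \<sigma> (x - t))) = 0" if \<sigma>: "0 < \<sigma>" for \<sigma> x
  proof -
    have i1: "integrable lborel (\<lambda>t. f' t * complex_of_real (normal_density 0 \<sigma> (x - t)))"
      using f2 integrable_normal_density_square[OF \<sigma>] by (intro integrable_mult_of_L2) auto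
    have i2: "integrable lborel (\<lambda>t. F t * complex_of_real (normal_density 0 \<sigma> (x - t)))"
    proof (rule Bochner_Integration.integrable_bound)
      show "integrable lborel (\<lambda>t. M * normal_density 0 \<sigma> (x - t))"
        by (intro integrable_mult_right integrable_normal_density_shift \<sigma>)
      show "AE t in lborel. norm (F t * complex_of_real (normal_density 0 \<sigma> (x - t))) \<le> norm (M * normal_density 0 \<sigma> (x - t))"
        using FM M0 by (intro AE_I2) (auto simp: norm_mult abs_mult intro!: mult_right_mono)
    qed measurable
    show ?thesis
      using i1 i2 smoothing_of_fourier_L2[OF four \<sigma> f' g', of x] smoothing_of_osc_integral[OF g'(1) \<sigma>, of x]
      by (simp add: h_def left_diff_distrib F_def)
  qed
  have si: "set_integrable lborel {a..b} h" for a b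
  proof -
    obtain C where "(\<integral>\<^sup>+x. ennreal (indicator {a..b} x * cmod (h (x - 0))) \<partial>lborel) \<le> ennreal C"
      using loc[of a b] by blast
    thus ?thesis unfolding set_integrable_def
      by (intro integrableI_bounded) (auto intro: le_less_trans)
  qed
  have "AE x in lborel. h x = 0"
    by (intro AE_zero_of_interval_integrals si interval_integral_zero_of_gauss_smoothing loc sm) auto
  thus ?thesis by eventually_elim (simp add: h_def F_def)
qed

text \<open>The second moment is assumed so that |exp (i t) - 1 - i t| \<le> t^2 / 2 yields an
  explicit quadratic error for the difference quotient, instead of a limit under the integral. In
  the application all moments are available.\<close>

lemma osc_integral_has_vector_derivative:
  assumes g0: "integrable lborel g" and g1: "integrable lborel (\<lambda>\<xi>. complex_of_real \<xi> * g \<xi>)"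
    and g2: "integrable lborel (\<lambda>\<xi>. complex_of_real \<xi> ^ 2 * g \<xi>)"
  shows "(osc_integral s g has_vector_derivative osc_integral s (\<lambda>\<xi>. \<i> * complex_of_real s * (complex_of_real \<xi> * g \<xi>)) x) (at x)"
proof -
  define F where "F = osc_integral s g"
  define D where "D = osc_integral s (\<lambda>\<xi>. \<i> * complex_of_real s * (complex_of_real \<xi> * g \<xi>)) x"
  define K where "K = (LINT \<xi>|lborel. cmod (complex_of_real \<xi> ^ 2 * g \<xi>))"
  have bound: "norm (F y - F x - (y - x) *\<^sub>R D) \<le> s\<^sup>2 / 2 * K * \<bar>y - x\<bar> ^ 2" for y
  proof -
    define h where "h = y - x"
    define r where "r \<xi> = g \<xi> * cis (s * x * \<xi>) * (cis (s * h * \<xi>) - 1 - \<i> * complex_of_real (s * h * \<xi>))" for \<xi>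
    have i1: "integrable lborel (\<lambda>\<xi>. \<i> * complex_of_real s * (complex_of_real \<xi> * g \<xi>))"
      using g1 by (rule integrable_mult_right)
    have ir: "integrable lborel r" and Fr: "F y - F x - h *\<^sub>R D = (LINT \<xi>|lborel. r \<xi>)"
    proof -
      have rr: "r \<xi> = g \<xi> * cis (s * y * \<xi>) - g \<xi> * cis (s * x * \<xi>)
          - complex_of_real h * ((\<i> * complex_of_real s * (complex_of_real \<xi> * g \<xi>)) * cis (s * x * \<xi>))" for \<xi>
      proof -
        have "cis (s * y * \<xi>) = cis (s * x * \<xi>) * cis (s * h * \<xi>)"
          by (simp add: cis_mult h_def algebra_simps)
        thus ?thesis by (simp add: r_def algebra_simps)
      qed
      note j = integrable_mult_cis[OF g0, of s y] integrable_mult_cis[OF g0, of s x]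
        integrable_mult_right[OF integrable_mult_cis[OF i1, of s x], of "complex_of_real h"]
      show "integrable lborel r" unfolding rr[abs_def]
        by (intro Bochner_Integration.integrable_diff j)
      have "(LINT \<xi>|lborel. r \<xi>) = F y - F x - complex_of_real h * D"
        unfolding rr[abs_def] F_def D_def osc_integral_def
        by (subst Bochner_Integration.integral_diff, intro Bochner_Integration.integrable_diff j, rule j,
            subst Bochner_Integration.integral_diff, rule j, rule j, subst integral_mult_right_zero) simp
      thus "F y - F x - h *\<^sub>R D = (LINT \<xi>|lborel. r \<xi>)" by (simp add: scaleR_conv_of_real)
    qed
    have "norm (F y - F x - h *\<^sub>R D) \<le> (LINT \<xi>|lborel. norm (r \<xi>))"
      unfolding Fr by (rule integral_norm_bound)
    also have "\<dots> \<le> (LINT \<xi>|lborel. s\<^sup>2 / 2 * h\<^sup>2 * cmod (complex_of_real \<xi> ^ 2 * g \<xi>))"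
    proof (intro integral_mono)
      show "integrable lborel (\<lambda>\<xi>. norm (r \<xi>))" using ir by simp
      show "integrable lborel (\<lambda>\<xi>. s\<^sup>2 / 2 * h\<^sup>2 * cmod (complex_of_real \<xi> ^ 2 * g \<xi>))"
        using g2 by (intro integrable_mult_right integrable_norm)
      fix \<xi>
      have "cmod (cis (s * h * \<xi>) - 1 - \<i> * complex_of_real (s * h * \<xi>)) \<le> \<bar>s * h * \<xi>\<bar>\<^sup>2 / 2"
        using iexp_approx1[of "s * h * \<xi>" 1]
        by (simp add: cis_conv_exp fact_numeral numeral_2_eq_2 diff_diff_eq)
      hence "cmod (g \<xi>) * cmod (cis (s * h * \<xi>) - 1 - \<i> * complex_of_real (s * h * \<xi>)) \<le> cmod (g \<xi>) * (\<bar>s * h * \<xi>\<bar>\<^sup>2 / 2)"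
        by (intro mult_left_mono) auto
      thus "norm (r \<xi>) \<le> s\<^sup>2 / 2 * h\<^sup>2 * cmod (complex_of_real \<xi> ^ 2 * g \<xi>)"
        by (simp add: r_def norm_mult norm_power power_mult_distrib mult_ac)
    qed
    also have "\<dots> = s\<^sup>2 / 2 * h\<^sup>2 * K" unfolding K_def by (rule integral_mult_right_zero)
    finally show ?thesis by (simp add: h_def mult_ac)
  qed
  have "((\<lambda>y. norm (F y - F x - (y - x) *\<^sub>R D) / norm (y - x)) \<longlongrightarrow> 0) (at x)"
  proof (rule tendsto_sandwich)
    show "\<forall>\<^sub>F y in at x. 0 \<le> norm (F y - F x - (y - x) *\<^sub>R D) / norm (y - x)" by simp
    show "\<forall>\<^sub>F y in at x. norm (F y - F x - (y - x) *\<^sub>R D) / norm (y - x) \<le> s\<^sup>2 / 2 * K * \<bar>y - x\<bar>"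
    proof (intro always_eventually allI)
      fix y
      show "norm (F y - F x - (y - x) *\<^sub>R D) / norm (y - x) \<le> s\<^sup>2 / 2 * K * \<bar>y - x\<bar>"
      proof (cases "y = x")
        case False
        define d where "d = \<bar>y - x\<bar>"
        have "d \<noteq> 0" using False by (simp add: d_def)
        have "norm (F y - F x - (y - x) *\<^sub>R D) / d \<le> (s\<^sup>2 / 2 * K * d ^ 2) / d"
          unfolding d_def by (intro divide_right_mono bound) simp
        also have "\<dots> = s\<^sup>2 / 2 * K * d" using \<open>d \<noteq> 0\<close> by (simp add: power2_eq_square[of d])
        finally show ?thesis by (simp add: d_def)
      qed simp
    qed
    have "((\<lambda>y. s\<^sup>2 / 2 * K * \<bar>y - x\<bar>) \<longlongrightarrow> s\<^sup>2 / 2 * K * \<bar>x - x\<bar>) (at x)"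
      by (intro tendsto_intros)
    thus "((\<lambda>y. s\<^sup>2 / 2 * K * \<bar>y - x\<bar>) \<longlongrightarrow> 0) (at x)" by simp
  qed simp
  hence "(F has_vector_derivative D) (at x)"
    unfolding has_vector_derivative_def has_derivative_iff_norm
    by (intro conjI bounded_linear_scaleR_left) auto
  thus ?thesis by (simp add: F_def D_def)
qed

lemma integrable_inverse_square: "integrable lborel (\<lambda>x::real. 1 / (1 + x\<^sup>2))"
proof -
  have "set_integrable lborel UNIV (\<lambda>x::real. inverse (1 + x\<^sup>2))"
    using integrable_inverse_1_plus_square by simp
  thus ?thesis by (simp add: set_integrable_def inverse_eq_divide)
qed

text \<open>By \<open>moment_bound\<close>, each power of 2 pi |\<xi>| is at most P n times the
  weight, which gives the L2 bound. Integrability combines the L2 bounds of orders n and n +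
  1.\<close>

lemma weighted_moments:
  fixes g :: "real \<Rightarrow> complex"
  assumes \<alpha>: "0 < \<alpha>" "\<alpha> \<le> 1" and gm [measurable]: "g \<in> borel_measurable borel" and V: "0 \<le> V"
    and w: "(\<integral>\<^sup>+\<xi>. ennreal ((cmod (g \<xi>) * exp (\<alpha> * Theta \<xi>))\<^sup>2) \<partial>lborel) \<le> ennreal V"
  shows weighted_moments_L2: "(\<integral>\<^sup>+\<xi>. ennreal ((cmod ((2 * pi * \<i> * complex_of_real \<xi>) ^ n * g \<xi>))\<^sup>2) \<partial>lborel)
      \<le> ennreal ((\<Prod>k=1..n. moment_ratio (2 * pi * exp 6) \<alpha> k)\<^sup>2 * V)"
    and weighted_moments_L1: "integrable lborel (\<lambda>\<xi>. (2 * pi * \<i> * complex_of_real \<xi>) ^ n * g \<xi>)"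
proof -
  define P where "P n = (\<Prod>k=1..n. moment_ratio (2 * pi * exp 6) \<alpha> k)" for n
  have [measurable]: "Theta \<in> borel_measurable borel" unfolding Theta_def by measurable
  have pw: "(2 * pi * \<bar>\<xi>\<bar>) ^ n \<le> P n * exp (\<alpha> * Theta \<xi>)" for n \<xi>
  proof -
    have "Theta \<bar>\<xi>\<bar> = Theta \<xi>" by (simp add: Theta_def)
    hence "(2 * pi * \<bar>\<xi>\<bar>) ^ n * exp (- \<alpha> * Theta \<xi>) \<le> P n"
      using moment_bound[OF \<alpha>, of "\<bar>\<xi>\<bar>" n] by (simp add: P_def)
    thus ?thesis by (simp add: exp_minus field_simps)
  qed
  have L2: "(\<integral>\<^sup>+\<xi>. ennreal ((cmod ((2 * pi * \<i> * complex_of_real \<xi>) ^ n * g \<xi>))\<^sup>2) \<partial>lborel)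
      \<le> ennreal ((P n)\<^sup>2 * V)" for n
  proof -
    have "(\<integral>\<^sup>+\<xi>. ennreal ((cmod ((2 * pi * \<i> * complex_of_real \<xi>) ^ n * g \<xi>))\<^sup>2) \<partial>lborel)
      \<le> (\<integral>\<^sup>+\<xi>. ennreal ((P n)\<^sup>2) * ennreal ((cmod (g \<xi>) * exp (\<alpha> * Theta \<xi>))\<^sup>2) \<partial>lborel)"
    proof (intro nn_integral_mono)
      fix \<xi> :: real
      have "cmod ((2 * pi * \<i> * complex_of_real \<xi>) ^ n * g \<xi>) = (2 * pi * \<bar>\<xi>\<bar>) ^ n * cmod (g \<xi>)"
        by (simp add: norm_mult norm_power)
      also have "\<dots> \<le> P n * exp (\<alpha> * Theta \<xi>) * cmod (g \<xi>)" by (intro mult_right_mono pw) simp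
      finally have "(cmod ((2 * pi * \<i> * complex_of_real \<xi>) ^ n * g \<xi>))\<^sup>2 \<le> (P n * (cmod (g \<xi>) * exp (\<alpha> * Theta \<xi>)))\<^sup>2"
        by (intro power_mono) (simp_all add: mult_ac)
      also have "\<dots> = (P n)\<^sup>2 * (cmod (g \<xi>) * exp (\<alpha> * Theta \<xi>))\<^sup>2" by (rule power_mult_distrib)
      finally show "ennreal ((cmod ((2 * pi * \<i> * complex_of_real \<xi>) ^ n * g \<xi>))\<^sup>2)
        \<le> ennreal ((P n)\<^sup>2) * ennreal ((cmod (g \<xi>) * exp (\<alpha> * Theta \<xi>))\<^sup>2)"
        by (simp add: ennreal_leI flip: ennreal_mult)
    qed
    also have "\<dots> = ennreal ((P n)\<^sup>2) * (\<integral>\<^sup>+\<xi>. ennreal ((cmod (g \<xi>) * exp (\<alpha> * Theta \<xi>))\<^sup>2) \<partial>lborel)"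
      by (intro nn_integral_cmult) measurable
    also have "\<dots> \<le> ennreal ((P n)\<^sup>2) * ennreal V" by (intro mult_left_mono w) simp
    also have "\<dots> = ennreal ((P n)\<^sup>2 * V)" using V by (simp add: ennreal_mult)
    finally show ?thesis .
  qed
  from L2[of n] show "(\<integral>\<^sup>+\<xi>. ennreal ((cmod ((2 * pi * \<i> * complex_of_real \<xi>) ^ n * g \<xi>))\<^sup>2) \<partial>lborel)
      \<le> ennreal ((\<Prod>k=1..n. moment_ratio (2 * pi * exp 6) \<alpha> k)\<^sup>2 * V)" by (simp add: P_def)
  have sqi: "integrable lborel (\<lambda>\<xi>. (cmod ((2 * pi * \<i> * complex_of_real \<xi>) ^ n * g \<xi>))\<^sup>2)" for n
    using L2[of n] by (intro integrableI_bounded) (auto intro: le_less_trans)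
  show "integrable lborel (\<lambda>\<xi>. (2 * pi * \<i> * complex_of_real \<xi>) ^ n * g \<xi>)"
  proof (rule Bochner_Integration.integrable_bound)
    let ?a = "\<lambda>n \<xi>. cmod ((2 * pi * \<i> * complex_of_real \<xi>) ^ n * g \<xi>)"
    show "integrable lborel (\<lambda>\<xi>. (?a n \<xi>)\<^sup>2 + (?a (n + 1) \<xi>)\<^sup>2 + 1 / (1 + \<xi>\<^sup>2))"
      by (intro Bochner_Integration.integrable_add sqi integrable_inverse_square)
    show "AE \<xi> in lborel. norm ((2 * pi * \<i> * complex_of_real \<xi>) ^ n * g \<xi>)
        \<le> norm ((?a n \<xi>)\<^sup>2 + (?a (n + 1) \<xi>)\<^sup>2 + 1 / (1 + \<xi>\<^sup>2))"
    proof (intro AE_I2)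
      fix \<xi> :: real
      define a where "a = ?a n \<xi>"
      have a: "0 \<le> a" by (simp add: a_def)
      have "?a (n + 1) \<xi> = (2 * pi * \<bar>\<xi>\<bar>) * a" by (simp add: a_def norm_mult norm_power)
      moreover have "\<bar>\<xi>\<bar> * a \<le> (2 * pi * \<bar>\<xi>\<bar>) * a"
        using a pi_gt3 by (intro mult_right_mono) (auto simp: mult_le_cancel_right1)
      ultimately have "(\<bar>\<xi>\<bar> * a)\<^sup>2 \<le> (?a (n + 1) \<xi>)\<^sup>2" using a by (intro power_mono) auto
      hence *: "\<xi>\<^sup>2 * a\<^sup>2 \<le> (?a (n + 1) \<xi>)\<^sup>2" by (simp add: power_mult_distrib)
      have p: "0 < 1 + \<xi>\<^sup>2" by (simp add: add_pos_nonneg)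
      \<comment> \<open>AM-GM for a sqrt (1 + \<xi>^2) and 1 / sqrt (1 + \<xi>^2); the term \<xi>^2
        a^2 is covered by the next moment.\<close>
      have "0 \<le> ((1 + \<xi>\<^sup>2) * a - 1)\<^sup>2 / (1 + \<xi>\<^sup>2)" using p by simp
      also have "\<dots> = (1 + \<xi>\<^sup>2) * a\<^sup>2 - 2 * a + 1 / (1 + \<xi>\<^sup>2)"
        using p by (simp add: power2_eq_square field_simps)
      finally have "2 * a \<le> (1 + \<xi>\<^sup>2) * a\<^sup>2 + 1 / (1 + \<xi>\<^sup>2)" by simp
      hence "a \<le> a\<^sup>2 + (?a (n + 1) \<xi>)\<^sup>2 + 1 / (1 + \<xi>\<^sup>2)"
        using * a by (simp add: distrib_right)
      also have "\<dots> \<le> norm (a\<^sup>2 + (?a (n + 1) \<xi>)\<^sup>2 + 1 / (1 + \<xi>\<^sup>2))" by simp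
      finally show "norm ((2 * pi * \<i> * complex_of_real \<xi>) ^ n * g \<xi>)
        \<le> norm ((?a n \<xi>)\<^sup>2 + (?a (n + 1) \<xi>)\<^sup>2 + 1 / (1 + \<xi>\<^sup>2))" unfolding a_def .
    qed
  qed measurable
qed

section \<open>Summation over unit intervals\<close>

lemma nn_integral_split_unit_intervals:
  fixes X :: "real \<Rightarrow> ennreal"
  assumes [measurable]: "X \<in> borel_measurable borel"
  shows "(\<integral>\<^sup>+x. X x \<partial>lborel) = (\<Sum>i. \<integral>\<^sup>+x\<in>{of_int (int_decode i)..<of_int (int_decode i) + 1}. X x \<partial>lborel)"
proof -
  let ?I = "\<lambda>i. {of_int (int_decode i)..<of_int (int_decode i) + 1 :: real}"
  have "x \<in> ?I (int_encode \<lfloor>x\<rfloor>)" for x :: real by simp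
  hence "(\<Union>i. ?I i) = UNIV" by blast
  moreover have "disjoint_family ?I"
  proof (unfold disjoint_family_on_def, intro ballI impI)
    fix i j :: nat assume "i \<noteq> j"
    hence "int_decode i \<noteq> int_decode j" by (metis int_decode_inverse)
    moreover have "\<lfloor>x\<rfloor> = int_decode i" if "x \<in> ?I i" for i x
      using that by (intro floor_unique) auto
    ultimately show "?I i \<inter> ?I j = {}" by fastforce
  qed
  ultimately show ?thesis
    using nn_integral_disjoint_family[of X lborel ?I] by simp
qed

text \<open>Half-open intervals partition the line, while the local estimates, which use
  compactness, are made on closed ones.\<close>

lemma nn_integral_half_open_unit_interval:
  fixes X :: "real \<Rightarrow> ennreal"
  shows "(\<integral>\<^sup>+x\<in>{a..<a+1}. X x \<partial>lborel) = (\<integral>\<^sup>+x\<in>{a..a+1}. X x \<partial>lborel)"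
proof (rule nn_integral_cong_AE)
  show "AE x in lborel. X x * indicator {a..<a+1} x = X x * indicator {a..a+1} x"
    using AE_lborel_singleton[of "a + 1"] by eventually_elim (auto simp: indicator_def)
qed

text \<open>An interval is bad when its share of \<open>\<Sum>n. |F n|\<^sup>2 / (4 ^ (n + 1) (C P\<^sub>n)\<^sup>2)\<close> exceeds its
  share of \<open>|F 0|\<^sup>2\<close>; by the choice of the weights bad intervals carry at most a third of the mass.\<close>

lemma unit_interval_estimate:
  fixes F :: "nat \<Rightarrow> real \<Rightarrow> complex"
  assumes d: "\<And>n x. (F n has_vector_derivative F (Suc n) x) (at x)"
    and \<alpha>: "0 < \<alpha>" "\<alpha> \<le> 1" and B: "1 \<le> B" and C: "1 < C"
    and P_def: "P = (\<lambda>n. \<Prod>k=1..n. moment_ratio B \<alpha> k)"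
    and H_def: "H = (\<lambda>x. \<Sum>n. ennreal ((cmod (F n x))\<^sup>2 / (4 ^ (n + 1) * (C * P n)\<^sup>2)))"
    and fin: "(\<integral>\<^sup>+x\<in>{a..a+1}. ennreal ((cmod (F 0 x))\<^sup>2) \<partial>lborel) < \<infinity>"
    and KN: "K \<le> N" and K: "exp (- real K) * (8 * C * moment_ratio B \<alpha> 1) < 1"
    and S: "1 \<le> (\<Sum>n=K..<N. 1 / (exp 1 * (2 * moment_ratio B \<alpha> (n + 2))))"
    and n0: "2 * (2 * moment_ratio B \<alpha> (N + 2)) * exp (real N) \<le> real n0"
    and E: "E \<in> sets borel" "ennreal \<gamma> \<le> emeasure lborel (E \<inter> {a..a+1})"
    and \<gamma>: "0 < \<gamma>" "\<gamma> < 1"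
    and \<eta>_def: "\<eta> = \<gamma> / 2 * (exp (- real N) / 2 * (\<gamma> / (real n0 * 2 ^ (N + 2))) ^ N)\<^sup>2"
  shows "ennreal \<eta> * (\<integral>\<^sup>+x\<in>{a..a+1}. ennreal ((cmod (F 0 x))\<^sup>2) \<partial>lborel)
     \<le> ennreal \<eta> * (\<integral>\<^sup>+x\<in>{a..a+1}. H x \<partial>lborel)
       + (\<integral>\<^sup>+x\<in>E \<inter> {a..a+1}. ennreal ((cmod (F 0 x))\<^sup>2) \<partial>lborel)"
proof -
  define q where "q = (\<integral>\<^sup>+x\<in>{a..a+1}. ennreal ((cmod (F 0 x))\<^sup>2) \<partial>lborel)"
  define s where "s = sqrt (enn2real q)"
  have qs: "q = ennreal (s\<^sup>2)" using fin by (simp add: s_def q_def)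
  have cont: "continuous_on S (F n)" for n S using d by (rule continuous_of_vector_derivative)
  have [measurable]: "F n \<in> borel_measurable borel" for n
    by (intro borel_measurable_continuous_onI cont)
  have mr: "1 \<le> moment_ratio B \<alpha> k" if "1 \<le> k" for k using moment_ratio_ge_1[OF \<alpha> B that] .
  have P1: "1 \<le> P n" for n unfolding P_def by (intro prod_ge_1) (auto intro: mr)
  have PS: "P (Suc n) = P n * moment_ratio B \<alpha> (Suc n)" for n by (simp add: P_def)
  have s0: "0 \<le> s" by (simp add: s_def)
  \<comment> \<open>A bad interval pays for its mass with the H term, a good one with its mass on E.
    Both terms stand on the right-hand side, so no distinction survives into the sum.\<close>
  consider "s = 0" | "q \<le> (\<integral>\<^sup>+x\<in>{a..a+1}. H x \<partial>lborel)"
    | "s > 0" "(\<integral>\<^sup>+x\<in>{a..a+1}. H x \<partial>lborel) \<le> q" using s0 by fastforce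
  hence "ennreal \<eta> * q \<le> ennreal \<eta> * (\<integral>\<^sup>+x\<in>{a..a+1}. H x \<partial>lborel)
       + (\<integral>\<^sup>+x\<in>E \<inter> {a..a+1}. ennreal ((cmod (F 0 x))\<^sup>2) \<partial>lborel)"
  proof cases
    case 1 thus ?thesis by (simp add: qs)
  next
    case 2
    from mult_left_mono[OF this, of "ennreal \<eta>"] show ?thesis by (simp add: add_increasing2)
  next
    case 3
    \<comment> \<open>T n is read off from the n-th weight of H: on a good interval each single term
      of H has integral at most q. T n + T (n + 1) is at most 6 * 2^n * C * P (n + 1), hence below m
      n; using P (n + 1) in m makes its ratio exactly
      \<open>2 * moment_ratio B \<alpha> (n + 2)\<close>.\<close>
    define T where "T n = 2 ^ (n + 1) * C * P n" for n
    define m where "m n = 8 * C * 2 ^ n * P (Suc n)" for n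
    have T: "0 < T n" for n using P1[of n] C by (simp add: T_def)
    have Ts: "(\<integral>\<^sup>+x\<in>{a..a+1}. ennreal ((cmod (F n x))\<^sup>2) \<partial>lborel) \<le> ennreal ((T n * s)\<^sup>2)" for n
    proof -
      have T2: "(T n)\<^sup>2 = 4 ^ (n + 1) * (C * P n)\<^sup>2"
      proof -
        have "((2::real) ^ (n + 1))\<^sup>2 = (2\<^sup>2) ^ (n + 1)" by (simp only: power_mult[symmetric] mult.commute)
        thus ?thesis unfolding T_def mult.assoc power_mult_distrib[of "2 ^ (n + 1)"] by simp
      qed
      have "(\<integral>\<^sup>+x\<in>{a..a+1}. ennreal ((cmod (F n x))\<^sup>2) \<partial>lborel)
        = (\<integral>\<^sup>+x. ennreal ((T n)\<^sup>2) * (ennreal ((cmod (F n x))\<^sup>2 / (T n)\<^sup>2) * indicator {a..a+1} x) \<partial>lborel)"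
        using T[of n] by (intro nn_integral_cong) (auto simp: indicator_def simp flip: ennreal_mult)
      also have "\<dots> = ennreal ((T n)\<^sup>2) * (\<integral>\<^sup>+x\<in>{a..a+1}. ennreal ((cmod (F n x))\<^sup>2 / (T n)\<^sup>2) \<partial>lborel)"
        by (intro nn_integral_cmult) measurable
      also have "\<dots> \<le> ennreal ((T n)\<^sup>2) * (\<integral>\<^sup>+x\<in>{a..a+1}. H x \<partial>lborel)"
      proof (intro mult_left_mono nn_integral_mono mult_right_mono)
        fix x
        define t where "t n = ennreal ((cmod (F n x))\<^sup>2 / (4 ^ (n + 1) * (C * P n)\<^sup>2))" for n
        have "sum t {n} \<le> suminf t" by (intro sum_le_suminf summableI) auto
        thus "ennreal ((cmod (F n x))\<^sup>2 / (T n)\<^sup>2) \<le> H x" unfolding H_def T2 t_def by simp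
      qed auto
      also have "\<dots> \<le> ennreal ((T n)\<^sup>2) * q" using 3 by (intro mult_left_mono) auto
      also have "\<dots> = ennreal ((T n * s)\<^sup>2)" by (simp add: qs power_mult_distrib ennreal_mult)
      finally show ?thesis .
    qed
    have "ennreal (\<gamma> / 2 * (exp (- real N) / 2 * (\<gamma> / (real n0 * 2 ^ (N + 2))) ^ N)\<^sup>2 * s\<^sup>2)
       \<le> (\<integral>\<^sup>+x\<in>E \<inter> {a..a+1}. ennreal ((cmod (F 0 x))\<^sup>2) \<partial>lborel)"
    proof (rule local_lower_bound[where T = T and m = m and K = K and R = "\<lambda>n. 2 * moment_ratio B \<alpha> (n + 2)"])
      show "T n + T (Suc n) \<le> m n" for n
      proof -
        have "P n * 1 \<le> P (Suc n)" unfolding PS using P1[of n] by (intro mult_left_mono mr) auto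
        hence "2 ^ (n + 1) * C * P n \<le> 2 ^ (n + 1) * C * P (Suc n)" using C by (intro mult_left_mono) auto
        moreover have "0 \<le> C * P (Suc n)" using C P1[of "Suc n"] by simp
        ultimately show ?thesis by (simp add: T_def m_def)
      qed
      show "m (Suc n) \<le> m n * (2 * moment_ratio B \<alpha> (n + 2))" for n
        by (simp add: m_def PS[of "Suc n"])
      show "mono m"
      proof (rule incseq_SucI)
        fix n
        have "m n * 1 \<le> m n * (2 * moment_ratio B \<alpha> (n + 2))"
          using C P1[of "Suc n"] mr[of "n + 2"] by (intro mult_left_mono) (auto simp: m_def)
        also have "\<dots> = m (Suc n)" by (simp add: m_def PS[of "Suc n"])
        finally show "m n \<le> m (Suc n)" by simp
      qed
      have m0: "m 0 = 8 * C * moment_ratio B \<alpha> 1" by (simp add: m_def P_def)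
      have "1 * 1 \<le> (8 * C) * moment_ratio B \<alpha> 1" using C by (intro mult_mono mr) auto
      thus "1 \<le> m 0" by (simp add: m0)
      show "exp (- real K) * m 0 < 1" using K by (simp add: m0)
      show "mono (\<lambda>n. 2 * moment_ratio B \<alpha> (n + 2))"
        using \<alpha> B by (intro monoI mult_left_mono moment_ratio_mono) auto
      show "0 < 2 * moment_ratio B \<alpha> (n + 2)" for n using mr[of "n + 2"] by simp
      show "(\<integral>\<^sup>+x\<in>{a..a+1}. ennreal ((cmod (F 0 x))\<^sup>2) \<partial>lborel) = ennreal (s\<^sup>2)" using qs by (simp add: q_def)
    qed (fact d 3(1) Ts T KN S n0 E \<gamma> refl)+
    hence "ennreal (\<eta> * s\<^sup>2) \<le> (\<integral>\<^sup>+x\<in>E \<inter> {a..a+1}. ennreal ((cmod (F 0 x))\<^sup>2) \<partial>lborel)"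
      unfolding \<eta>_def .
    moreover have "ennreal (\<eta> * s\<^sup>2) = ennreal \<eta> * q"
      unfolding qs using \<gamma> by (intro ennreal_mult) (auto simp: \<eta>_def)
    ultimately have "ennreal \<eta> * q \<le> (\<integral>\<^sup>+x\<in>E \<inter> {a..a+1}. ennreal ((cmod (F 0 x))\<^sup>2) \<partial>lborel)"
      by simp
    thus ?thesis by (simp add: add_increasing)
  qed
  thus ?thesis by (simp add: q_def)
qed

text \<open>The weights in H cancel the bounds on the derivatives and leave the series of 4^-(n +
  1), so H has at most a third of the total mass. Adding \<open>unit_interval_estimate\<close> over
  all intervals and moving that third to the left leaves 2 / 3.\<close>

lemma global_estimate:
  fixes F :: "nat \<Rightarrow> real \<Rightarrow> complex"
  assumes d: "\<And>n x. (F n has_vector_derivative F (Suc n) x) (at x)"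
    and \<alpha>: "0 < \<alpha>" "\<alpha> \<le> 1" and B: "1 \<le> B" and C: "1 < C"
    and S2: "(\<integral>\<^sup>+x. ennreal ((cmod (F 0 x))\<^sup>2) \<partial>lborel) = ennreal S2" "0 \<le> S2"
    and Fn: "\<And>n. (\<integral>\<^sup>+x. ennreal ((cmod (F n x))\<^sup>2) \<partial>lborel)
        \<le> ennreal ((\<Prod>k=1..n. moment_ratio B \<alpha> k)\<^sup>2 * (C\<^sup>2 * S2))"
    and KN: "K \<le> N" and K: "exp (- real K) * (8 * C * moment_ratio B \<alpha> 1) < 1"
    and S: "1 \<le> (\<Sum>n=K..<N. 1 / (exp 1 * (2 * moment_ratio B \<alpha> (n + 2))))"
    and n0: "2 * (2 * moment_ratio B \<alpha> (N + 2)) * exp (real N) \<le> real n0"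
    and E: "E \<in> sets borel" "\<And>a. ennreal \<gamma> \<le> emeasure lborel (E \<inter> {a..a+1})"
    and \<gamma>: "0 < \<gamma>" "\<gamma> < 1"
    and \<eta>_def: "\<eta> = \<gamma> / 2 * (exp (- real N) / 2 * (\<gamma> / (real n0 * 2 ^ (N + 2))) ^ N)\<^sup>2"
    and Y: "(\<integral>\<^sup>+x\<in>E. ennreal ((cmod (F 0 x))\<^sup>2) \<partial>lborel) = ennreal Y" "0 \<le> Y"
  shows "\<eta> * (2 / 3 * S2) \<le> Y"
proof -
  define P where "P = (\<lambda>n. \<Prod>k=1..n. moment_ratio B \<alpha> k)"
  define H where "H = (\<lambda>x. \<Sum>n. ennreal ((cmod (F n x))\<^sup>2 / (4 ^ (n + 1) * (C * P n)\<^sup>2)))"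
  have cont: "continuous_on S (F n)" for n S using d by (rule continuous_of_vector_derivative)
  have [measurable]: "F n \<in> borel_measurable borel" for n
    by (intro borel_measurable_continuous_onI cont)
  have Hm [measurable]: "H \<in> borel_measurable borel" unfolding H_def by measurable
  note Em [measurable] = E(1)
  have P1: "1 \<le> P n" for n unfolding P_def by (intro prod_ge_1) (auto intro: moment_ratio_ge_1[OF \<alpha> B])
  have \<eta>0: "0 \<le> \<eta>" using \<gamma> by (simp add: \<eta>_def)
  let ?X = "\<lambda>x. ennreal ((cmod (F 0 x))\<^sup>2)"
  let ?I = "\<lambda>i. {of_int (int_decode i)..<of_int (int_decode i) + 1 :: real}"
  have HS: "(\<integral>\<^sup>+x. H x \<partial>lborel) \<le> ennreal (S2 / 3)"
  proof -
    have "(\<integral>\<^sup>+x. H x \<partial>lborel) = (\<Sum>n. \<integral>\<^sup>+x. ennreal ((cmod (F n x))\<^sup>2 / (4 ^ (n + 1) * (C * P n)\<^sup>2)) \<partial>lborel)"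
      unfolding H_def by (intro nn_integral_suminf) measurable
    also have "\<dots> \<le> (\<Sum>n. ennreal (S2 * (1 / 4) ^ (n + 1)))"
    proof (intro suminf_le allI summableI)
      fix n
      define c where "c = 1 / (4 ^ (n + 1) * (C * P n)\<^sup>2)"
      have c: "0 \<le> c" by (simp add: c_def)
      have "(\<integral>\<^sup>+x. ennreal ((cmod (F n x))\<^sup>2 / (4 ^ (n + 1) * (C * P n)\<^sup>2)) \<partial>lborel)
        = (\<integral>\<^sup>+x. ennreal c * ennreal ((cmod (F n x))\<^sup>2) \<partial>lborel)"
        using c by (intro nn_integral_cong) (simp add: c_def flip: ennreal_mult)
      also have "\<dots> = ennreal c * (\<integral>\<^sup>+x. ennreal ((cmod (F n x))\<^sup>2) \<partial>lborel)"
        by (intro nn_integral_cmult) measurable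
      also have "\<dots> \<le> ennreal c * ennreal ((P n)\<^sup>2 * (C\<^sup>2 * S2))"
        unfolding P_def by (intro mult_left_mono Fn) simp
      also have "\<dots> = ennreal (c * ((P n)\<^sup>2 * (C\<^sup>2 * S2)))" using c S2 by (simp add: ennreal_mult)
      also have "c * ((P n)\<^sup>2 * (C\<^sup>2 * S2)) = S2 * (1 / 4) ^ (n + 1)"
        using P1[of n] C by (simp add: c_def power_mult_distrib power_divide)
      finally show "(\<integral>\<^sup>+x. ennreal ((cmod (F n x))\<^sup>2 / (4 ^ (n + 1) * (C * P n)\<^sup>2)) \<partial>lborel)
        \<le> ennreal (S2 * (1 / 4) ^ (n + 1))" .
    qed
    also have "\<dots> = ennreal (S2 / 3)"
    proof (rule suminf_ennreal_eq)
      have "(\<lambda>n. S2 / 4 * (1 / 4) ^ n) sums (S2 / 4 * (1 / (1 - 1 / 4)))"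
        by (intro sums_mult geometric_sums) simp
      thus "(\<lambda>n. S2 * (1 / 4) ^ (n + 1)) sums (S2 / 3)" by simp
    qed (use S2 in auto)
    finally show ?thesis .
  qed
  have "ennreal \<eta> * ennreal S2 = ennreal \<eta> * (\<Sum>i. \<integral>\<^sup>+x\<in>?I i. ?X x \<partial>lborel)"
    unfolding S2(1)[symmetric] by (subst nn_integral_split_unit_intervals) auto
  also have "\<dots> = (\<Sum>i. ennreal \<eta> * (\<integral>\<^sup>+x\<in>?I i. ?X x \<partial>lborel))"
    by (rule ennreal_suminf_cmult[symmetric])
  also have "\<dots> \<le> (\<Sum>i. ennreal \<eta> * (\<integral>\<^sup>+x\<in>?I i. H x \<partial>lborel) + (\<integral>\<^sup>+x\<in>?I i. ?X x * indicator E x \<partial>lborel))"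
  proof (intro suminf_le allI summableI)
    fix i
    define a where "a = real_of_int (int_decode i)"
    have "(\<integral>\<^sup>+x\<in>{a..a+1}. ?X x \<partial>lborel) \<le> (\<integral>\<^sup>+x. ?X x \<partial>lborel)"
      by (intro nn_integral_mono) (auto simp: indicator_def)
    hence fin: "(\<integral>\<^sup>+x\<in>{a..a+1}. ?X x \<partial>lborel) < \<infinity>" using S2 by (auto intro: le_less_trans)
    have "(\<integral>\<^sup>+x\<in>E \<inter> {a..a+1}. ?X x \<partial>lborel) = (\<integral>\<^sup>+x\<in>{a..a+1}. ?X x * indicator E x \<partial>lborel)"
      by (intro nn_integral_cong) (auto simp: indicator_def)
    thus "ennreal \<eta> * (\<integral>\<^sup>+x\<in>?I i. ?X x \<partial>lborel)
       \<le> ennreal \<eta> * (\<integral>\<^sup>+x\<in>?I i. H x \<partial>lborel) + (\<integral>\<^sup>+x\<in>?I i. ?X x * indicator E x \<partial>lborel)"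
      unfolding nn_integral_half_open_unit_interval a_def[symmetric]
      using unit_interval_estimate[OF d \<alpha> B C P_def H_def fin KN K S n0 E \<gamma> \<eta>_def] by simp
  qed
  also have "\<dots> = (\<Sum>i. ennreal \<eta> * (\<integral>\<^sup>+x\<in>?I i. H x \<partial>lborel)) + (\<Sum>i. \<integral>\<^sup>+x\<in>?I i. ?X x * indicator E x \<partial>lborel)"
    by (intro suminf_add[symmetric] summableI)
  also have "\<dots> = ennreal \<eta> * (\<integral>\<^sup>+x. H x \<partial>lborel) + (\<integral>\<^sup>+x. ?X x * indicator E x \<partial>lborel)"
    by (simp add: ennreal_suminf_cmult nn_integral_split_unit_intervals[of H]
        nn_integral_split_unit_intervals[of "\<lambda>x. ?X x * indicator E x"])
  also have "\<dots> \<le> ennreal \<eta> * ennreal (S2 / 3) + ennreal Y"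
    unfolding Y(1) by (intro add_right_mono mult_left_mono HS) simp
  also have "ennreal \<eta> * ennreal (S2 / 3) = ennreal (\<eta> * (S2 / 3))"
    using \<eta>0 S2 by (intro ennreal_mult[symmetric]) auto
  also have "\<dots> + ennreal Y = ennreal (\<eta> * (S2 / 3) + Y)"
    using \<eta>0 S2 Y by (intro ennreal_plus[symmetric]) auto
  finally have "ennreal (\<eta> * S2) \<le> ennreal (\<eta> * (S2 / 3) + Y)" using \<eta>0 S2 by (simp add: ennreal_mult)
  moreover have "0 \<le> \<eta> * (S2 / 3) + Y" using \<eta>0 S2 Y by simp
  ultimately have "\<eta> * S2 \<le> \<eta> * (S2 / 3) + Y" by (subst (asm) ennreal_le_iff)
  thus ?thesis by (simp add: algebra_simps)
qed

section \<open>Construction of the derivatives of f and conclusion\<close>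

lemma W_powr: "W \<bar>\<xi>\<bar> powr \<alpha> = exp (\<alpha> * Theta \<xi>)"
  by (simp add: W_def Theta_def powr_def)

text \<open>F n is the inverse transform of (2 pi i \<xi>)^n times the transform of f:
  differentiation follows from integrable moments, F 0 is f by inversion, and the norms come from
  \<open>plancherel_le\<close> and the weighted moments.\<close>

lemma weighted_derivative_family:
  assumes four: "has_fourier_L2 f g" and f: "f' \<in> borel_measurable borel" "AE x in lborel. f x = f' x"
    "integrable lborel (\<lambda>x. (cmod (f' x))\<^sup>2)"
    and \<alpha>: "0 < \<alpha>" "\<alpha> \<le> 1" and V: "0 \<le> V"
    and w: "(\<integral>\<^sup>+ \<xi>. ennreal ((cmod (g \<xi> * complex_of_real (W \<bar>\<xi>\<bar> powr \<alpha>)))\<^sup>2) \<partial>lebesgue) \<le> ennreal V"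
  obtains F :: "nat \<Rightarrow> real \<Rightarrow> complex"
  where "\<And>n x. (F n has_vector_derivative F (Suc n) x) (at x)" "AE x in lborel. f' x = F 0 x"
    "\<And>n. (\<integral>\<^sup>+x. ennreal ((cmod (F n x))\<^sup>2) \<partial>lborel)
        \<le> ennreal ((\<Prod>k=1..n. moment_ratio (2 * pi * exp 6) \<alpha> k)\<^sup>2 * V)"
proof -
  have gm: "g \<in> borel_measurable lebesgue" using four by (simp add: has_fourier_L2_def in_L2_def)
  obtain g' where g' [measurable]: "g' \<in> borel_measurable borel" and gg: "AE x in lborel. g x = g' x"
    using lebesgue_measurable_borel_representative[OF gm] by blast
  have [measurable]: "Theta \<in> borel_measurable borel" unfolding Theta_def by measurable
  have "(\<integral>\<^sup>+\<xi>. ennreal ((cmod (g' \<xi>) * exp (\<alpha> * Theta \<xi>))\<^sup>2) \<partial>lborel)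
      = (\<integral>\<^sup>+\<xi>. ennreal ((cmod (g' \<xi>) * exp (\<alpha> * Theta \<xi>))\<^sup>2) \<partial>lebesgue)"
    by (intro nn_integral_completion[symmetric]) measurable
  also have "\<dots> = (\<integral>\<^sup>+ \<xi>. ennreal ((cmod (g \<xi> * complex_of_real (W \<bar>\<xi>\<bar> powr \<alpha>)))\<^sup>2) \<partial>lebesgue)"
    using AE_completion[OF gg] by (intro nn_integral_cong_AE) (auto simp: W_powr norm_mult)
  finally have w': "(\<integral>\<^sup>+\<xi>. ennreal ((cmod (g' \<xi>) * exp (\<alpha> * Theta \<xi>))\<^sup>2) \<partial>lborel) \<le> ennreal V"
    using w by simp
  define G where "G n = (\<lambda>\<xi>. (2 * pi * \<i> * complex_of_real \<xi>) ^ n * g' \<xi>)" for n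
  have Gi: "integrable lborel (G n)" for n
    unfolding G_def by (rule weighted_moments_L1[OF \<alpha> g' V w'])
  \<comment> \<open>Multiplying by \<xi> only raises the index up to a constant, so the first and
    second moments demanded for differentiation are integrable along with G (n + 1) and G (n +
    2).\<close>
  have up: "complex_of_real \<xi> * G n \<xi> = (1 / (2 * pi * \<i>)) * G (Suc n) \<xi>" for n \<xi>
    by (simp add: G_def)
  define F where "F n = osc_integral (2 * pi) (G n)" for n
  show thesis
  proof (rule that[of F])
    fix n x
    have "complex_of_real \<xi> ^ 2 * G n \<xi> = (1 / (2 * pi * \<i>)) * ((1 / (2 * pi * \<i>)) * G (Suc (Suc n)) \<xi>)" for \<xi>
    proof -
      have "complex_of_real \<xi> ^ 2 * G n \<xi> = complex_of_real \<xi> * (complex_of_real \<xi> * G n \<xi>)"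
        by (simp add: power2_eq_square mult.assoc)
      also have "\<dots> = (1 / (2 * pi * \<i>)) * (complex_of_real \<xi> * G (Suc n) \<xi>)" by (simp add: up[of \<xi> n])
      finally show ?thesis by (simp only: up)
    qed
    hence "integrable lborel (\<lambda>\<xi>. complex_of_real \<xi> * G n \<xi>)" "integrable lborel (\<lambda>\<xi>. complex_of_real \<xi> ^ 2 * G n \<xi>)"
      using Gi by (simp_all only: up integrable_mult_right)
    note D = osc_integral_has_vector_derivative[OF Gi this, of "2 * pi" x]
    have "(\<lambda>\<xi>. \<i> * complex_of_real (2 * pi) * (complex_of_real \<xi> * G n \<xi>)) = G (Suc n)"
      by (simp add: G_def fun_eq_iff)
    thus "(F n has_vector_derivative F (Suc n) x) (at x)" using D by (simp add: F_def)
  next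
    have "integrable lborel g'" using Gi[of 0] by (simp add: G_def)
    from fourier_inversion_AE[OF four f this gg] show "AE x in lborel. f' x = F 0 x"
      by (simp add: F_def G_def)
  next
    fix n
    have "(\<integral>\<^sup>+x. ennreal ((cmod (F n x))\<^sup>2) \<partial>lborel) \<le> (\<integral>\<^sup>+\<xi>. ennreal ((cmod (G n \<xi>))\<^sup>2) \<partial>lborel)"
      unfolding F_def by (rule plancherel_le[OF Gi])
    also have "\<dots> \<le> ennreal ((\<Prod>k=1..n. moment_ratio (2 * pi * exp 6) \<alpha> k)\<^sup>2 * V)"
      unfolding G_def by (rule weighted_moments_L2[OF \<alpha> g' V w'])
    finally show "(\<integral>\<^sup>+x. ennreal ((cmod (F n x))\<^sup>2) \<partial>lborel)
        \<le> ennreal ((\<Prod>k=1..n. moment_ratio (2 * pi * exp 6) \<alpha> k)\<^sup>2 * V)" .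
  qed
qed

text \<open>Links the Bochner integral over \<open>lebesgue\<close> in the norm with the extended
  integrals over \<open>lborel\<close> of the estimates; square integrability rules out the default
  value 0.\<close>

lemma L2_norm_on_square:
  assumes f: "in_L2 f" and f': "f' \<in> borel_measurable borel" "AE x in lborel. f x = f' x" and E: "E \<in> sets borel"
  shows "ennreal ((L2_norm_on E f)\<^sup>2) = (\<integral>\<^sup>+x\<in>E. ennreal ((cmod (f' x))\<^sup>2) \<partial>lborel)"
    and "integrable lborel (\<lambda>x. (cmod (f' x))\<^sup>2)"
proof -
  note [measurable] = f'(1) E
  have fm: "f \<in> borel_measurable lebesgue" using f by (simp add: in_L2_def)
  have f'm: "f' \<in> borel_measurable lebesgue" by (intro measurable_completion) simp
  have "integrable lebesgue (\<lambda>x. (cmod (f' x))\<^sup>2)"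
    using f AE_completion[OF f'(2)] fm f'm unfolding in_L2_def
    by (subst integrable_cong_AE[where g = "\<lambda>x. (cmod (f x))\<^sup>2"]) auto
  thus i: "integrable lborel (\<lambda>x. (cmod (f' x))\<^sup>2)" by (subst (asm) integrable_completion) auto
  hence iE: "integrable lborel (\<lambda>x. indicator E x *\<^sub>R (cmod (f' x))\<^sup>2)"
    by (intro integrable_mult_indicator) auto
  have EL: "indicat_real E \<in> borel_measurable lebesgue"
    by (intro measurable_completion) simp
  have "(LINT x:E|lebesgue. (cmod (f x))\<^sup>2) = (LINT x|lebesgue. indicator E x *\<^sub>R (cmod (f' x))\<^sup>2)"
    unfolding set_lebesgue_integral_def using AE_completion[OF f'(2)] fm f'm
    by (intro integral_cong_AE) (auto intro!: borel_measurable_times EL)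
  also have "\<dots> = (LINT x|lborel. indicator E x *\<^sub>R (cmod (f' x))\<^sup>2)"
    by (intro integral_completion) measurable
  finally have eq: "(LINT x:E|lebesgue. (cmod (f x))\<^sup>2) = (LINT x|lborel. indicator E x *\<^sub>R (cmod (f' x))\<^sup>2)" .
  have "(L2_norm_on E f)\<^sup>2 = (LINT x|lborel. indicator E x *\<^sub>R (cmod (f' x))\<^sup>2)"
    unfolding L2_norm_on_def eq by (intro real_sqrt_pow2) (auto intro!: Bochner_Integration.integral_nonneg)
  also have "ennreal \<dots> = (\<integral>\<^sup>+x. ennreal (indicator E x *\<^sub>R (cmod (f' x))\<^sup>2) \<partial>lborel)"
    using iE by (intro nn_integral_eq_integral[symmetric]) auto
  also have "\<dots> = (\<integral>\<^sup>+x\<in>E. ennreal ((cmod (f' x))\<^sup>2) \<partial>lborel)"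
    by (intro nn_integral_cong) (auto simp: indicator_def)
  finally show "ennreal ((L2_norm_on E f)\<^sup>2) = (\<integral>\<^sup>+x\<in>E. ennreal ((cmod (f' x))\<^sup>2) \<partial>lborel)" .
qed

lemma L2_norm_on_nonneg: "0 \<le> L2_norm_on E f"
  unfolding L2_norm_on_def set_lebesgue_integral_def
  by (auto intro!: Bochner_Integration.integral_nonneg)

theorem proposition1p4:
  "\<exists>A::real. A > 0 \<and>
     (\<forall>(\<gamma>::real) (\<alpha>::real) (C\<^sub>W::real) (f::real \<Rightarrow> complex) (fhat::real \<Rightarrow> complex) (E::real set).
        0 < \<gamma> \<and> \<gamma> < 1 \<and> 0 < \<alpha> \<and> \<alpha> \<le> 1 \<and> C\<^sub>W > 1 \<and>
        in_L2 f \<and> has_fourier_L2 f fhat \<and>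
        (\<integral>\<^sup>+ \<xi>. ennreal ((cmod (fhat \<xi> * complex_of_real (W \<bar>\<xi>\<bar> powr \<alpha>)))\<^sup>2) \<partial>lebesgue)
          \<le> ennreal (C\<^sub>W\<^sup>2 * (L2_norm_on UNIV f)\<^sup>2) \<and>
        relatively_dense \<gamma> E \<longrightarrow>
        L2_norm_on UNIV f
          \<le> (A / \<gamma>) powr (ln (A * C\<^sub>W) powr exp (A / \<alpha>)) * L2_norm_on E f)"
proof -
  \<comment> \<open>The constant of \<open>moment_bound\<close>.\<close>
  define B where "B = 2 * pi * exp (6::real)"
  have B: "1 \<le> B"
  proof -
    have "1 * 1 \<le> (2 * pi) * exp (6::real)" using pi_gt3 by (intro mult_mono) auto
    thus ?thesis by (simp add: B_def)
  qed
  obtain A where A: "1 \<le> A" and choice: "\<And>\<gamma> \<alpha> C. 0 < \<gamma> \<Longrightarrow> \<gamma> < 1 \<Longrightarrow> 0 < \<alpha> \<Longrightarrow> \<alpha> \<le> 1 \<Longrightarrow> 1 < C \<Longrightarrow>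
      \<exists>K N n0::nat. K \<le> N \<and> exp (- real K) * (8 * C * moment_ratio B \<alpha> 1) < 1 \<and>
        1 \<le> (\<Sum>n=K..<N. 1 / (exp 1 * (2 * moment_ratio B \<alpha> (n + 2)))) \<and>
        2 * (2 * moment_ratio B \<alpha> (N + 2)) * exp (real N) \<le> real n0 \<and>
        3 / 2 \<le> \<gamma> / 2 * (exp (- real N) / 2 * (\<gamma> / (real n0 * 2 ^ (N + 2))) ^ N)\<^sup>2
                 * ((A / \<gamma>) powr (ln (A * C) powr exp (A / \<alpha>)))\<^sup>2"
    using parameter_choice[OF B] by metis
  show ?thesis
  proof (intro exI[of _ A] conjI allI impI)
    show "A > 0" using A by simp
    fix \<gamma> \<alpha> C :: real and f g :: "real \<Rightarrow> complex" and E :: "real set"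
    assume H: "0 < \<gamma> \<and> \<gamma> < 1 \<and> 0 < \<alpha> \<and> \<alpha> \<le> 1 \<and> C > 1 \<and> in_L2 f \<and> has_fourier_L2 f g \<and>
        (\<integral>\<^sup>+ \<xi>. ennreal ((cmod (g \<xi> * complex_of_real (W \<bar>\<xi>\<bar> powr \<alpha>)))\<^sup>2) \<partial>lebesgue)
          \<le> ennreal (C\<^sup>2 * (L2_norm_on UNIV f)\<^sup>2) \<and> relatively_dense \<gamma> E"
    hence \<gamma>: "0 < \<gamma>" "\<gamma> < 1" and \<alpha>: "0 < \<alpha>" "\<alpha> \<le> 1" and C: "1 < C" and f: "in_L2 f"
      and four: "has_fourier_L2 f g" and rel: "relatively_dense \<gamma> E"
      and w: "(\<integral>\<^sup>+ \<xi>. ennreal ((cmod (g \<xi> * complex_of_real (W \<bar>\<xi>\<bar> powr \<alpha>)))\<^sup>2) \<partial>lebesgue)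
          \<le> ennreal (C\<^sup>2 * (L2_norm_on UNIV f)\<^sup>2)"
      by auto
    define Q where "Q = (A / \<gamma>) powr (ln (A * C) powr exp (A / \<alpha>))"
    define S where "S = L2_norm_on UNIV f"
    define Y where "Y = L2_norm_on E f"
    have S0: "0 \<le> S" and Y0: "0 \<le> Y" unfolding S_def Y_def by (rule L2_norm_on_nonneg)+
    have Eb: "E \<in> sets borel" using rel by (simp add: relatively_dense_def)
    have EI: "ennreal \<gamma> \<le> emeasure lborel (E \<inter> {a..a+1})" for a
    proof -
      have "ennreal \<gamma> \<le> emeasure lebesgue (E \<inter> {a..a+1})"
        using rel unfolding relatively_dense_def by (simp add: is_interval_cc)
      thus ?thesis using Eb by simp
    qed
    obtain f' where f': "f' \<in> borel_measurable borel" "AE x in lborel. f x = f' x"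
      using lebesgue_measurable_borel_representative[of f] f by (auto simp: in_L2_def)
    have f2: "integrable lborel (\<lambda>x. (cmod (f' x))\<^sup>2)" by (rule L2_norm_on_square(2)[OF f f' Eb])
    have V: "0 \<le> C\<^sup>2 * S\<^sup>2" by simp
    obtain F where F: "\<And>n x. (F n has_vector_derivative F (Suc n) x) (at x)" "AE x in lborel. f' x = F 0 x"
      "\<And>n. (\<integral>\<^sup>+x. ennreal ((cmod (F n x))\<^sup>2) \<partial>lborel)
        \<le> ennreal ((\<Prod>k=1..n. moment_ratio B \<alpha> k)\<^sup>2 * (C\<^sup>2 * S\<^sup>2))"
      by (rule weighted_derivative_family[OF four f' f2 \<alpha> V w[folded S_def], folded B_def]) blast
    have norms: "(\<integral>\<^sup>+x\<in>D. ennreal ((cmod (F 0 x))\<^sup>2) \<partial>lborel) = ennreal ((L2_norm_on D f)\<^sup>2)"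
      if "D \<in> sets borel" for D
      unfolding L2_norm_on_square(1)[OF f f' that] using F(2) by (intro nn_integral_cong_AE) auto
    obtain K N n0 :: nat where KN: "K \<le> N" and K: "exp (- real K) * (8 * C * moment_ratio B \<alpha> 1) < 1"
      and sum: "1 \<le> (\<Sum>n=K..<N. 1 / (exp 1 * (2 * moment_ratio B \<alpha> (n + 2))))"
      and n0: "2 * (2 * moment_ratio B \<alpha> (N + 2)) * exp (real N) \<le> real n0"
      and large: "3 / 2 \<le> \<gamma> / 2 * (exp (- real N) / 2 * (\<gamma> / (real n0 * 2 ^ (N + 2))) ^ N)\<^sup>2 * Q\<^sup>2"
      using choice[OF \<gamma> \<alpha> C] unfolding Q_def by blast
    define \<eta> where "\<eta> = \<gamma> / 2 * (exp (- real N) / 2 * (\<gamma> / (real n0 * 2 ^ (N + 2))) ^ N)\<^sup>2"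
    have est: "\<eta> * (2 / 3 * S\<^sup>2) \<le> Y\<^sup>2"
    proof (rule global_estimate[OF F(1) \<alpha> B C _ _ F(3) KN K sum n0 Eb EI \<gamma> \<eta>_def])
      show "(\<integral>\<^sup>+x. ennreal ((cmod (F 0 x))\<^sup>2) \<partial>lborel) = ennreal (S\<^sup>2)"
        using norms[of UNIV] by (simp add: S_def)
      show "(\<integral>\<^sup>+x\<in>E. ennreal ((cmod (F 0 x))\<^sup>2) \<partial>lborel) = ennreal (Y\<^sup>2)"
        using norms[OF Eb] by (simp add: Y_def)
    qed auto
    \<comment> \<open>The 3 / 2 supplied by \<open>parameter_choice\<close> undoes the 2 / 3 in
      \<open>est\<close>.\<close>
    have "S\<^sup>2 = (2 / 3 * S\<^sup>2) * (3 / 2)" by simp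
    also have "\<dots> \<le> (2 / 3 * S\<^sup>2) * (\<eta> * Q\<^sup>2)"
      using large unfolding \<eta>_def by (intro mult_left_mono) auto
    also have "\<dots> = \<eta> * (2 / 3 * S\<^sup>2) * Q\<^sup>2" by (simp add: mult_ac)
    also have "\<dots> \<le> Y\<^sup>2 * Q\<^sup>2" by (intro mult_right_mono est) simp
    also have "\<dots> = (Q * Y)\<^sup>2" by (simp add: power_mult_distrib)
    finally have "S \<le> Q * Y"
      by (rule power2_le_imp_le) (use Y0 in \<open>simp add: Q_def\<close>)
    thus "L2_norm_on UNIV f \<le> (A / \<gamma>) powr (ln (A * C) powr exp (A / \<alpha>)) * L2_norm_on E f"
      by (simp add: S_def Y_def Q_def)
  qed
qed

end
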